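(* The right Quillen adjoint $\mathcal{M}\mathbf{dTop}^{\mathbf{sat}}\subset\mathcal{M}\mathbf{dTop}$ between the q-model structures is a right Quillen equivalence such that the unit and the counit of the adjunction are isomorphisms on q-cofibrant objects.
   Context: $\mathbf{Top}$ denotes either the category of $\Delta$-generated spaces (spaces whose topology is final with respect to all continuous maps from $[0,1]$) or its full subcategory of $\Delta$-Hausdorff ones (the image of every continuous map from $[0,1]$ is closed), with its q-model (Quillen) structure. The $\Delta$-kelleyfication of a space is the same set with the final topology with respect to all continuous maps from $[0,1]$; $\mathbf{TOP}(U,V)$ is the set of continuous maps with the $\Delta$-kelleyfication of the compact-open topology. $\mathcal{M}(1,1)$ is the set of nondecreasing surjective maps from $[0,1]$ to itself. An $\mathcal{M}$-multipointed $d$-space is a triple $X=(|X|,X^0,\mathbb{P}^{top}X)$ with $|X|\in\mathbf{Top}$, $X^0\subset |X|$ a set (of states), and $\mathbb{P}^{top}X$ a set of continuous maps $[0,1]\to|X|$ (execution paths) such that: $\gamma(0),\gamma(1)\in X^0$ for each execution path; $\gamma\phi$ is an execution path for each execution path $\gamma$ and each $\phi\in\mathcal{M}(1,1)$; and if $\gamma_1(1)=\gamma_2(0)$ the normalized composition ($t\mapsto\gamma_1(2t)$ for $t\le 1/2$, $t\mapsto\gamma_2(2t-1)$ for $t\geq 1/2$) is an execution path. Maps are continuous maps $|X|\to|Y|$ sending states to states and execution paths to execution paths. The category is $\mathcal{M}\mathbf{dTop}$. $\mathbb{P}^{top}_{\alpha,\beta}X$ is the set of execution paths from $\alpha$ to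 $\beta$ with the $\Delta$-kelleyfication of the relative topology from $\mathbf{TOP}([0,1],|X|)$, and $\mathbb{P}^{top}X=\coprod_{(\alpha,\beta)}\mathbb{P}^{top}_{\alpha,\beta}X$. $X$ is saturated if every continuous map $\gamma:[0,1]\to|X|$ such that $\gamma\phi\in\mathbb{P}^{top}X$ for some $\phi\in\mathcal{M}(1,1)$ belongs to $\mathbb{P}^{top}X$. $\mathcal{M}\mathbf{dTop}^{\mathbf{sat}}$ is the full subcategory of saturated objects; the inclusion into $\mathcal{M}\mathbf{dTop}$ is a right adjoint. In the q-model structures of both $\mathcal{M}\mathbf{dTop}$ and $\mathcal{M}\mathbf{dTop}^{\mathbf{sat}}$, the weak equivalences are the maps $f$ with $f^0:X^0\to Y^0$ bijective and $\mathbb{P}^{top}f$ a weak homotopy equivalence and the fibrations are the maps with $\mathbb{P}^{top}f$ a q-fibration (Serre fibration). q-cofibrant means cofibrant in the q-model structure. *)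

theory Defs
  imports "HOL-Analysis.Analysis" "HOL-Library.Equipollence"
begin

record ('o, 'a) cat =
  Obj :: "'o set"
  Arr :: "'a set"
  Src :: "'a \<Rightarrow> 'o"
  Tgt :: "'a \<Rightarrow> 'o"
  Idt :: "'o \<Rightarrow> 'a"
  Cmp :: "'a \<Rightarrow> 'a \<Rightarrow> 'a"  \<comment> \<open>\<open>Cmp C g f\<close> is \<open>g\<close> after \<open>f\<close>\<close>

definition Hom :: "('o, 'a, 'z) cat_scheme \<Rightarrow> 'o \<Rightarrow> 'o \<Rightarrow> 'a set" where
  "Hom C x y = {f \<in> Arr C. Src C f = x \<and> Tgt C f = y}"

definition category :: "('o, 'a, 'z) cat_scheme \<Rightarrow> bool" where
  "category C \<longleftrightarrow>
     (\<forall>f \<in> Arr C. Src C f \<in> Obj C \<and> Tgt C f \<in> Obj C) \<and>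
     (\<forall>x \<in> Obj C. Idt C x \<in> Hom C x x) \<and>
     (\<forall>x y z f g. f \<in> Hom C x y \<and> g \<in> Hom C y z \<longrightarrow> Cmp C g f \<in> Hom C x z) \<and>
     (\<forall>x y f. f \<in> Hom C x y \<longrightarrow> Cmp C f (Idt C x) = f \<and> Cmp C (Idt C y) f = f) \<and>
     (\<forall>w x y z f g h. f \<in> Hom C w x \<and> g \<in> Hom C x y \<and> h \<in> Hom C y z \<longrightarrow>
        Cmp C h (Cmp C g f) = Cmp C (Cmp C h g) f)"

definition iso_arr :: "('o, 'a, 'z) cat_scheme \<Rightarrow> 'a \<Rightarrow> bool" where
  "iso_arr C f \<longleftrightarrow> f \<in> Arr C \<and>
     (\<exists>g \<in> Hom C (Tgt C f) (Src C f).
        Cmp C g f = Idt C (Src C f) \<and> Cmp C f g = Idt C (Tgt C f))"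

definition initial_obj :: "('o, 'a, 'z) cat_scheme \<Rightarrow> 'o \<Rightarrow> bool" where
  "initial_obj C i \<longleftrightarrow> i \<in> Obj C \<and> (\<forall>x \<in> Obj C. \<exists>!f. f \<in> Hom C i x)"

definition terminal_obj :: "('o, 'a, 'z) cat_scheme \<Rightarrow> 'o \<Rightarrow> bool" where
  "terminal_obj C t \<longleftrightarrow> t \<in> Obj C \<and> (\<forall>x \<in> Obj C. \<exists>!f. f \<in> Hom C x t)"

definition full_subcat :: "('o, 'a) cat \<Rightarrow> 'o set \<Rightarrow> ('o, 'a) cat" where
  "full_subcat C S = C\<lparr>Obj := Obj C \<inter> S, Arr := {f \<in> Arr C. Src C f \<in> S \<and> Tgt C f \<in> S}\<rparr>"

record ('o1, 'a1, 'o2, 'a2) fnctr =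
  OMap :: "'o1 \<Rightarrow> 'o2"
  AMap :: "'a1 \<Rightarrow> 'a2"

definition is_functor ::
  "('o1, 'a1, 'z1) cat_scheme \<Rightarrow> ('o2, 'a2, 'z2) cat_scheme \<Rightarrow> ('o1, 'a1, 'o2, 'a2) fnctr \<Rightarrow> bool" where
  "is_functor C D F \<longleftrightarrow>
     (\<forall>x \<in> Obj C. OMap F x \<in> Obj D \<and> AMap F (Idt C x) = Idt D (OMap F x)) \<and>
     (\<forall>x y f. f \<in> Hom C x y \<longrightarrow> AMap F f \<in> Hom D (OMap F x) (OMap F y)) \<and>
     (\<forall>x y z f g. f \<in> Hom C x y \<and> g \<in> Hom C y z \<longrightarrow>
        AMap F (Cmp C g f) = Cmp D (AMap F g) (AMap F f))"

definition inclusion :: "('o, 'a, 'o, 'a) fnctr" where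
  "inclusion = \<lparr>OMap = id, AMap = id\<rparr>"

text \<open>\<open>F : C \<rightarrow> D\<close> is left adjoint to \<open>G : D \<rightarrow> C\<close>, with unit \<open>\<eta>\<close> and counit \<open>\<epsilon>\<close>
  (naturality and the two triangle identities).\<close>

definition adjunction ::
  "('o1, 'a1, 'z1) cat_scheme \<Rightarrow> ('o2, 'a2, 'z2) cat_scheme \<Rightarrow>
   ('o1, 'a1, 'o2, 'a2) fnctr \<Rightarrow> ('o2, 'a2, 'o1, 'a1) fnctr \<Rightarrow>
   ('o1 \<Rightarrow> 'a1) \<Rightarrow> ('o2 \<Rightarrow> 'a2) \<Rightarrow> bool" where
  "adjunction C D F G \<eta> \<epsilon> \<longleftrightarrow>
     category C \<and> category D \<and> is_functor C D F \<and> is_functor D C G \<and>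
     (\<forall>x \<in> Obj C. \<eta> x \<in> Hom C x (OMap G (OMap F x))) \<and>
     (\<forall>x y f. f \<in> Hom C x y \<longrightarrow> Cmp C (\<eta> y) f = Cmp C (AMap G (AMap F f)) (\<eta> x)) \<and>
     (\<forall>x \<in> Obj D. \<epsilon> x \<in> Hom D (OMap F (OMap G x)) x) \<and>
     (\<forall>x y f. f \<in> Hom D x y \<longrightarrow> Cmp D (\<epsilon> y) (AMap F (AMap G f)) = Cmp D f (\<epsilon> x)) \<and>
     (\<forall>x \<in> Obj C. Cmp D (\<epsilon> (OMap F x)) (AMap F (\<eta> x)) = Idt D (OMap F x)) \<and>
     (\<forall>x \<in> Obj D. Cmp C (AMap G (\<epsilon> x)) (\<eta> (OMap G x)) = Idt C (OMap G x))"

record ('o, 'a) model_cat = "('o, 'a) cat" +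
  Weq :: "'a set"
  Fib :: "'a set"
  Cof :: "'a set"

definition has_llp :: "('o, 'a, 'z) cat_scheme \<Rightarrow> 'a \<Rightarrow> 'a \<Rightarrow> bool" where
  "has_llp C i p \<longleftrightarrow>
     (\<forall>u \<in> Hom C (Src C i) (Src C p). \<forall>v \<in> Hom C (Tgt C i) (Tgt C p).
        Cmp C p u = Cmp C v i \<longrightarrow>
        (\<exists>h \<in> Hom C (Tgt C i) (Src C p). Cmp C h i = u \<and> Cmp C p h = v))"

text \<open>A model structure is determined by its weak equivalences and its fibrations: the
  cofibrations are the arrows with the left lifting property against the trivial fibrations.\<close>

definition model_cat_of :: "('o, 'a) cat \<Rightarrow> 'a set \<Rightarrow> 'a set \<Rightarrow> ('o, 'a) model_cat" where
  "model_cat_of C W B =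
     \<lparr>Obj = Obj C, Arr = Arr C, Src = Src C, Tgt = Tgt C, Idt = Idt C, Cmp = Cmp C,
      Weq = W, Fib = B, Cof = {i \<in> Arr C. \<forall>p \<in> W \<inter> B. has_llp C i p}\<rparr>"

definition cofibrant :: "('o, 'a, 'z) model_cat_scheme \<Rightarrow> 'o \<Rightarrow> bool" where
  "cofibrant M x \<longleftrightarrow> (\<exists>i f. initial_obj M i \<and> f \<in> Hom M i x \<and> f \<in> Cof M)"

definition fibrant :: "('o, 'a, 'z) model_cat_scheme \<Rightarrow> 'o \<Rightarrow> bool" where
  "fibrant M x \<longleftrightarrow> (\<exists>t f. terminal_obj M t \<and> f \<in> Hom M x t \<and> f \<in> Fib M)"

definition right_quillen_functor ::
  "('o2, 'a2, 'z2) model_cat_scheme \<Rightarrow> ('o1, 'a1, 'z1) model_cat_scheme \<Rightarrow>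
   ('o2, 'a2, 'o1, 'a1) fnctr \<Rightarrow> bool" where
  "right_quillen_functor N M G \<longleftrightarrow>
     (\<exists>F \<eta> \<epsilon>. adjunction M N F G \<eta> \<epsilon>) \<and>
     AMap G ` Fib N \<subseteq> Fib M \<and>
     AMap G ` (Fib N \<inter> Weq N) \<subseteq> Fib M \<inter> Weq M"

text \<open>The arrow \<open>Cmp M (AMap G f) (\<eta> x)\<close> is the adjunct \<open>x \<rightarrow> G y\<close> of \<open>f : F x \<rightarrow> y\<close>.\<close>

definition right_quillen_equivalence ::
  "('o2, 'a2, 'z2) model_cat_scheme \<Rightarrow> ('o1, 'a1, 'z1) model_cat_scheme \<Rightarrow>
   ('o2, 'a2, 'o1, 'a1) fnctr \<Rightarrow> bool" where
  "right_quillen_equivalence N M G \<longleftrightarrow>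
     right_quillen_functor N M G \<and>
     (\<forall>F \<eta> \<epsilon>. adjunction M N F G \<eta> \<epsilon> \<longrightarrow>
        (\<forall>x y f. cofibrant M x \<and> fibrant N y \<and> f \<in> Hom N (OMap F x) y \<longrightarrow>
           (f \<in> Weq N \<longleftrightarrow> Cmp M (AMap G f) (\<eta> x) \<in> Weq M)))"


definition delta_kelley :: "'u topology \<Rightarrow> 'u topology" where
  "delta_kelley X = topology (\<lambda>U. U \<subseteq> topspace X \<and>
     (\<forall>p. pathin X p \<longrightarrow> openin (top_of_set {0..1}) {t \<in> {0..1}. p t \<in> U}))"

lemma openin_delta_kelley:
  "openin (delta_kelley X) U \<longleftrightarrow> U \<subseteq> topspace X \<and>
     (\<forall>p. pathin X p \<longrightarrow> openin (top_of_set {0..1}) {t \<in> {0..1}. p t \<in> U})"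
proof -
  let ?P = "\<lambda>U. U \<subseteq> topspace X \<and>
     (\<forall>p. pathin X p \<longrightarrow> openin (top_of_set {0..1}) {t \<in> {0..1}. p t \<in> U})"
  have "istopology ?P"
    unfolding istopology_def
  proof (intro conjI allI impI)
    fix S T p assume *: "?P S" "?P T" and p: "pathin X p"
    have "{t \<in> {0..1}. p t \<in> S \<inter> T} = {t \<in> {0..1}. p t \<in> S} \<inter> {t \<in> {0..1}. p t \<in> T}"
      by auto
    with * p show "openin (top_of_set {0..1}) {t \<in> {0..1}. p t \<in> S \<inter> T}"
      by (simp add: openin_Int)
  next
    fix K p assume *: "\<forall>S\<in>K. ?P S" and p: "pathin X p"
    have "{t \<in> {0..1}. p t \<in> \<Union>K} = (\<Union>S\<in>K. {t \<in> {0..1}. p t \<in> S})"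
      by auto
    with * p show "openin (top_of_set {0..1}) {t \<in> {0..1}. p t \<in> \<Union>K}"
      by (simp add: openin_clauses(3))
  qed auto
  then show ?thesis
    by (simp add: delta_kelley_def)
qed

definition Delta_generated_spaces :: "'u topology set" where
  "Delta_generated_spaces = {X. delta_kelley X = X}"

definition Delta_Hausdorff_spaces :: "'u topology set" where
  "Delta_Hausdorff_spaces =
     {X \<in> Delta_generated_spaces. \<forall>p. pathin X p \<longrightarrow> closedin X (p ` {0..1})}"

text \<open>Maps are kept extensional, so that they are determined by their values on the domain.\<close>

definition cmaps :: "'a topology \<Rightarrow> 'b topology \<Rightarrow> ('a \<Rightarrow> 'b) set" where
  "cmaps U V = {f \<in> extensional (topspace U). continuous_map U V f}"

definition compact_open :: "'a topology \<Rightarrow> 'b topology \<Rightarrow> ('a \<Rightarrow> 'b) topology" where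
  "compact_open U V = topology_generated_by
     {{f \<in> cmaps U V. f ` K \<subseteq> W} |K W. compactin U K \<and> openin V W}"

definition TOP_space :: "'a topology \<Rightarrow> 'b topology \<Rightarrow> ('a \<Rightarrow> 'b) topology" where
  "TOP_space U V = delta_kelley (compact_open U V)"


text \<open>Disks and spheres are replaced by cubes and their boundaries; the quotient by
  \<open>loop_homotopy\<close> also identifies maps that differ only outside the cube.\<close>

definition cube :: "nat \<Rightarrow> (nat \<Rightarrow> real) topology" where
  "cube n = product_topology (\<lambda>_. top_of_set {0..1}) {..<n}"

definition cube_boundary :: "nat \<Rightarrow> (nat \<Rightarrow> real) set" where
  "cube_boundary n = {z \<in> topspace (cube n). \<exists>i<n. z i = 0 \<or> z i = 1}"

definition serre_fibration :: "'a topology \<Rightarrow> 'b topology \<Rightarrow> ('a \<Rightarrow> 'b) \<Rightarrow> bool" where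
  "serre_fibration X Y f \<longleftrightarrow> continuous_map X Y f \<and>
     (\<forall>n g h. continuous_map (cube n) X g \<and>
        continuous_map (prod_topology (cube n) (top_of_set {0..1::real})) Y h \<and>
        (\<forall>z \<in> topspace (cube n). h (z, 0) = f (g z)) \<longrightarrow>
        (\<exists>k. continuous_map (prod_topology (cube n) (top_of_set {0..1::real})) X k \<and>
           (\<forall>z \<in> topspace (cube n). k (z, 0) = g z) \<and>
           (\<forall>z \<in> topspace (cube n). \<forall>t \<in> {0..1}. f (k (z, t)) = h (z, t))))"

definition loop_maps :: "nat \<Rightarrow> 'a topology \<Rightarrow> 'a \<Rightarrow> ((nat \<Rightarrow> real) \<Rightarrow> 'a) set" where
  "loop_maps n X x = {g. continuous_map (cube n) X g \<and> g ` cube_boundary n \<subseteq> {x}}"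

definition loop_homotopy ::
  "nat \<Rightarrow> 'a topology \<Rightarrow> 'a \<Rightarrow> (((nat \<Rightarrow> real) \<Rightarrow> 'a) \<times> ((nat \<Rightarrow> real) \<Rightarrow> 'a)) set" where
  "loop_homotopy n X x = {(g, h). g \<in> loop_maps n X x \<and> h \<in> loop_maps n X x \<and>
     homotopic_with (\<lambda>k. k ` cube_boundary n \<subseteq> {x}) (cube n) X g h}"

definition homotopy_group :: "nat \<Rightarrow> 'a topology \<Rightarrow> 'a \<Rightarrow> ((nat \<Rightarrow> real) \<Rightarrow> 'a) set set" where
  "homotopy_group n X x = loop_maps n X x // loop_homotopy n X x"

definition homotopy_group_map ::
  "nat \<Rightarrow> 'b topology \<Rightarrow> ('a \<Rightarrow> 'b) \<Rightarrow> 'a \<Rightarrow> ((nat \<Rightarrow> real) \<Rightarrow> 'a) set \<Rightarrow> ((nat \<Rightarrow> real) \<Rightarrow> 'b) set" where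
  "homotopy_group_map n Y f x c = (\<Union>g \<in> c. loop_homotopy n Y (f x) `` {f \<circ> g})"

text \<open>The map induced on \<open>\<pi>\<^sub>n\<close> is always a group homomorphism for \<open>n \<ge> 1\<close>, so it is an
  isomorphism iff it is bijective; the group structure is therefore not needed.\<close>

definition weak_homotopy_equivalence :: "'a topology \<Rightarrow> 'b topology \<Rightarrow> ('a \<Rightarrow> 'b) \<Rightarrow> bool" where
  "weak_homotopy_equivalence X Y f \<longleftrightarrow> continuous_map X Y f \<and>
     bij_betw (\<lambda>c. \<Union>x \<in> c. path_component_of_set Y (f x))
       (path_components_of X) (path_components_of Y) \<and>
     (\<forall>n \<ge> 1. \<forall>x \<in> topspace X.
        bij_betw (homotopy_group_map n Y f x) (homotopy_group n X x) (homotopy_group n Y (f x)))"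


definition M11 :: "(real \<Rightarrow> real) set" where
  "M11 = {\<phi>. mono_on {0..1} \<phi> \<and> \<phi> ` {0..1} = {0..1}}"

record 'u mdspace =
  und :: "'u topology"
  states :: "'u set"
  expaths :: "(real \<Rightarrow> 'u) set"

definition ncomp :: "(real \<Rightarrow> 'u) \<Rightarrow> (real \<Rightarrow> 'u) \<Rightarrow> real \<Rightarrow> 'u" where
  "ncomp \<gamma>1 \<gamma>2 = (\<lambda>t \<in> {0..1}. if t \<le> 1/2 then \<gamma>1 (2 * t) else \<gamma>2 (2 * t - 1))"

text \<open>\<open>compose {0..1} \<gamma> \<phi>\<close> is \<open>\<gamma>\<phi>\<close> as an extensional function on \<open>[0,1]\<close>.\<close>

definition is_mdspace :: "'u topology set \<Rightarrow> 'u mdspace \<Rightarrow> bool" where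
  "is_mdspace Top X \<longleftrightarrow>
     und X \<in> Top \<and> states X \<subseteq> topspace (und X) \<and>
     expaths X \<subseteq> cmaps (top_of_set {0..1}) (und X) \<and>
     (\<forall>\<gamma> \<in> expaths X. \<gamma> 0 \<in> states X \<and> \<gamma> 1 \<in> states X) \<and>
     (\<forall>\<gamma> \<in> expaths X. \<forall>\<phi> \<in> M11. compose {0..1} \<gamma> \<phi> \<in> expaths X) \<and>
     (\<forall>\<gamma>1 \<in> expaths X. \<forall>\<gamma>2 \<in> expaths X. \<gamma>1 1 = \<gamma>2 0 \<longrightarrow> ncomp \<gamma>1 \<gamma>2 \<in> expaths X)"

definition is_mdmap :: "'u mdspace \<Rightarrow> 'u mdspace \<Rightarrow> ('u \<Rightarrow> 'u) \<Rightarrow> bool" where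
  "is_mdmap X Y f \<longleftrightarrow>
     f \<in> cmaps (und X) (und Y) \<and> f ` states X \<subseteq> states Y \<and>
     (\<forall>\<gamma> \<in> expaths X. compose {0..1} f \<gamma> \<in> expaths Y)"

record 'u mdarr =
  mdom :: "'u mdspace"
  mcod :: "'u mdspace"
  mfun :: "'u \<Rightarrow> 'u"

text \<open>\<open>Top\<close> is a class of spaces whose points are taken from the type \<open>'u\<close>, which plays the
  role of the universe of discourse: all objects, including those against which lifting
  properties are tested, have their points in \<open>'u\<close>.\<close>

definition MdTop :: "'u topology set \<Rightarrow> ('u mdspace, 'u mdarr) cat" where
  "MdTop Top =
     \<lparr>Obj = {X. is_mdspace Top X},
      Arr = {a. is_mdspace Top (mdom a) \<and> is_mdspace Top (mcod a) \<and>
                is_mdmap (mdom a) (mcod a) (mfun a)},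
      Src = mdom,
      Tgt = mcod,
      Idt = (\<lambda>X. \<lparr>mdom = X, mcod = X, mfun = (\<lambda>x \<in> topspace (und X). x)\<rparr>),
      Cmp = (\<lambda>b a. \<lparr>mdom = mdom a, mcod = mcod b,
                    mfun = compose (topspace (und (mdom a))) (mfun b) (mfun a)\<rparr>)\<rparr>"

definition saturated :: "'u mdspace \<Rightarrow> bool" where
  "saturated X \<longleftrightarrow>
     (\<forall>\<gamma> \<in> cmaps (top_of_set {0..1}) (und X).
        (\<exists>\<phi> \<in> M11. compose {0..1} \<gamma> \<phi> \<in> expaths X) \<longrightarrow> \<gamma> \<in> expaths X)"

definition MdTop_sat :: "'u topology set \<Rightarrow> ('u mdspace, 'u mdarr) cat" where
  "MdTop_sat Top = full_subcat (MdTop Top) {X. saturated X}"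

definition Ptop_between :: "'u mdspace \<Rightarrow> 'u \<Rightarrow> 'u \<Rightarrow> (real \<Rightarrow> 'u) topology" where
  "Ptop_between X \<alpha> \<beta> = delta_kelley
     (subtopology (TOP_space (top_of_set {0..1}) (und X))
        {\<gamma> \<in> expaths X. \<gamma> 0 = \<alpha> \<and> \<gamma> 1 = \<beta>})"

definition Ptop :: "'u mdspace \<Rightarrow> (('u \<times> 'u) \<times> (real \<Rightarrow> 'u)) topology" where
  "Ptop X = sum_topology (\<lambda>(\<alpha>, \<beta>). Ptop_between X \<alpha> \<beta>) (states X \<times> states X)"

definition Ptop_map :: "('u \<Rightarrow> 'u) \<Rightarrow> ('u \<times> 'u) \<times> (real \<Rightarrow> 'u) \<Rightarrow> ('u \<times> 'u) \<times> (real \<Rightarrow> 'u)" where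
  "Ptop_map f = (\<lambda>((\<alpha>, \<beta>), \<gamma>). ((f \<alpha>, f \<beta>), compose {0..1} f \<gamma>))"

definition q_weq :: "'u mdarr \<Rightarrow> bool" where
  "q_weq a \<longleftrightarrow> bij_betw (mfun a) (states (mdom a)) (states (mcod a)) \<and>
     weak_homotopy_equivalence (Ptop (mdom a)) (Ptop (mcod a)) (Ptop_map (mfun a))"

definition q_fib :: "'u mdarr \<Rightarrow> bool" where
  "q_fib a \<longleftrightarrow> serre_fibration (Ptop (mdom a)) (Ptop (mcod a)) (Ptop_map (mfun a))"

definition q_model :: "('u mdspace, 'u mdarr) cat \<Rightarrow> ('u mdspace, 'u mdarr) model_cat" where
  "q_model C = model_cat_of C {a \<in> Arr C. q_weq a} {a \<in> Arr C. q_fib a}"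

end

theory Submission
  imports Defs
begin

text \<open>
  Saturating a multipointed \<open>d\<close>-space adds execution paths without changing the space or the
  states, so the inclusion of the saturated objects has a left adjoint whose unit and counit are
  identity maps of underlying spaces (\<open>saturation_adjunction\<close>). The two model structures have the
  same weak equivalences and fibrations, and at a saturated object the unit and the counit of any
  adjunction are inverse to each other (\<open>unit_counit_inverse\<close>). Everything therefore follows once
  cofibrant objects of the larger category are known to be saturated
  (\<open>cofibrant_imp_saturated\<close>).

  Saturated objects are stable under retracts. Given a cofibrant \<open>X\<close>, it suffices to find a
  saturated \<open>Z\<close> and a trivial fibration \<open>Z \<rightarrow> X\<close>: the lifting property gives a section. A cellular
  replacement of \<open>X\<close> may have more points than the universe, but \<open>Z\<close> can be written down directly,
  because weak equivalences and fibrations only see the spaces of execution paths. Let \<open>|Z|\<close> be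
  \<open>|X| \<times> \<real>\<^sup>\<nat>\<close> with states \<open>(\<alpha>, 0)\<close>, and let the execution paths be the pairs
  \<open>(\<gamma>, \<omega>) = (\<delta>\<psi>, \<rho>\<psi>)\<close>, where \<open>\<psi>\<close> reparametrizes, \<open>\<delta>\<close> is an execution path of \<open>X\<close> and \<open>\<rho>\<close> is a loop
  at \<open>0\<close> with almost all coordinates zero that is constant on no interval.

  \<^item> \<open>Z\<close> is saturated (\<open>regular_pair_desat\<close>): if \<open>(\<gamma>, \<omega>)\<phi> = (\<delta>, \<rho>)\<psi>\<close>, then \<open>\<psi>\<close> is constant wherever \<open>\<phi>\<close>
    is, since \<open>\<rho>\<close> is nowhere constant; so \<open>\<psi> = \<theta>\<phi>\<close> and \<open>(\<gamma>, \<omega>) = (\<delta>, \<rho>)\<theta>\<close>.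

  \<^item> \<open>Z \<rightarrow> X\<close> is a trivial fibration. Adding \<open>t\<close> times its shift to a loop \<open>\<omega>\<close>, with \<open>s (1 - s)\<close> in
    the coordinate that the shift leaves vacant, gives a deformation that starts at \<open>\<omega>\<close> and
    consists of nowhere constant loops for \<open>t > 0\<close> (\<open>nowhere_constant_regularize\<close>), and a nowhere
    constant loop may accompany any execution path of \<open>X\<close>. So a homotopy in \<open>X\<close> is lifted by
    letting the loop deform at a speed that is positive except where the lift is prescribed.

  Continuity is tested along paths throughout: the spaces involved carry the final topology of
  their paths, the cubes included, and paths of execution paths are jointly continuous families.
\<close>

section \<open>\<Delta>-generated spaces\<close>

abbreviation unit_interval :: "real topology" where
  "unit_interval \<equiv> top_of_set {0..1}"

lemma continuous_map_app: "continuous_map X Y f \<Longrightarrow> x \<in> topspace X \<Longrightarrow> f x \<in> topspace Y"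
  using continuous_map_funspace by blast

lemma topspace_delta_kelley [simp]: "topspace (delta_kelley X) = topspace X"
proof -
  have "openin (delta_kelley X) (topspace X)"
    unfolding openin_delta_kelley
  proof (intro conjI allI impI)
    fix p assume "pathin X p"
    then have "{t \<in> {0..1}. p t \<in> topspace X} = {0..1}"
      by (auto simp: pathin_def continuous_map_def)
    then show "openin unit_interval {t \<in> {0..1}. p t \<in> topspace X}"
      by (metis openin_topspace topspace_euclidean_subtopology)
  qed simp
  then show ?thesis
    by (meson openin_delta_kelley openin_subset openin_topspace subset_antisym)
qed

lemma openin_imp_openin_delta_kelley:
  assumes "openin X U" shows "openin (delta_kelley X) U"
  unfolding openin_delta_kelley
proof (intro conjI allI impI)
  show "U \<subseteq> topspace X" by (simp add: assms openin_subset)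
  fix p assume "pathin X p"
  then show "openin unit_interval {t \<in> {0..1}. p t \<in> U}"
    using assms unfolding pathin_def continuous_map_def by simp
qed

lemma pathin_delta_kelley [simp]: "pathin (delta_kelley X) p \<longleftrightarrow> pathin X p"
proof
  assume "pathin (delta_kelley X) p"
  then show "pathin X p"
    unfolding pathin_def continuous_map_def
    by (auto simp: openin_imp_openin_delta_kelley)
next
  assume p: "pathin X p"
  then show "pathin (delta_kelley X) p"
    unfolding pathin_def continuous_map_def
    by (auto simp: openin_delta_kelley pathin_def continuous_map_def)
qed

lemma delta_kelley_in_Delta_generated: "delta_kelley X \<in> Delta_generated_spaces"
  unfolding Delta_generated_spaces_def
  by (auto simp: topology_eq openin_delta_kelley)

lemma Delta_generated_openI:
  assumes "X \<in> Delta_generated_spaces" "U \<subseteq> topspace X"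
    "\<And>p. pathin X p \<Longrightarrow> openin unit_interval {t \<in> {0..1}. p t \<in> U}"
  shows "openin X U"
proof -
  have "openin (delta_kelley X) U" using assms by (auto simp: openin_delta_kelley)
  then show ?thesis using assms(1) by (simp add: Delta_generated_spaces_def)
qed

text \<open>A \<open>\<Delta>\<close>-generated space carries the final topology of its paths, so continuity may be
  tested along paths. This reduces every continuity question below to a question about
  paths, which do not see the \<open>\<Delta>\<close>-kelleyfications in the definition of the path spaces.\<close>

lemma continuous_map_Delta_generated_iff:
  assumes X: "X \<in> Delta_generated_spaces"
  shows "continuous_map X Y f \<longleftrightarrow> (\<forall>p. pathin X p \<longrightarrow> pathin Y (f \<circ> p))"
proof
  assume "continuous_map X Y f"
  then show "\<forall>p. pathin X p \<longrightarrow> pathin Y (f \<circ> p)" by (auto intro: pathin_compose)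
next
  assume *: "\<forall>p. pathin X p \<longrightarrow> pathin Y (f \<circ> p)"
  have f: "f x \<in> topspace Y" if "x \<in> topspace X" for x
    using *[rule_format, of "\<lambda>_. x"] that by (simp add: o_def)
  show "continuous_map X Y f"
    unfolding continuous_map_def
  proof (intro conjI allI impI)
    show "f \<in> topspace X \<rightarrow> topspace Y" using f by auto
    fix U assume U: "openin Y U"
    show "openin X {x \<in> topspace X. f x \<in> U}"
    proof (rule Delta_generated_openI[OF X])
      fix p assume p: "pathin X p"
      then have "openin unit_interval {t \<in> {0..1}. (f \<circ> p) t \<in> U}"
        using * U unfolding pathin_def continuous_map_def by simp
      moreover have "{t \<in> {0..1}. (f \<circ> p) t \<in> U} = {t \<in> {0..1}. p t \<in> {x \<in> topspace X. f x \<in> U}}"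
        using p by (auto simp: pathin_def continuous_map_def)
      ultimately show "openin unit_interval {t \<in> {0..1}. p t \<in> {x \<in> topspace X. f x \<in> U}}"
        by simp
    qed auto
  qed
qed

lemma continuous_map_into_delta_kelley:
  assumes "X \<in> Delta_generated_spaces"
  shows "continuous_map X (delta_kelley Y) f \<longleftrightarrow> continuous_map X Y f"
  by (simp add: continuous_map_Delta_generated_iff[OF assms])

text \<open>A practical criterion for being \<open>\<Delta>\<close>-generated, designed to be stable under finite
  products: sequences, which detect open sets of a metrizable space, extend to paths. The
  times are the same for all sequences, so that paths in the factors of a product combine.\<close>

definition path_sequential :: "'a topology \<Rightarrow> bool" where
  "path_sequential X \<longleftrightarrow> metrizable_space X \<and>
     (\<forall>\<sigma> x. limitin X \<sigma> x sequentially \<and> range \<sigma> \<subseteq> topspace X \<longrightarrow>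
        (\<exists>p. pathin X p \<and> p 0 = x \<and> (\<forall>n. p (1 / real (Suc n)) = \<sigma> n)))"

lemma path_sequential_imp_Delta_generated:
  assumes "path_sequential X" shows "X \<in> Delta_generated_spaces"
proof -
  obtain M d where M: "Metric_space M d" and X: "X = Metric_space.mtopology M d"
    using assms by (auto simp: path_sequential_def metrizable_space_def)
  interpret Metric_space M d by (fact M)
  have "openin X U" if U: "openin (delta_kelley X) U" for U
  proof (rule ccontr)
    assume "\<not> openin X U"
    moreover have sub: "U \<subseteq> M"
      using U X by (auto simp: openin_delta_kelley)
    ultimately obtain x where x: "x \<in> U" and "\<forall>r>0. \<not> mball x r \<subseteq> U"
      unfolding X openin_mtopology by auto
    then have "\<forall>n. \<exists>y. y \<in> mball x (1 / real (Suc n)) - U"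
      by (metis DiffI of_nat_0_less_iff subsetI zero_less_Suc zero_less_divide_1_iff)
    then obtain \<sigma> where \<sigma>: "\<And>n. \<sigma> n \<in> mball x (1 / real (Suc n)) - U"
      by metis
    have "limitin X \<sigma> x sequentially"
      unfolding X limitin_metric eventually_sequentially
    proof (intro conjI allI impI)
      show "x \<in> M" using x sub by auto
      fix e :: real assume "e > 0"
      then obtain N where N: "1 / real (Suc N) < e" using nat_approx_posE by auto
      show "\<exists>N. \<forall>n\<ge>N. \<sigma> n \<in> M \<and> d (\<sigma> n) x < e"
      proof (intro exI[of _ N] allI impI)
        fix n assume "n \<ge> N"
        then have "1 / real (Suc n) \<le> 1 / real (Suc N)" by (simp add: frac_le)
        then show "\<sigma> n \<in> M \<and> d (\<sigma> n) x < e"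
          using \<sigma>[of n] N by (auto simp: commute)
      qed
    qed
    moreover have "range \<sigma> \<subseteq> topspace X" using \<sigma> X by auto
    ultimately obtain p where p: "pathin X p" "p 0 = x" "\<And>n. p (1 / real (Suc n)) = \<sigma> n"
      using assms unfolding path_sequential_def by blast
    have "openin unit_interval {t \<in> {0..1}. p t \<in> U}"
      using U p(1) by (auto simp: openin_delta_kelley)
    then obtain e where "e > 0" and e: "\<And>t. t \<in> {0..1} \<Longrightarrow> dist t 0 < e \<Longrightarrow> p t \<in> U"
      using p(2) x unfolding openin_euclidean_subtopology_iff
      by (smt (verit) atLeastAtMost_iff mem_Collect_eq)
    obtain n where n: "1 / real (Suc n) < e" using \<open>e > 0\<close> nat_approx_posE by auto
    have "p (1 / real (Suc n)) \<in> U" by (rule e) (use n in auto)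
    then show False using p(3) \<sigma> by auto
  qed
  then have "delta_kelley X = X"
    by (auto simp: topology_eq intro: openin_imp_openin_delta_kelley)
  then show ?thesis by (simp add: Delta_generated_spaces_def)
qed

lemma path_sequential_prod_topology:
  assumes "path_sequential X" "path_sequential Y"
  shows "path_sequential (prod_topology X Y)"
  unfolding path_sequential_def
proof (intro conjI allI impI)
  show "metrizable_space (prod_topology X Y)"
    using assms by (simp add: path_sequential_def metrizable_space_prod_topology)
  fix \<sigma> x assume *: "limitin (prod_topology X Y) \<sigma> x sequentially \<and> range \<sigma> \<subseteq> topspace (prod_topology X Y)"
  then have "range (fst \<circ> \<sigma>) \<subseteq> topspace X" "range (snd \<circ> \<sigma>) \<subseteq> topspace Y"
    by (auto simp: image_subset_iff mem_Times_iff)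
  with * assms obtain p q where "pathin X p" "p 0 = fst x" "\<And>n. p (1 / real (Suc n)) = fst (\<sigma> n)"
    and "pathin Y q" "q 0 = snd x" "\<And>n. q (1 / real (Suc n)) = snd (\<sigma> n)"
    unfolding path_sequential_def limitin_pairwise by (metis comp_apply)
  then show "\<exists>p. pathin (prod_topology X Y) p \<and> p 0 = x \<and> (\<forall>n. p (1 / real (Suc n)) = \<sigma> n)"
    by (intro exI[of _ "\<lambda>t. (p t, q t)"]) (auto simp: pathin_def continuous_map_paired)
qed

lemma path_sequential_product_topology:
  assumes X: "\<And>i. i \<in> I \<Longrightarrow> path_sequential (X i)" and I: "countable I"
  shows "path_sequential (product_topology X I)"
  unfolding path_sequential_def
proof (intro conjI allI impI)
  have "countable {i \<in> I. \<nexists>a. topspace (X i) \<subseteq> {a}}"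
    by (rule countable_subset[OF _ I]) auto
  then show "metrizable_space (product_topology X I)"
    using X by (simp add: path_sequential_def metrizable_space_product_topology)
  fix \<sigma> x
  assume *: "limitin (product_topology X I) \<sigma> x sequentially \<and> range \<sigma> \<subseteq> topspace (product_topology X I)"
  have "\<exists>p. pathin (X i) p \<and> p 0 = x i \<and> (\<forall>n. p (1 / real (Suc n)) = \<sigma> n i)" if i: "i \<in> I" for i
  proof -
    have "range (\<lambda>n. \<sigma> n i) \<subseteq> topspace (X i)" using * i by (auto simp: PiE_iff)
    moreover have "limitin (X i) (\<lambda>n. \<sigma> n i) (x i) sequentially"
      using * i by (auto simp: limitin_componentwise)
    ultimately show ?thesis
      using X[OF i] unfolding path_sequential_def by blast
  qed
  then obtain p where p: "\<And>i. i \<in> I \<Longrightarrow> pathin (X i) (p i)" "\<And>i. i \<in> I \<Longrightarrow> p i 0 = x i"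
    "\<And>i n. i \<in> I \<Longrightarrow> p i (1 / real (Suc n)) = \<sigma> n i"
    by metis
  show "\<exists>p. pathin (product_topology X I) p \<and> p 0 = x \<and> (\<forall>n. p (1 / real (Suc n)) = \<sigma> n)"
  proof (intro exI conjI allI)
    show "pathin (product_topology X I) (\<lambda>t. \<lambda>i\<in>I. p i t)"
      using p(1) unfolding pathin_def continuous_map_componentwise by auto
    show "(\<lambda>i\<in>I. p i 0) = x"
      using * p(2) by (auto simp: fun_eq_iff limitin_componentwise extensional_def)
    show "(\<lambda>i\<in>I. p i (1 / real (Suc n))) = \<sigma> n" for n
    proof -
      have "\<sigma> n \<in> extensional I" using * by (auto simp: PiE_iff image_subset_iff)
      then show ?thesis using p(3) by (auto simp: fun_eq_iff extensional_def)
    qed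
  qed
qed

text \<open>The Tietze theorem extends a convergent sequence of numbers to a path; the points \<open>1 / (n + 1)\<close>
  with their limit \<open>0\<close> form a closed set on which the prescribed values are continuous.\<close>

lemma path_sequential_unit_interval: "path_sequential unit_interval"
  unfolding path_sequential_def
proof (intro conjI allI impI)
  show "metrizable_space unit_interval"
    by (simp add: metrizable_space_euclidean metrizable_space_subtopology)
  fix \<sigma> :: "nat \<Rightarrow> real" and x
  assume *: "limitin unit_interval \<sigma> x sequentially \<and> range \<sigma> \<subseteq> topspace unit_interval"
  then have lim: "\<sigma> \<longlonglongrightarrow> x" and x: "x \<in> {0..1}"
    by (auto simp: limitin_subtopology)
  define r :: "nat \<Rightarrow> real" where "r n = 1 / real (Suc n)" for n
  have "inj r" by (auto simp: inj_def r_def)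
  define S where "S = insert 0 (range r)"
  define f where "f t = (if t = 0 then x else \<sigma> (the_inv r t))" for t
  have f0: "f 0 = x" and fr: "f (r n) = \<sigma> n" for n
    using the_inv_f_f[OF \<open>inj r\<close>] by (auto simp: f_def r_def)
  have "r \<longlonglongrightarrow> 0" unfolding r_def using LIMSEQ_inverse_real_of_nat by (simp add: inverse_eq_divide)
  then have "compact S" unfolding S_def by (rule compact_sequence_with_limit)
  have "continuous_on S f"
    unfolding continuous_on_eq_continuous_within
  proof
    fix t assume "t \<in> S"
    then consider "t = 0" | n where "t = r n" by (auto simp: S_def)
    then show "continuous (at t within S) f"
    proof cases
      case 1
      show ?thesis
        unfolding continuous_within_eps_delta
      proof (intro allI impI)
        fix e :: real assume "e > 0"
        then obtain N where N: "\<And>n. n \<ge> N \<Longrightarrow> dist (\<sigma> n) x < e"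
          using lim by (auto simp: lim_sequentially)
        show "\<exists>d>0. \<forall>x'\<in>S. dist x' t < d \<longrightarrow> dist (f x') (f t) < e"
        proof (intro exI[of _ "r N"] conjI ballI impI)
          show "0 < r N" by (simp add: r_def)
          fix x' assume "x' \<in> S" "dist x' t < r N"
          then consider "x' = 0" | n where "x' = r n" "r n < r N" using 1 by (auto simp: S_def)
          then show "dist (f x') (f t) < e"
          proof cases
            case 2
            then have "n \<ge> N" by (simp add: r_def frac_less2 divide_simps split: if_splits)
            then show ?thesis using N 2 1 f0 fr by simp
          qed (use \<open>e > 0\<close> 1 in auto)
        qed
      qed
    next
      case 2
      have iso: "x' = t" if "x' \<in> S" "dist x' t < r n - r (Suc n)" for x'
      proof -
        have dec: "r k \<ge> r l" if "k \<le> l" for k l using that by (simp add: r_def frac_le)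
        have pos: "r k > 0" for k by (simp add: r_def)
        consider "x' = 0" | m where "x' = r m" "m \<ge> Suc n" | m where "x' = r m" "m < n" | "x' = r n"
        proof -
          have "x' = 0 \<or> (\<exists>m. x' = r m)" using \<open>x' \<in> S\<close> by (auto simp: S_def)
          moreover have "m \<ge> Suc n \<or> m < n \<or> m = n" for m by arith
          ultimately show ?thesis using that by metis
        qed
        then show ?thesis
        proof cases
          case 1 then show ?thesis using that(2) 2 pos[of n] pos[of "Suc n"] by (auto simp: dist_real_def)
        next
          case (2 m) then show ?thesis using that(2) \<open>t = r n\<close> dec[of "Suc n" m] by (auto simp: dist_real_def)
        next
          case (3 m)
          have "r m - r n \<ge> r n - r (Suc n)"
          proof -
            have "r m \<ge> r (n - 1)" by (rule dec) (use 3 in auto)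
            moreover obtain k where k: "n = Suc k" using 3 by (cases n) auto
            moreover have "r k - r (Suc k) \<ge> r (Suc k) - r (Suc (Suc k))"
            proof -
              have step: "r i - r (Suc i) = 1 / ((real i + 1) * (real i + 2))" for i
                unfolding r_def by (simp add: field_simps)
              show ?thesis unfolding step by (intro divide_left_mono mult_mono mult_pos_pos) auto
            qed
            ultimately show ?thesis by simp
          qed
          then show ?thesis using that(2) \<open>t = r n\<close> 3 by (auto simp: dist_real_def)
        qed (use 2 in auto)
      qed
      have "r n - r (Suc n) > 0" by (simp add: r_def frac_less2)
      then show ?thesis
        unfolding continuous_within_eps_delta using iso by (metis dist_self)
    qed
  qed
  moreover have "f ` S \<subseteq> {0..1}"
    using * x f0 fr by (auto simp: S_def)
  moreover have "S \<subseteq> {0..1}" by (auto simp: S_def r_def)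
  moreover have normal: "normal_space unit_interval"
    by (simp add: metrizable_imp_normal_space metrizable_space_euclidean metrizable_space_subtopology)
  moreover have closedS: "closedin unit_interval S"
    using \<open>compact S\<close> \<open>S \<subseteq> {0..1}\<close> by (simp add: closed_subset compact_imp_closed)
  moreover have contf': "continuous_map (subtopology unit_interval S) euclideanreal f"
    using \<open>continuous_on S f\<close> \<open>S \<subseteq> {0..1}\<close> by (simp add: subtopology_subtopology inf.absorb2)
  ultimately obtain g where g: "continuous_map unit_interval euclideanreal g"
    "g ` {0..1} \<subseteq> {0..1}" "\<And>t. t \<in> S \<Longrightarrow> g t = f t"
    using Tietze_extension_realinterval[of unit_interval S "{0..1}" f]
    by (smt (verit) normal closedS contf' empty_iff is_interval_cc topspace_euclidean_subtopology x)
  then have "pathin unit_interval g"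
    by (auto simp: pathin_def continuous_map_in_subtopology)
  moreover have "g 0 = x" "g (1 / real (Suc n)) = \<sigma> n" for n
    using g(3) f0 fr[of n] by (auto simp: S_def r_def)
  ultimately show "\<exists>p. pathin unit_interval p \<and> p 0 = x \<and> (\<forall>n. p (1 / real (Suc n)) = \<sigma> n)"
    by blast
qed

lemma path_sequential_cube: "path_sequential (cube n)"
  unfolding cube_def by (rule path_sequential_product_topology) (auto intro: path_sequential_unit_interval)

lemma unit_interval_Delta_generated: "unit_interval \<in> Delta_generated_spaces"
  by (rule path_sequential_imp_Delta_generated[OF path_sequential_unit_interval])

section \<open>Paths in spaces of execution paths\<close>

lemma topspace_compact_open [simp]: "topspace (compact_open U V) = cmaps U V"
proof -
  have "cmaps U V \<in> {{f \<in> cmaps U V. f ` K \<subseteq> W} |K W. compactin U K \<and> openin V W}"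
    by (intro CollectI exI[of _ "{}"]) auto
  then show ?thesis unfolding compact_open_def topology_generated_by_topspace by blast
qed

text \<open>The exponential law for the compact unit interval: the tube lemma gives one direction,
  the continuity of evaluation, which rests on local compactness, the other.\<close>

lemma continuous_map_compact_open_iff:
  "continuous_map A (compact_open unit_interval Y) q \<longleftrightarrow>
     (\<forall>a \<in> topspace A. q a \<in> extensional {0..1}) \<and>
     continuous_map (prod_topology A unit_interval) Y (\<lambda>(a, u). q a u)"
    (is "?L \<longleftrightarrow> ?E \<and> ?R")
proof
  assume L: ?L
  then have cm: "q a \<in> cmaps unit_interval Y" if "a \<in> topspace A" for a
    using that by (auto simp: continuous_map_def)
  have ?R
    unfolding continuous_map_def
  proof (intro conjI allI impI)
    show "(\<lambda>(a, u). q a u) \<in> topspace (prod_topology A unit_interval) \<rightarrow> topspace Y"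
      using cm by (auto simp: cmaps_def continuous_map_def Pi_iff)
    fix W assume W: "openin Y W"
    show "openin (prod_topology A unit_interval)
        {z \<in> topspace (prod_topology A unit_interval). (\<lambda>(a, u). q a u) z \<in> W}" (is "openin _ ?P")
    proof (subst openin_subopen, intro ballI)
      fix z assume z: "z \<in> ?P"
      then obtain a u where au: "z = (a, u)" "a \<in> topspace A" "u \<in> {0..1}" and qW: "q a u \<in> W" by auto
      have qa: "continuous_map unit_interval Y (q a)" using cm[OF au(2)] by (simp add: cmaps_def)
      have "openin unit_interval {s \<in> {0..1}. q a s \<in> W}"
        using qa W by (auto simp: continuous_map_def)
      then obtain e where "e > 0" and e: "\<And>s. s \<in> {0..1} \<Longrightarrow> dist s u < e \<Longrightarrow> q a s \<in> W"
        using qW au(3) unfolding openin_euclidean_subtopology_iff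
        by (smt (verit) mem_Collect_eq)
      define K where "K = {0..1} \<inter> cball u (e / 2)"
      have K: "compactin unit_interval K"
        by (auto simp: K_def compactin_subtopology compact_Int_closed)
      define U where "U = {f \<in> cmaps unit_interval Y. f ` K \<subseteq> W}"
      have "openin (compact_open unit_interval Y) U"
        unfolding compact_open_def U_def
        by (rule topology_generated_by_Basis) (use K W in auto)
      then have "openin A {a' \<in> topspace A. q a' \<in> U}"
        using L by (auto simp: continuous_map_def)
      moreover have "openin unit_interval ({0..1} \<inter> ball u (e / 2))"
        by auto
      moreover have "a \<in> {a' \<in> topspace A. q a' \<in> U}"
        using au cm e \<open>e > 0\<close> by (auto simp: U_def K_def dist_commute)
      moreover have "u \<in> {0..1} \<inter> ball u (e / 2)" using au \<open>e > 0\<close> by auto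
      ultimately show "\<exists>N. openin (prod_topology A unit_interval) N \<and> z \<in> N \<and> N \<subseteq> ?P"
        by (intro exI[of _ "{a' \<in> topspace A. q a' \<in> U} \<times> ({0..1} \<inter> ball u (e / 2))"])
           (auto simp: openin_prod_Times_iff au U_def K_def image_subset_iff)
    qed
  qed
  then show "?E \<and> ?R" using cm by (auto simp: cmaps_def)
next
  assume *: "?E \<and> ?R"
  have cm: "q a \<in> cmaps unit_interval Y" if "a \<in> topspace A" for a
  proof -
    have "continuous_map unit_interval Y ((\<lambda>(a, u). q a u) \<circ> (\<lambda>u. (a, u)))"
      using * that by (intro continuous_map_compose[of _ "prod_topology A unit_interval"])
        (auto simp: continuous_map_pairwise o_def)
    then show ?thesis using * that by (simp add: cmaps_def o_def)
  qed
  show ?L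
    unfolding compact_open_def
  proof (rule continuous_on_generated_topo)
    fix U assume "U \<in> {{f \<in> cmaps unit_interval Y. f ` K \<subseteq> W} |K W. compactin unit_interval K \<and> openin Y W}"
    then obtain K W where U: "U = {f \<in> cmaps unit_interval Y. f ` K \<subseteq> W}"
      and K: "compactin unit_interval K" and W: "openin Y W" by auto
    define C where "C = (topspace A \<times> K) \<inter>
      {z \<in> topspace (prod_topology A unit_interval). (\<lambda>(a, u). q a u) z \<in> topspace Y - W}"
    have "closedin unit_interval K"
      using K by (simp add: Hausdorff_space_subtopology compactin_imp_closedin)
    then have "closedin (prod_topology A unit_interval) C"
      unfolding C_def using * W
      by (intro closedin_Int closedin_continuous_map_preimage[of _ Y])
         (auto simp: closedin_prod_Times_iff)
    moreover have "closed_map (prod_topology A unit_interval) A fst"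
      by (rule Abstract_Topological_Spaces.closed_map_fst)
         (simp add: compact_space_subtopology)
    ultimately have "closedin A (fst ` C)" by (auto simp: closed_map_def)
    moreover have "q -` U \<inter> topspace A = topspace A - fst ` C"
    proof -
      have K01: "K \<subseteq> {0..1}" using K by (auto simp: compactin_subtopology)
      have *: "q a u \<in> topspace Y" if "a \<in> topspace A" "u \<in> {0..1}" for a u
        using * that unfolding continuous_map_def by (auto simp: Pi_iff)
      have "a \<in> fst ` C \<longleftrightarrow> (\<exists>u \<in> K. q a u \<notin> W)" if "a \<in> topspace A" for a
      proof
        assume "a \<in> fst ` C"
        then obtain u where "(a, u) \<in> C" by auto
        then show "\<exists>u \<in> K. q a u \<notin> W" by (auto simp: C_def)
      next
        assume "\<exists>u \<in> K. q a u \<notin> W"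
        then obtain u where u: "u \<in> K" "q a u \<notin> W" by auto
        then have "q a u \<in> topspace Y" using K01 that by (intro *) auto
        then have "(a, u) \<in> C" using u that K01 by (auto simp: C_def)
        then show "a \<in> fst ` C" by (metis fst_conv image_eqI)
      qed
      then show ?thesis using cm by (auto simp: U)
    qed
    ultimately show "openin A (q -` U \<inter> topspace A)" by auto
  next
    show "q ` topspace A \<subseteq> \<Union>{{f \<in> cmaps unit_interval Y. f ` K \<subseteq> W} |K W. compactin unit_interval K \<and> openin Y W}"
    proof -
      have "\<Union>{{f \<in> cmaps unit_interval Y. f ` K \<subseteq> W} |K W. compactin unit_interval K \<and> openin Y W}
          = cmaps unit_interval Y"
        using topspace_compact_open[of unit_interval Y]
        unfolding compact_open_def topology_generated_by_topspace .
      then show ?thesis using cm by (simp add: image_subset_iff)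
    qed
  qed
qed

text \<open>The conditions on states and execution paths that make \<open>Ptop\<close> well behaved, without the
  closure conditions.\<close>

definition path_data :: "'u mdspace \<Rightarrow> bool" where
  "path_data X \<longleftrightarrow> expaths X \<subseteq> cmaps unit_interval (und X) \<and>
     (\<forall>\<gamma> \<in> expaths X. \<gamma> 0 \<in> states X \<and> \<gamma> 1 \<in> states X)"

lemma is_mdspace_path_data: "is_mdspace Top X \<Longrightarrow> path_data X"
  by (simp add: is_mdspace_def path_data_def)

abbreviation with_ends :: "(real \<Rightarrow> 'u) \<Rightarrow> ('u \<times> 'u) \<times> (real \<Rightarrow> 'u)" where
  "with_ends \<gamma> \<equiv> ((\<gamma> 0, \<gamma> 1), \<gamma>)"

lemma topspace_Ptop_between:
  assumes "path_data X"
  shows "topspace (Ptop_between X \<alpha> \<beta>) = {\<gamma> \<in> expaths X. \<gamma> 0 = \<alpha> \<and> \<gamma> 1 = \<beta>}"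
  using assms by (auto simp: Ptop_between_def TOP_space_def path_data_def)

lemma topspace_Ptop:
  assumes "path_data X" shows "topspace (Ptop X) = with_ends ` expaths X"
  using assms by (auto simp: Ptop_def topspace_Ptop_between[OF assms] path_data_def image_iff)

lemma pathin_Ptop_between:
  assumes X: "path_data X"
  shows "pathin (Ptop_between X \<alpha> \<beta>) q \<longleftrightarrow>
     (\<forall>t \<in> {0..1}. q t \<in> expaths X \<and> q t 0 = \<alpha> \<and> q t 1 = \<beta>) \<and>
     continuous_map (prod_topology unit_interval unit_interval) (und X) (\<lambda>(t, s). q t s)"
proof -
  have "pathin (Ptop_between X \<alpha> \<beta>) q \<longleftrightarrow>
     (\<forall>t \<in> {0..1}. q t \<in> expaths X \<and> q t 0 = \<alpha> \<and> q t 1 = \<beta>) \<and> pathin (compact_open unit_interval (und X)) q"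
    unfolding Ptop_between_def TOP_space_def by (auto simp: pathin_subtopology image_subset_iff)
  moreover have "q t \<in> extensional {0..1}" if "q t \<in> expaths X" for t
    using that X by (auto simp: path_data_def cmaps_def)
  ultimately show ?thesis
    unfolding pathin_def continuous_map_compact_open_iff by auto
qed

lemma Ptop_Delta_generated: "Ptop X \<in> Delta_generated_spaces"
proof -
  have "openin (Ptop X) U" if U: "openin (delta_kelley (Ptop X)) U" for U
    unfolding Ptop_def openin_sum_topology
  proof (intro conjI ballI)
    show sub: "U \<subseteq> Sigma (states X \<times> states X) (topspace \<circ> (\<lambda>(\<alpha>, \<beta>). Ptop_between X \<alpha> \<beta>))"
      using openin_subset[OF U] by (simp add: Ptop_def)
    fix i assume i: "i \<in> states X \<times> states X"
    obtain \<alpha> \<beta> where ab: "i = (\<alpha>, \<beta>)" by fastforce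
    have *: "Ptop_between X \<alpha> \<beta> \<in> Delta_generated_spaces"
      unfolding Ptop_between_def by (rule delta_kelley_in_Delta_generated)
    have "openin (Ptop_between X \<alpha> \<beta>) {x. (i, x) \<in> U}"
    proof (rule Delta_generated_openI[OF *])
      show "{x. (i, x) \<in> U} \<subseteq> topspace (Ptop_between X \<alpha> \<beta>)" using sub ab by auto
      fix p assume p: "pathin (Ptop_between X \<alpha> \<beta>) p"
      have "pathin (Ptop X) ((\<lambda>x. (i, x)) \<circ> p)"
        unfolding Ptop_def
        by (rule pathin_compose[OF p]) (use i ab continuous_map_component_injection[of i "states X \<times> states X" "\<lambda>(\<alpha>, \<beta>). Ptop_between X \<alpha> \<beta>"] in simp)
      then show "openin unit_interval {t \<in> {0..1}. p t \<in> {x. (i, x) \<in> U}}"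
        using U by (auto simp: openin_delta_kelley)
    qed
    then show "openin (case i of (\<alpha>, \<beta>) \<Rightarrow> Ptop_between X \<alpha> \<beta>) {x. (i, x) \<in> U}"
      using ab by simp
  qed
  then have "delta_kelley (Ptop X) = Ptop X"
    by (auto simp: topology_eq intro: openin_imp_openin_delta_kelley)
  then show ?thesis by (simp add: Delta_generated_spaces_def)
qed

text \<open>Paths of execution paths are jointly continuous families with fixed ends: the unit
  interval is connected and therefore stays in one summand of the coproduct.\<close>

lemma pathin_Ptop:
  assumes X: "path_data X"
  shows "pathin (Ptop X) q \<longleftrightarrow>
     (\<forall>t \<in> {0..1}. q t \<in> with_ends ` expaths X \<and> fst (q t) = fst (q 0)) \<and>
     continuous_map (prod_topology unit_interval unit_interval) (und X) (\<lambda>(t, s). snd (q t) s)"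
    (is "?L \<longleftrightarrow> ?E \<and> ?R")
proof -
  let ?S = "states X \<times> states X" and ?B = "\<lambda>(\<alpha>, \<beta>). Ptop_between X \<alpha> \<beta>"
  obtain \<alpha> \<beta> where ab: "fst (q 0) = (\<alpha>, \<beta>)" by fastforce
  have *: "pathin (Ptop_between X \<alpha> \<beta>) (snd \<circ> q) \<longleftrightarrow> ?E \<and> ?R" if "\<forall>t \<in> {0..1}. fst (q t) = (\<alpha>, \<beta>)"
  proof -
    have "snd (q t) \<in> expaths X \<and> snd (q t) 0 = \<alpha> \<and> snd (q t) 1 = \<beta> \<longleftrightarrow>
        q t \<in> with_ends ` expaths X \<and> fst (q t) = fst (q 0)" if "t \<in> {0..1}" for t
      using that \<open>\<forall>t \<in> {0..1}. fst (q t) = (\<alpha>, \<beta>)\<close> ab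
      by (metis (no_types, lifting) fst_conv image_iff prod.collapse snd_conv)
    then show ?thesis unfolding pathin_Ptop_between[OF X] by (simp add: ab o_def)
  qed
  show ?thesis
  proof
    assume L: ?L
    then have q: "continuous_map unit_interval (sum_topology ?B ?S) q"
      by (simp add: pathin_def Ptop_def)
    have op: "openin unit_interval {t \<in> {0..1}. q t \<in> Sigma J (topspace \<circ> ?B)}" if "J \<subseteq> ?S" for J
    proof -
      have "openin (sum_topology ?B ?S) (Sigma J (topspace \<circ> ?B))"
      proof -
        have "openin (?B i) {x. (i, x) \<in> Sigma J (topspace \<circ> ?B)}" for i by (cases "i \<in> J") auto
        then show ?thesis using that by (auto simp: openin_sum_topology)
      qed
      then show ?thesis using q by (auto simp: continuous_map_def)
    qed
    have top: "q t \<in> Sigma ?S (topspace \<circ> ?B)" if "t \<in> {0..1}" for t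
      using continuous_map_image_subset_topspace[OF q] that
      by (metis image_subset_iff topspace_euclidean_subtopology topspace_sum_topology)
    define A where "A = {t \<in> {0..1}. q t \<in> Sigma {(\<alpha>, \<beta>)} (topspace \<circ> ?B)}"
    define A' where "A' = {t \<in> {0..1}. q t \<in> Sigma (?S - {(\<alpha>, \<beta>)}) (topspace \<circ> ?B)}"
    have "(\<alpha>, \<beta>) \<in> ?S" using top[of 0] ab by (metis SigmaE atLeastAtMost_iff fst_conv order_refl zero_le_one)
    then have "openin unit_interval A" "openin unit_interval A'"
      unfolding A_def A'_def by (intro op; auto)+
    moreover have "A \<union> A' = {0..1}" "A \<inter> A' = {}"
      using top by (fastforce simp: A_def A'_def)+
    moreover have "0 \<in> A" using top[of 0] ab by (auto simp: A_def)
    moreover have "connected {0..1::real}" by simp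
    ultimately have "A' = {}"
      unfolding connected_openin by (metis Un_upper1 Un_upper2 empty_iff order_refl)
    have cst: "\<forall>t \<in> {0..1}. fst (q t) = (\<alpha>, \<beta>)"
    proof
      fix t :: real assume "t \<in> {0..1}"
      then have "t \<in> A" using \<open>A \<union> A' = {0..1}\<close> \<open>A' = {}\<close> by blast
      then show "fst (q t) = (\<alpha>, \<beta>)" unfolding A_def by (metis (lifting) SigmaE fst_conv mem_Collect_eq singletonD)
    qed
    have "pathin (Ptop_between X \<alpha> \<beta>) (snd \<circ> q)"
      unfolding pathin_def continuous_map_def
    proof (intro conjI allI impI)
      show "snd \<circ> q \<in> topspace unit_interval \<rightarrow> topspace (Ptop_between X \<alpha> \<beta>)"
      proof
        fix t assume "t \<in> topspace unit_interval"
        then have t: "t \<in> {0..1}" by simp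
        then have "q t = ((\<alpha>, \<beta>), snd (q t))" using cst by (metis prod.collapse)
        with top[OF t] have "((\<alpha>, \<beta>), snd (q t)) \<in> Sigma ?S (topspace \<circ> ?B)" by (rule back_subst)
        then show "(snd \<circ> q) t \<in> topspace (Ptop_between X \<alpha> \<beta>)" by simp
      qed
      fix U assume U: "openin (Ptop_between X \<alpha> \<beta>) U"
      then have "openin (sum_topology ?B ?S) ({(\<alpha>, \<beta>)} \<times> U)"
      proof -
        have "openin (?B i) (if i = (\<alpha>, \<beta>) then U else {})" for i using U by simp
        moreover have "Sigma ?S (\<lambda>i. if i = (\<alpha>, \<beta>) then U else {}) = {(\<alpha>, \<beta>)} \<times> U"
          using \<open>(\<alpha>, \<beta>) \<in> ?S\<close> by (auto split: if_splits)
        ultimately show ?thesis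
          using openin_disjoint_union[of ?B ?S "\<lambda>i. if i = (\<alpha>, \<beta>) then U else {}"] by (metis (no_types, lifting))
      qed
      then have "openin unit_interval {t \<in> {0..1}. q t \<in> {(\<alpha>, \<beta>)} \<times> U}"
        using q by (auto simp: continuous_map_def)
      moreover have "{t \<in> {0..1}. q t \<in> {(\<alpha>, \<beta>)} \<times> U} = {t \<in> topspace unit_interval. (snd \<circ> q) t \<in> U}"
        using cst by (auto simp: mem_Times_iff)
      ultimately show "openin unit_interval {t \<in> topspace unit_interval. (snd \<circ> q) t \<in> U}" by simp
    qed
    then show "?E \<and> ?R" using * cst by blast
  next
    assume R: "?E \<and> ?R"
    then have cst: "\<forall>t \<in> {0..1}. fst (q t) = (\<alpha>, \<beta>)" using ab by simp
    then have "pathin (Ptop_between X \<alpha> \<beta>) (snd \<circ> q)" using * R by blast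
    moreover have "(\<alpha>, \<beta>) \<in> ?S"
    proof -
      have "q 0 \<in> with_ends ` expaths X" using R by auto
      then show ?thesis using X ab by (auto simp: path_data_def)
    qed
    then have "continuous_map (Ptop_between X \<alpha> \<beta>) (Ptop X) (\<lambda>x. ((\<alpha>, \<beta>), x))"
      unfolding Ptop_def using continuous_map_component_injection[of "(\<alpha>, \<beta>)" ?S ?B] by simp
    ultimately have "pathin (Ptop X) ((\<lambda>x. ((\<alpha>, \<beta>), x)) \<circ> (snd \<circ> q))"
      by (rule pathin_compose)
    moreover have "((\<lambda>x. ((\<alpha>, \<beta>), x)) \<circ> (snd \<circ> q)) t = q t" if "t \<in> {0..1}" for t
      using cst that by (simp add: prod_eq_iff)
    ultimately show ?L
      unfolding pathin_def by (rule continuous_map_eq) auto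
  qed
qed

lemma Ptop_map_with_ends: "Ptop_map f (with_ends \<gamma>) = with_ends (compose {0..1} f \<gamma>)"
  by (simp add: Ptop_map_def compose_def)

lemma continuous_map_Ptop_map:
  assumes X: "path_data X" and Y: "path_data Y" and f: "is_mdmap X Y f"
  shows "continuous_map (Ptop X) (Ptop Y) (Ptop_map f)"
  unfolding continuous_map_Delta_generated_iff[OF Ptop_Delta_generated]
proof (intro allI impI)
  fix q assume q: "pathin (Ptop X) q"
  have cf: "continuous_map (und X) (und Y) f" using f by (simp add: is_mdmap_def cmaps_def)
  have E: "q t \<in> with_ends ` expaths X" "fst (q t) = fst (q 0)" if "t \<in> {0..1}" for t
    using q that unfolding pathin_Ptop[OF X] by blast+
  show "pathin (Ptop Y) (Ptop_map f \<circ> q)"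
    unfolding pathin_Ptop[OF Y]
  proof (intro conjI ballI)
    fix t :: real assume t: "t \<in> {0..1}"
    then obtain \<gamma> where g: "\<gamma> \<in> expaths X" "q t = with_ends \<gamma>" using E by blast
    then have "(Ptop_map f \<circ> q) t = with_ends (compose {0..1} f \<gamma>)"
      by (simp only: comp_apply Ptop_map_with_ends)
    then show "(Ptop_map f \<circ> q) t \<in> with_ends ` expaths Y"
      using f g by (auto simp: is_mdmap_def)
    show "fst ((Ptop_map f \<circ> q) t) = fst ((Ptop_map f \<circ> q) 0)"
      using E(2)[OF t] by (simp add: Ptop_map_def split_beta)
  next
    have "continuous_map (prod_topology unit_interval unit_interval) (und Y) (f \<circ> (\<lambda>(t, s). snd (q t) s))"
      using q cf unfolding pathin_Ptop[OF X] by (blast intro: continuous_map_compose)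
    then show "continuous_map (prod_topology unit_interval unit_interval) (und Y)
        (\<lambda>(t, s). snd ((Ptop_map f \<circ> q) t) s)"
      by (rule continuous_map_eq) (auto simp: Ptop_map_def split_beta compose_def)
  qed
qed

section \<open>Weak homotopy equivalences\<close>

text \<open>Applied to path components and to homotopy groups alike.\<close>

lemma bij_betw_quotient_iff:
  assumes r: "equiv A r" and s: "equiv B s"
    and \<phi>: "\<And>a. a \<in> A \<Longrightarrow> \<phi> a \<in> B"
    and F: "\<And>a. a \<in> A \<Longrightarrow> F (r `` {a}) = s `` {\<phi> a}"
  shows "bij_betw F (A // r) (B // s) \<longleftrightarrow>
     (\<forall>b \<in> B. \<exists>a \<in> A. (\<phi> a, b) \<in> s) \<and>
     (\<forall>a \<in> A. \<forall>a' \<in> A. (\<phi> a, \<phi> a') \<in> s \<longrightarrow> (a, a') \<in> r)"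
proof -
  have cls: "s `` {\<phi> a} = s `` {b} \<longleftrightarrow> (\<phi> a, b) \<in> s" if "a \<in> A" "b \<in> B" for a b
    using eq_equiv_class_iff[OF s \<phi>[OF that(1)] that(2)] .
  have clr: "r `` {a} = r `` {a'} \<longleftrightarrow> (a, a') \<in> r" if "a \<in> A" "a' \<in> A" for a a'
    using eq_equiv_class_iff[OF r that] .
  have "inj_on F (A // r) \<longleftrightarrow> (\<forall>a \<in> A. \<forall>a' \<in> A. (\<phi> a, \<phi> a') \<in> s \<longrightarrow> (a, a') \<in> r)"
    unfolding inj_on_def quotient_def using F cls clr \<phi> by simp
  moreover have "F ` (A // r) = (\<lambda>a. s `` {\<phi> a}) ` A"
    unfolding quotient_def using F by (auto simp: image_iff)
  moreover have "(\<lambda>a. s `` {\<phi> a}) ` A = B // s \<longleftrightarrow> (\<forall>b \<in> B. \<exists>a \<in> A. (\<phi> a, b) \<in> s)"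
  proof
    assume "(\<lambda>a. s `` {\<phi> a}) ` A = B // s"
    then have "\<forall>b \<in> B. \<exists>a \<in> A. s `` {\<phi> a} = s `` {b}"
      using quotientI[of _ B s] by (metis (mono_tags, lifting) imageE)
    then show "\<forall>b \<in> B. \<exists>a \<in> A. (\<phi> a, b) \<in> s" using cls by blast
  next
    assume *: "\<forall>b \<in> B. \<exists>a \<in> A. (\<phi> a, b) \<in> s"
    show "(\<lambda>a. s `` {\<phi> a}) ` A = B // s"
    proof
      show "(\<lambda>a. s `` {\<phi> a}) ` A \<subseteq> B // s" using \<phi> by (auto intro: quotientI)
      show "B // s \<subseteq> (\<lambda>a. s `` {\<phi> a}) ` A"
      proof
        fix c assume "c \<in> B // s"
        then obtain b where b: "b \<in> B" "c = s `` {b}" by (rule quotientE)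
        with * obtain a where "a \<in> A" "(\<phi> a, b) \<in> s" by blast
        then show "c \<in> (\<lambda>a. s `` {\<phi> a}) ` A" using cls[of a b] b by auto
      qed
    qed
  qed
  ultimately show ?thesis unfolding bij_betw_def by metis
qed

lemma cube_boundary_subset: "cube_boundary n \<subseteq> topspace (cube n)"
  by (auto simp: cube_boundary_def)

lemma equiv_loop_homotopy: "equiv (loop_maps n X x) (loop_homotopy n X x)"
proof (rule equivI)
  show "loop_homotopy n X x \<subseteq> loop_maps n X x \<times> loop_maps n X x"
    by (auto simp: loop_homotopy_def)
  show "refl_on (loop_maps n X x) (loop_homotopy n X x)"
    by (auto simp: refl_on_def loop_homotopy_def loop_maps_def homotopic_with_refl)
  show "sym (loop_homotopy n X x)"
    by (auto simp: sym_def loop_homotopy_def homotopic_with_symD)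
  show "trans (loop_homotopy n X x)"
    unfolding trans_def loop_homotopy_def by (blast intro: homotopic_with_trans)
qed

lemma loop_maps_compose:
  assumes "continuous_map X Y f" "g \<in> loop_maps n X x"
  shows "f \<circ> g \<in> loop_maps n Y (f x)"
  using assms by (auto simp: loop_maps_def intro: continuous_map_compose)

lemma loop_homotopy_compose:
  assumes f: "continuous_map X Y f" and "(g, h) \<in> loop_homotopy n X x"
  shows "(f \<circ> g, f \<circ> h) \<in> loop_homotopy n Y (f x)"
proof -
  have "homotopic_with (\<lambda>k. k ` cube_boundary n \<subseteq> {f x}) (cube n) Y (f \<circ> g) (f \<circ> h)"
    using assms(2) unfolding loop_homotopy_def
    by (intro homotopic_with_compose_continuous_map_left[OF _ f]) (auto elim!: homotopic_with_mono)
  then show ?thesis using assms loop_maps_compose[OF f] by (auto simp: loop_homotopy_def)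
qed

lemma loop_homotopy_cong:
  assumes g: "g \<in> loop_maps n X x" and eq: "\<And>z. z \<in> topspace (cube n) \<Longrightarrow> g z = h z"
  shows "h \<in> loop_maps n X x" "(g, h) \<in> loop_homotopy n X x"
proof -
  have "h ` cube_boundary n = g ` cube_boundary n"
    using eq cube_boundary_subset[of n] by (intro image_cong) auto
  then show h: "h \<in> loop_maps n X x"
    using g eq by (auto simp: loop_maps_def intro: continuous_map_eq)
  have "homotopic_with (\<lambda>k. k ` cube_boundary n \<subseteq> {x}) (cube n) X g h"
    using g h eq by (intro homotopic_with_equal) (auto simp: loop_maps_def)
  then show "(g, h) \<in> loop_homotopy n X x" using g h by (simp add: loop_homotopy_def)
qed

text \<open>In terms of representatives, so that classes of loops disappear and only maps out of
  cubes have to be lifted.\<close>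

lemma weak_homotopy_equivalence_iff:
  "weak_homotopy_equivalence X Y f \<longleftrightarrow> continuous_map X Y f \<and>
     (\<forall>y \<in> topspace Y. \<exists>x \<in> topspace X. path_component_of Y (f x) y) \<and>
     (\<forall>x \<in> topspace X. \<forall>x' \<in> topspace X. path_component_of Y (f x) (f x') \<longrightarrow> path_component_of X x x') \<and>
     (\<forall>n \<ge> 1. \<forall>x \<in> topspace X.
        (\<forall>g \<in> loop_maps n Y (f x). \<exists>k \<in> loop_maps n X x. (f \<circ> k, g) \<in> loop_homotopy n Y (f x)) \<and>
        (\<forall>g \<in> loop_maps n X x. \<forall>g' \<in> loop_maps n X x.
           (f \<circ> g, f \<circ> g') \<in> loop_homotopy n Y (f x) \<longrightarrow> (g, g') \<in> loop_homotopy n X x))"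
proof (cases "continuous_map X Y f")
  case f: True
  have eqX: "equiv (topspace X) {(x, y). path_component_of X x y}"
    by (rule equivI) (auto simp: refl_on_def sym_def trans_def path_component_of_equiv)
  have eqY: "equiv (topspace Y) {(x, y). path_component_of Y x y}"
    by (rule equivI) (auto simp: refl_on_def sym_def trans_def path_component_of_equiv)
  have clX: "path_components_of X = topspace X // {(x, y). path_component_of X x y}"
    unfolding path_components_of_def quotient_def by auto
  have clY: "path_components_of Y = topspace Y // {(x, y). path_component_of Y x y}"
    unfolding path_components_of_def quotient_def by auto
  have "bij_betw (\<lambda>c. \<Union>x \<in> c. path_component_of_set Y (f x)) (path_components_of X) (path_components_of Y) \<longleftrightarrow>
     (\<forall>y \<in> topspace Y. \<exists>x \<in> topspace X. (f x, y) \<in> {(x, y). path_component_of Y x y}) \<and>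
     (\<forall>x \<in> topspace X. \<forall>x' \<in> topspace X. (f x, f x') \<in> {(x, y). path_component_of Y x y}
        \<longrightarrow> (x, x') \<in> {(x, y). path_component_of X x y})"
    unfolding clX clY
  proof (rule bij_betw_quotient_iff[OF eqX eqY])
    show "f a \<in> topspace Y" if "a \<in> topspace X" for a
      using f that by (rule continuous_map_app)
    fix a assume a: "a \<in> topspace X"
    have "path_component_of_set Y (f x) = path_component_of_set Y (f a)" if "path_component_of X a x" for x
    proof -
      have "path_component_of Y (f a) (f x)"
        using path_component_of_continuous_image[OF f that] .
      then have "path_component_of Y (f a) = path_component_of Y (f x)"
        using path_component_of_equiv[of Y "f a" "f x"] by blast
      then show ?thesis by simp
    qed
    moreover have "path_component_of X a a" using a by (simp add: path_component_of_refl)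
    ultimately have "(\<Union>x \<in> Collect (path_component_of X a). path_component_of_set Y (f x))
        = path_component_of_set Y (f a)" by blast
    then show "(\<Union>x \<in> {(x, y). path_component_of X x y} `` {a}. path_component_of_set Y (f x))
        = {(x, y). path_component_of Y x y} `` {f a}"
      by (simp add: Image_def)
  qed
  moreover have "bij_betw (homotopy_group_map n Y f x) (homotopy_group n X x) (homotopy_group n Y (f x)) \<longleftrightarrow>
     (\<forall>g \<in> loop_maps n Y (f x). \<exists>k \<in> loop_maps n X x. (f \<circ> k, g) \<in> loop_homotopy n Y (f x)) \<and>
     (\<forall>g \<in> loop_maps n X x. \<forall>g' \<in> loop_maps n X x.
           (f \<circ> g, f \<circ> g') \<in> loop_homotopy n Y (f x) \<longrightarrow> (g, g') \<in> loop_homotopy n X x)" for n x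
    unfolding homotopy_group_def
  proof (rule bij_betw_quotient_iff[OF equiv_loop_homotopy equiv_loop_homotopy])
    fix g assume g: "g \<in> loop_maps n X x"
    show "f \<circ> g \<in> loop_maps n Y (f x)" by (rule loop_maps_compose[OF f g])
    have "loop_homotopy n Y (f x) `` {f \<circ> h} = loop_homotopy n Y (f x) `` {f \<circ> g}"
      if "(g, h) \<in> loop_homotopy n X x" for h
      using equiv_class_eq[OF equiv_loop_homotopy loop_homotopy_compose[OF f that]] by simp
    moreover have "(g, g) \<in> loop_homotopy n X x"
      using g equiv_loop_homotopy by (meson equivE refl_onD)
    ultimately show "homotopy_group_map n Y f x (loop_homotopy n X x `` {g})
        = loop_homotopy n Y (f x) `` {f \<circ> g}"
      unfolding homotopy_group_map_def by blast
  qed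
  ultimately show ?thesis using f unfolding weak_homotopy_equivalence_def by simp
qed (simp add: weak_homotopy_equivalence_def)

lemma weak_homotopy_equivalence_cong:
  assumes w: "weak_homotopy_equivalence X Y f" and eq: "\<And>x. x \<in> topspace X \<Longrightarrow> f x = g x"
  shows "weak_homotopy_equivalence X Y g"
proof -
  have f: "continuous_map X Y f" using w by (simp add: weak_homotopy_equivalence_def)
  then have g: "continuous_map X Y g" using eq by (rule continuous_map_eq)
  have cong: "(f \<circ> k, g \<circ> k) \<in> loop_homotopy n Y (f x)" if k: "k \<in> loop_maps n X x" for n k x
  proof (rule loop_homotopy_cong(2)[OF loop_maps_compose[OF f k]])
    fix z assume "z \<in> topspace (cube n)"
    then have "k z \<in> topspace X"
      using k by (auto simp: loop_maps_def dest: continuous_map_app)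
    then show "(f \<circ> k) z = (g \<circ> k) z" by (simp add: eq)
  qed
  have tr: "(a, c) \<in> loop_homotopy n Y y" if "(a, b) \<in> loop_homotopy n Y y" "(b, c) \<in> loop_homotopy n Y y" for a b c n y
    using that equiv_loop_homotopy by (meson equivE transD)
  have sy: "(b, a) \<in> loop_homotopy n Y y" if "(a, b) \<in> loop_homotopy n Y y" for a b n y
    using that equiv_loop_homotopy by (meson equivE symD)
  show ?thesis
    unfolding weak_homotopy_equivalence_iff
  proof (intro conjI allI impI ballI)
    fix n x h assume nx: "n \<ge> (1::nat)" "x \<in> topspace X" and "h \<in> loop_maps n Y (g x)"
    then obtain k where "k \<in> loop_maps n X x" "(f \<circ> k, h) \<in> loop_homotopy n Y (f x)"
      using w eq unfolding weak_homotopy_equivalence_iff by metis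
    then show "\<exists>k \<in> loop_maps n X x. (g \<circ> k, h) \<in> loop_homotopy n Y (g x)"
      using cong eq nx tr sy by metis
  next
    fix n x h h' assume nx: "n \<ge> (1::nat)" "x \<in> topspace X"
      and h: "h \<in> loop_maps n X x" "h' \<in> loop_maps n X x" "(g \<circ> h, g \<circ> h') \<in> loop_homotopy n Y (g x)"
    have "(f \<circ> h, f \<circ> h') \<in> loop_homotopy n Y (f x)"
      using cong[OF h(1)] cong[OF h(2)] h(3) eq[OF nx(2)] tr sy by metis
    then show "(h, h') \<in> loop_homotopy n X x"
      using w nx h unfolding weak_homotopy_equivalence_iff by blast
  qed (use w eq g in \<open>simp_all add: weak_homotopy_equivalence_iff\<close>)
qed

lemma weak_homotopy_equivalence_compose_homeomorphism:
  assumes h: "homeomorphic_maps X Z a b" and w: "weak_homotopy_equivalence Z Y f"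
  shows "weak_homotopy_equivalence X Y (f \<circ> a)"
proof -
  have a: "continuous_map X Z a" and b: "continuous_map Z X b"
    and ba: "\<And>x. x \<in> topspace X \<Longrightarrow> b (a x) = x" and ab: "\<And>z. z \<in> topspace Z \<Longrightarrow> a (b z) = z"
    using h by (auto simp: homeomorphic_maps_def)
  have f: "continuous_map Z Y f" using w by (simp add: weak_homotopy_equivalence_def)
  have at: "a x \<in> topspace Z" if "x \<in> topspace X" for x using a that by (rule continuous_map_app)
  have bt: "b z \<in> topspace X" if "z \<in> topspace Z" for z using b that by (rule continuous_map_app)
  show ?thesis
    unfolding weak_homotopy_equivalence_iff
  proof (intro conjI allI impI ballI)
    show "continuous_map X Y (f \<circ> a)" using a f by (rule continuous_map_compose)
  next
    fix y assume "y \<in> topspace Y"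
    then obtain z where "z \<in> topspace Z" "path_component_of Y (f z) y"
      using w unfolding weak_homotopy_equivalence_iff by blast
    then show "\<exists>x \<in> topspace X. path_component_of Y ((f \<circ> a) x) y"
      using ab bt by (intro bexI[of _ "b z"]) auto
  next
    fix x x' assume x: "x \<in> topspace X" "x' \<in> topspace X" and "path_component_of Y ((f \<circ> a) x) ((f \<circ> a) x')"
    then have "path_component_of Z (a x) (a x')"
      using w at unfolding weak_homotopy_equivalence_iff by simp
    then have "path_component_of X (b (a x)) (b (a x'))"
      by (rule path_component_of_continuous_image[OF b])
    then show "path_component_of X x x'" using ba x by simp
  next
    fix n x g assume n: "n \<ge> (1::nat)" and x: "x \<in> topspace X" and "g \<in> loop_maps n Y ((f \<circ> a) x)"
    then obtain k where k: "k \<in> loop_maps n Z (a x)" "(f \<circ> k, g) \<in> loop_homotopy n Y (f (a x))"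
      using w at unfolding weak_homotopy_equivalence_iff by (metis comp_apply)
    have kz: "a (b (k z)) = k z" if "z \<in> topspace (cube n)" for z
    proof -
      have "k z \<in> topspace Z" using k(1) that by (auto simp: loop_maps_def dest: continuous_map_app)
      then show ?thesis by (rule ab)
    qed
    have "b \<circ> k \<in> loop_maps n X x" using loop_maps_compose[OF b k(1)] ba x by simp
    moreover have "(f \<circ> k, (f \<circ> a) \<circ> (b \<circ> k)) \<in> loop_homotopy n Y (f (a x))"
      by (rule loop_homotopy_cong(2)[OF loop_maps_compose[OF f k(1)]]) (simp add: kz)
    then have "((f \<circ> a) \<circ> (b \<circ> k), g) \<in> loop_homotopy n Y (f (a x))"
      using k(2) equiv_loop_homotopy by (meson equivE symD transD)
    ultimately show "\<exists>k \<in> loop_maps n X x. ((f \<circ> a) \<circ> k, g) \<in> loop_homotopy n Y ((f \<circ> a) x)"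
      by auto
  next
    fix n x g g' assume n: "n \<ge> (1::nat)" and x: "x \<in> topspace X"
      and g: "g \<in> loop_maps n X x" "g' \<in> loop_maps n X x"
      and h: "((f \<circ> a) \<circ> g, (f \<circ> a) \<circ> g') \<in> loop_homotopy n Y ((f \<circ> a) x)"
    have "a \<circ> g \<in> loop_maps n Z (a x)" "a \<circ> g' \<in> loop_maps n Z (a x)"
      using g loop_maps_compose[OF a] by auto
    then have "(a \<circ> g, a \<circ> g') \<in> loop_homotopy n Z (a x)"
      using w n at[OF x] h unfolding weak_homotopy_equivalence_iff by (simp add: comp_assoc)
    then have "(b \<circ> (a \<circ> g), b \<circ> (a \<circ> g')) \<in> loop_homotopy n X x"
      using loop_homotopy_compose[OF b] ba x by metis
    moreover have "(k, b \<circ> (a \<circ> k)) \<in> loop_homotopy n X x" if k: "k \<in> loop_maps n X x" for k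
    proof (rule loop_homotopy_cong(2)[OF k])
      fix z assume "z \<in> topspace (cube n)"
      then have "k z \<in> topspace X" using k by (auto simp: loop_maps_def dest: continuous_map_app)
      then show "k z = (b \<circ> (a \<circ> k)) z" by (simp add: ba)
    qed
    ultimately show "(g, g') \<in> loop_homotopy n X x"
      using g equiv_loop_homotopy by (meson equivE symD transD)
  qed
qed

section \<open>Saturation as a reflection\<close>

lemma MdTop_simps [simp]:
  "Obj (MdTop Top) = {X. is_mdspace Top X}"
  "Arr (MdTop Top) = {a. is_mdspace Top (mdom a) \<and> is_mdspace Top (mcod a) \<and>
                is_mdmap (mdom a) (mcod a) (mfun a)}"
  "Src (MdTop Top) = mdom" "Tgt (MdTop Top) = mcod"
  "Idt (MdTop Top) = (\<lambda>X. \<lparr>mdom = X, mcod = X, mfun = (\<lambda>x \<in> topspace (und X). x)\<rparr>)"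
  "Cmp (MdTop Top) = (\<lambda>b a. \<lparr>mdom = mdom a, mcod = mcod b,
                    mfun = compose (topspace (und (mdom a))) (mfun b) (mfun a)\<rparr>)"
  by (simp_all add: MdTop_def)

lemma MdTop_sat_simps [simp]:
  "Obj (MdTop_sat Top) = {X. is_mdspace Top X \<and> saturated X}"
  "Arr (MdTop_sat Top) = {a \<in> Arr (MdTop Top). saturated (mdom a) \<and> saturated (mcod a)}"
  "Src (MdTop_sat Top) = mdom" "Tgt (MdTop_sat Top) = mcod"
  "Idt (MdTop_sat Top) = Idt (MdTop Top)"
  "Cmp (MdTop_sat Top) = Cmp (MdTop Top)"
  by (auto simp add: MdTop_sat_def full_subcat_def MdTop_def)

lemma q_model_simps [simp]:
  "Obj (q_model C) = Obj C" "Arr (q_model C) = Arr C" "Src (q_model C) = Src C"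
  "Tgt (q_model C) = Tgt C" "Idt (q_model C) = Idt C" "Cmp (q_model C) = Cmp C"
  "Weq (q_model C) = {a \<in> Arr C. q_weq a}" "Fib (q_model C) = {a \<in> Arr C. q_fib a}"
  by (simp_all add: q_model_def model_cat_of_def)

lemma Hom_MdTop:
  "f \<in> Hom (q_model (MdTop Top)) X Y \<longleftrightarrow>
     is_mdspace Top X \<and> is_mdspace Top Y \<and> is_mdmap X Y (mfun f) \<and> mdom f = X \<and> mcod f = Y"
  by (auto simp: Hom_def)

lemma Hom_MdTop_sat:
  "f \<in> Hom (q_model (MdTop_sat Top)) X Y \<longleftrightarrow>
     f \<in> Hom (q_model (MdTop Top)) X Y \<and> saturated X \<and> saturated Y"
  by (auto simp: Hom_def)

lemma is_mdmapD:
  assumes "is_mdmap X Y f"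
  shows "continuous_map (und X) (und Y) f" "f \<in> extensional (topspace (und X))"
    "x \<in> states X \<Longrightarrow> f x \<in> states Y" "\<gamma> \<in> expaths X \<Longrightarrow> compose {0..1} f \<gamma> \<in> expaths Y"
  using assms by (auto simp: is_mdmap_def cmaps_def)

lemma expaths_app:
  assumes "path_data X" "\<gamma> \<in> expaths X" "t \<in> {0..1}"
  shows "\<gamma> t \<in> topspace (und X)"
  using assms continuous_map_app[of unit_interval "und X" \<gamma> t] by (auto simp: path_data_def cmaps_def)

lemma compose_compose_path:
  assumes "path_data X" "\<gamma> \<in> expaths X"
  shows "compose {0..1} (compose (topspace (und X)) g f) \<gamma> = compose {0..1} g (compose {0..1} f \<gamma>)"
  using expaths_app[OF assms] by (auto simp: compose_def fun_eq_iff)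

lemma compose_id_path:
  assumes "path_data X" "\<gamma> \<in> expaths X"
  shows "compose {0..1} (\<lambda>x \<in> topspace (und X). x) \<gamma> = \<gamma>"
  using expaths_app[OF assms] assms
  by (auto simp: compose_def fun_eq_iff path_data_def cmaps_def extensional_def)

lemma is_mdmap_compose:
  assumes X: "is_mdspace Top X" and f: "is_mdmap X Y f" and g: "is_mdmap Y Z g"
  shows "is_mdmap X Z (compose (topspace (und X)) g f)"
proof -
  have "continuous_map (und X) (und Z) (g \<circ> f)"
    using is_mdmapD(1)[OF f] is_mdmapD(1)[OF g] by (rule continuous_map_compose)
  then have "continuous_map (und X) (und Z) (compose (topspace (und X)) g f)"
    by (rule continuous_map_eq) (simp add: compose_def)
  moreover have "compose (topspace (und X)) g f x \<in> states Z" if "x \<in> states X" for x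
    using that X is_mdmapD(3)[OF f] is_mdmapD(3)[OF g] by (auto simp: compose_def is_mdspace_def)
  moreover have "compose {0..1} (compose (topspace (und X)) g f) \<gamma> \<in> expaths Z" if "\<gamma> \<in> expaths X" for \<gamma>
    using is_mdmapD(4)[OF g is_mdmapD(4)[OF f that]]
    by (simp add: compose_compose_path[OF is_mdspace_path_data[OF X] that])
  ultimately show ?thesis by (auto simp: is_mdmap_def cmaps_def)
qed

lemma is_mdmap_id:
  assumes "is_mdspace Top X" shows "is_mdmap X X (\<lambda>x \<in> topspace (und X). x)"
proof -
  have "continuous_map (und X) (und X) (\<lambda>x \<in> topspace (und X). x)"
    by (rule continuous_map_eq[OF continuous_map_id]) simp
  then show ?thesis
    using assms compose_id_path[OF is_mdspace_path_data[OF assms]]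
    by (auto simp: is_mdmap_def cmaps_def is_mdspace_def)
qed

lemma compose_restrict_id:
  assumes "f \<in> extensional A" shows "compose A f (\<lambda>x \<in> A. x) = f"
  using assms by (auto simp: compose_def fun_eq_iff extensional_def)

lemma compose_id_left:
  assumes "f \<in> extensional A" "f ` A \<subseteq> B" shows "compose A (\<lambda>x \<in> B. x) f = f"
  using assms by (auto simp: compose_def fun_eq_iff extensional_def)

lemma is_mdmap_image: "is_mdmap X Y f \<Longrightarrow> f ` topspace (und X) \<subseteq> topspace (und Y)"
  using is_mdmapD(1) continuous_map_image_subset_topspace by blast

lemma category_MdTop: "category (q_model (MdTop Top))"
proof -
  have assoc: "compose A h (compose A g f) = compose A (compose B h g) f" if "f ` A \<subseteq> B"
    for A B and f g h :: "'a \<Rightarrow> 'a"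
    using that by (auto simp: compose_def fun_eq_iff)
  show ?thesis
    unfolding category_def
  proof (intro conjI allI impI ballI)
    fix w x y z f g h
    assume "f \<in> Hom (q_model (MdTop Top)) w x \<and> g \<in> Hom (q_model (MdTop Top)) x y
      \<and> h \<in> Hom (q_model (MdTop Top)) y z"
    then show "Cmp (q_model (MdTop Top)) h (Cmp (q_model (MdTop Top)) g f)
        = Cmp (q_model (MdTop Top)) (Cmp (q_model (MdTop Top)) h g) f"
      unfolding Hom_MdTop by (auto intro!: assoc dest: is_mdmap_image)
  next
    fix x y f assume "f \<in> Hom (q_model (MdTop Top)) x y"
    then have f: "is_mdmap x y (mfun f)" "mdom f = x" "mcod f = y" by (auto simp: Hom_MdTop)
    then show "Cmp (q_model (MdTop Top)) f (Idt (q_model (MdTop Top)) x) = f"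
      "Cmp (q_model (MdTop Top)) (Idt (q_model (MdTop Top)) y) f = f"
      using compose_restrict_id[OF is_mdmapD(2)[OF f(1)]]
        compose_id_left[OF is_mdmapD(2)[OF f(1)] is_mdmap_image[OF f(1)]] by auto
  qed (auto simp: Hom_MdTop is_mdmap_id intro: is_mdmap_compose)
qed

lemma category_MdTop_sat: "category (q_model (MdTop_sat Top))"
  using category_MdTop[of Top] unfolding category_def
  by (simp add: Hom_MdTop_sat Ball_def) blast

text \<open>Generating the new paths, instead of adding in one step those \<open>\<gamma>\<close> with an execution path
  \<open>\<gamma>\<phi>\<close>, makes the closure conditions immediate and gives the universal property by induction.\<close>

inductive_set sat_paths :: "'u mdspace \<Rightarrow> (real \<Rightarrow> 'u) set" for X where
  base: "\<gamma> \<in> expaths X \<Longrightarrow> \<gamma> \<in> sat_paths X"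
| reparam: "\<gamma> \<in> sat_paths X \<Longrightarrow> \<phi> \<in> M11 \<Longrightarrow> compose {0..1} \<gamma> \<phi> \<in> sat_paths X"
| concat: "\<gamma>1 \<in> sat_paths X \<Longrightarrow> \<gamma>2 \<in> sat_paths X \<Longrightarrow> \<gamma>1 1 = \<gamma>2 0 \<Longrightarrow> ncomp \<gamma>1 \<gamma>2 \<in> sat_paths X"
| desat: "\<gamma> \<in> cmaps unit_interval (und X) \<Longrightarrow> \<phi> \<in> M11 \<Longrightarrow>
    compose {0..1} \<gamma> \<phi> \<in> sat_paths X \<Longrightarrow> \<gamma> \<in> sat_paths X"

definition saturation :: "'u mdspace \<Rightarrow> 'u mdspace" where
  "saturation X = \<lparr>und = und X, states = states X, expaths = sat_paths X\<rparr>"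

lemma M11_ends:
  assumes "\<phi> \<in> M11" shows "\<phi> 0 = 0" "\<phi> 1 = 1"
proof -
  have mono: "\<And>s t. s \<in> {0..1} \<Longrightarrow> t \<in> {0..1} \<Longrightarrow> s \<le> t \<Longrightarrow> \<phi> s \<le> \<phi> t"
    using assms by (auto simp: M11_def mono_on_def)
  have im: "\<phi> ` {0..1} = {0..1}" using assms by (simp add: M11_def)
  have "0 \<in> \<phi> ` {0..1}" "1 \<in> \<phi> ` {0..1}" unfolding im by auto
  then obtain a b where "a \<in> {0..1}" "\<phi> a = 0" "b \<in> {0..1}" "\<phi> b = 1" by (metis imageE)
  moreover have "\<phi> 0 \<in> {0..1}" "\<phi> 1 \<in> {0..1}" using im by auto
  ultimately show "\<phi> 0 = 0" "\<phi> 1 = 1" using mono[of 0 a] mono[of b 1] by auto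
qed

lemma M11_app: "\<phi> \<in> M11 \<Longrightarrow> t \<in> {0..1} \<Longrightarrow> \<phi> t \<in> {0..1}"
  by (auto simp: M11_def)

text \<open>A monotone map without jumps is continuous; extended by the identity it becomes a
  monotone surjection of the line, whose image is open.\<close>

lemma M11_continuous:
  assumes "\<phi> \<in> M11" shows "continuous_on {0..1} \<phi>"
proof -
  define \<psi> where "\<psi> t = (if t \<in> {0..1} then \<phi> t else t)" for t
  have mono: "\<phi> s \<le> \<phi> t" if "s \<in> {0..1}" "t \<in> {0..1}" "s \<le> t" for s t
    using assms that by (auto simp: M11_def mono_on_def)
  have im: "\<phi> ` {0..1} = {0..1}" using assms by (simp add: M11_def)
  have "range \<psi> = UNIV"
  proof -
    have "t \<in> range \<psi>" for t
    proof (cases "t \<in> {0..1}")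
      case True
      then obtain s where "s \<in> {0..1}" "t = \<phi> s" using im by blast
      then show ?thesis by (intro image_eqI[of _ _ s]) (auto simp: \<psi>_def)
    next
      case False
      then show ?thesis by (intro image_eqI[of _ _ t]) (auto simp: \<psi>_def)
    qed
    then show ?thesis by auto
  qed
  moreover have "\<psi> s \<le> \<psi> t" if "s \<le> t" for s t
    using that mono[of s t] M11_app[OF assms, of s] M11_app[OF assms, of t]
    by (auto simp: \<psi>_def)
  ultimately have "continuous_on UNIV \<psi>" by (intro continuous_onI_mono) auto
  then have "continuous_on {0..1} \<psi>" by (rule continuous_on_subset) simp
  then show ?thesis by (rule continuous_on_eq) (simp add: \<psi>_def)
qed

lemma M11_continuous_map: "\<phi> \<in> M11 \<Longrightarrow> continuous_map unit_interval unit_interval \<phi>"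
  using M11_continuous M11_app by (auto simp: continuous_map_in_subtopology Pi_iff)

lemma cmaps_reparam:
  assumes \<gamma>: "\<gamma> \<in> cmaps unit_interval Y" and \<phi>: "\<phi> \<in> M11"
  shows "compose {0..1} \<gamma> \<phi> \<in> cmaps unit_interval Y"
proof -
  have "continuous_map unit_interval Y (\<gamma> \<circ> \<phi>)"
    using \<gamma> by (auto simp: cmaps_def intro: continuous_map_compose[OF M11_continuous_map[OF \<phi>]])
  then have "continuous_map unit_interval Y (compose {0..1} \<gamma> \<phi>)"
    by (rule continuous_map_eq) (simp add: compose_def)
  then show ?thesis by (simp add: cmaps_def)
qed

lemma continuous_map_halves:
  assumes 1: "continuous_map unit_interval Y \<gamma>1" and 2: "continuous_map unit_interval Y \<gamma>2"
    and eq: "\<gamma>1 1 = \<gamma>2 0"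
  shows "continuous_map unit_interval Y (\<lambda>t. if t \<le> 1/2 then \<gamma>1 (2 * t) else \<gamma>2 (2 * t - 1))"
proof (rule continuous_map_cases_le[where p = "\<lambda>t. t" and q = "\<lambda>_. 1/2"])
  have "{x \<in> topspace unit_interval. x \<le> 1/2} = {0..1/2}" "{x \<in> topspace unit_interval. 1/2 \<le> x} = {1/2..1}"
    by auto
  moreover have "subtopology unit_interval {0..1/2} = top_of_set {0..1/2}"
    "subtopology unit_interval {1/2..1} = top_of_set {1/2..1}"
    by (simp_all add: subtopology_subtopology inf.absorb2)
  moreover have "continuous_map (top_of_set {0..1/2}) unit_interval (\<lambda>t::real. 2 * t)"
    "continuous_map (top_of_set {1/2..1}) unit_interval (\<lambda>t::real. 2 * t - 1)"
    by (auto simp: continuous_map_in_subtopology intro!: continuous_intros)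
  then have "continuous_map (top_of_set {0..1/2}) Y (\<gamma>1 \<circ> (\<lambda>t::real. 2 * t))"
    "continuous_map (top_of_set {1/2..1}) Y (\<gamma>2 \<circ> (\<lambda>t::real. 2 * t - 1))"
    using 1 2 continuous_map_compose by blast+
  ultimately show "continuous_map (subtopology unit_interval {x \<in> topspace unit_interval. x \<le> 1/2}) Y (\<lambda>t. \<gamma>1 (2 * t))"
    "continuous_map (subtopology unit_interval {x \<in> topspace unit_interval. 1/2 \<le> x}) Y (\<lambda>t. \<gamma>2 (2 * t - 1))"
    by (simp_all only: o_def)
next
  fix t :: real assume "t = 1/2"
  then have "2 * t = 1" by simp
  then show "\<gamma>1 (2 * t) = \<gamma>2 (2 * t - 1)" using eq by (simp only: diff_self)
qed auto

lemma cmaps_ncomp: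
  assumes "\<gamma>1 \<in> cmaps unit_interval Y" "\<gamma>2 \<in> cmaps unit_interval Y" "\<gamma>1 1 = \<gamma>2 0"
  shows "ncomp \<gamma>1 \<gamma>2 \<in> cmaps unit_interval Y"
proof -
  have "continuous_map unit_interval Y (\<lambda>t. if t \<le> 1/2 then \<gamma>1 (2 * t) else \<gamma>2 (2 * t - 1))"
    using assms by (intro continuous_map_halves) (auto simp: cmaps_def)
  then have "continuous_map unit_interval Y (ncomp \<gamma>1 \<gamma>2)"
    by (rule continuous_map_eq) (simp add: ncomp_def)
  then show ?thesis by (simp add: cmaps_def ncomp_def)
qed

text \<open>The closure conditions never leave the set of continuous maps with ends in the states, so
  the least solution is a set of legitimate execution paths.\<close>

lemma sat_paths_cmaps:
  assumes "path_data X" "\<gamma> \<in> sat_paths X"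
  shows "\<gamma> \<in> cmaps unit_interval (und X) \<and> \<gamma> 0 \<in> states X \<and> \<gamma> 1 \<in> states X"
  using assms(2)
proof induction
  case (base \<gamma>) then show ?case using assms(1) by (auto simp: path_data_def)
next
  case (reparam \<gamma> \<phi>) then show ?case by (simp add: compose_eq M11_ends cmaps_reparam)
next
  case (concat \<gamma>1 \<gamma>2)
  then have "ncomp \<gamma>1 \<gamma>2 0 = \<gamma>1 0" "ncomp \<gamma>1 \<gamma>2 1 = \<gamma>2 1" by (simp_all add: ncomp_def)
  then show ?case using concat by (simp add: cmaps_ncomp)
next
  case (desat \<gamma> \<phi>) then show ?case using M11_ends[OF desat(2)] by (simp add: compose_def)
qed

lemma is_mdspace_saturation:
  assumes "is_mdspace Top X" shows "is_mdspace Top (saturation X)"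
  using assms sat_paths_cmaps[OF is_mdspace_path_data[OF assms]]
  by (auto simp: is_mdspace_def saturation_def intro: sat_paths.intros)

lemma saturated_saturation: "saturated (saturation X)"
  by (auto simp: saturated_def saturation_def intro: sat_paths.desat)

lemma compose_assoc_paths: "compose {0..1} f (compose {0..1} \<gamma> \<phi>) = compose {0..1} (compose {0..1} f \<gamma>) \<phi>"
  if "\<phi> \<in> M11"
  using M11_app[OF that] by (auto simp: compose_def fun_eq_iff)

lemma compose_ncomp: "compose {0..1} f (ncomp \<gamma>1 \<gamma>2) = ncomp (compose {0..1} f \<gamma>1) (compose {0..1} f \<gamma>2)"
  by (auto simp: compose_def ncomp_def fun_eq_iff)

text \<open>A map into a saturated object carries the added paths to execution paths as well; this
  is the universal property of the saturation.\<close>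

lemma is_mdmap_saturation:
  assumes X: "is_mdspace Top X" and Y: "is_mdspace Top Y" and f: "is_mdmap X Y f" and sat: "saturated Y"
  shows "is_mdmap (saturation X) Y f"
proof -
  have "compose {0..1} f \<gamma> \<in> expaths Y" if "\<gamma> \<in> sat_paths X" for \<gamma>
    using that
  proof induction
    case (base \<gamma>) then show ?case using is_mdmapD(4)[OF f] by simp
  next
    case (reparam \<gamma> \<phi>)
    then show ?case using Y by (simp add: compose_assoc_paths is_mdspace_def)
  next
    case (concat \<gamma>1 \<gamma>2)
    have "compose {0..1} f \<gamma>1 1 = compose {0..1} f \<gamma>2 0" using concat by (simp add: compose_def)
    then show ?case using Y concat by (simp add: compose_ncomp is_mdspace_def)
  next
    case (desat \<gamma> \<phi>)
    have "continuous_map unit_interval (und Y) (f \<circ> \<gamma>)"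
      using desat(1) is_mdmapD(1)[OF f] by (auto simp: cmaps_def intro: continuous_map_compose)
    then have "continuous_map unit_interval (und Y) (compose {0..1} f \<gamma>)"
      by (rule continuous_map_eq) (simp add: compose_def)
    then have "compose {0..1} f \<gamma> \<in> cmaps unit_interval (und Y)" by (simp add: cmaps_def)
    then show ?case
      using sat desat by (auto simp: saturated_def compose_assoc_paths)
  qed
  then show ?thesis using f by (simp add: is_mdmap_def saturation_def)
qed

lemma is_mdmap_into_saturation:
  assumes "is_mdmap X Y f" shows "is_mdmap X (saturation Y) f"
  using assms by (auto simp: is_mdmap_def saturation_def intro: sat_paths.base)

definition saturation_functor :: "('u mdspace, 'u mdarr, 'u mdspace, 'u mdarr) fnctr" where
  "saturation_functor = \<lparr>OMap = saturation,
     AMap = (\<lambda>a. \<lparr>mdom = saturation (mdom a), mcod = saturation (mcod a), mfun = mfun a\<rparr>)\<rparr>"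

lemma saturation_simps [simp]: "und (saturation X) = und X" "states (saturation X) = states X"
  by (simp_all add: saturation_def)

text \<open>Unit and counit are carried by identity maps, so that naturality and the triangle
  identities hold on the nose.\<close>

lemma saturation_adjunction:
  "adjunction (q_model (MdTop Top)) (q_model (MdTop_sat Top)) saturation_functor inclusion
     (\<lambda>X. \<lparr>mdom = X, mcod = saturation X, mfun = (\<lambda>x \<in> topspace (und X). x)\<rparr>)
     (\<lambda>Y. \<lparr>mdom = saturation Y, mcod = Y, mfun = (\<lambda>x \<in> topspace (und Y). x)\<rparr>)"
proof -
  have sat: "is_mdmap (saturation X) (saturation Y) f"
    if "is_mdspace Top X" "is_mdspace Top Y" "is_mdmap X Y f" for X Y f
    using that is_mdmap_saturation[OF that(1) is_mdspace_saturation[OF that(2)] is_mdmap_into_saturation[OF that(3)] saturated_saturation]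
    by blast
  have comp: "compose A f (\<lambda>x \<in> A. x) = f" "compose A (\<lambda>x \<in> B. x) f = f"
    if "is_mdmap X Y f" "A = topspace (und X)" "B = topspace (und Y)" for X Y f A B
    using compose_restrict_id[OF is_mdmapD(2)[OF that(1)]]
        compose_id_left[OF is_mdmapD(2)[OF that(1)] is_mdmap_image[OF that(1)]] that by auto
  have idid: "compose A (\<lambda>x \<in> A. x) (\<lambda>x \<in> A. x) = (\<lambda>x \<in> A. x)" for A :: "'a set"
    by (auto simp: compose_def)
  show ?thesis
    unfolding adjunction_def
    by (intro conjI)
       (auto simp: category_MdTop category_MdTop_sat is_functor_def Hom_MdTop Hom_MdTop_sat
         saturation_functor_def inclusion_def is_mdspace_saturation saturated_saturation sat
         is_mdmap_into_saturation is_mdmap_id comp idid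
         intro: is_mdmap_saturation is_mdmap_id)
qed

lemma category_comp_assoc:
  assumes "category C" "f \<in> Hom C w x" "g \<in> Hom C x y" "h \<in> Hom C y z"
  shows "Cmp C h (Cmp C g f) = Cmp C (Cmp C h g) f"
  using assms unfolding category_def by blast

text \<open>At a saturated object \<open>Y\<close>, unit and counit of any adjunction are inverse to each other.
  One composite is a triangle identity. The other follows from naturality of the counit at the
  unit \<open>Y \<rightarrow> F Y\<close>, which is an arrow of the full subcategory, and the other triangle.\<close>

lemma unit_counit_inverse:
  fixes Top :: "'u topology set"
  defines "M \<equiv> q_model (MdTop Top)" and "N \<equiv> q_model (MdTop_sat Top)"
  assumes adj: "adjunction M N F inclusion \<eta> \<epsilon>" and Y: "is_mdspace Top Y" "saturated Y"
  shows "\<eta> Y \<in> Hom N Y (OMap F Y)" "\<epsilon> Y \<in> Hom N (OMap F Y) Y"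
    "Cmp M (\<epsilon> Y) (\<eta> Y) = Idt M Y" "Cmp M (\<eta> Y) (\<epsilon> Y) = Idt M (OMap F Y)"
proof -
  have F: "is_functor M N F" using adj by (simp add: adjunction_def)
  have "OMap F Y \<in> Obj N" using F Y by (simp add: is_functor_def M_def N_def)
  moreover have "\<eta> Y \<in> Hom M Y (OMap F Y)"
    using adj Y by (auto simp: adjunction_def inclusion_def M_def)
  ultimately show \<eta>: "\<eta> Y \<in> Hom N Y (OMap F Y)"
    using Y by (simp add: M_def N_def Hom_MdTop_sat)
  show \<epsilon>: "\<epsilon> Y \<in> Hom N (OMap F Y) Y"
    using adj Y by (auto simp: adjunction_def inclusion_def N_def)
  show "Cmp M (\<epsilon> Y) (\<eta> Y) = Idt M Y"
    using adj Y by (auto simp: adjunction_def inclusion_def M_def N_def)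
  have "Cmp N (\<epsilon> (OMap F Y)) (AMap F (\<eta> Y)) = Cmp N (\<eta> Y) (\<epsilon> Y)"
    using adj \<eta> unfolding adjunction_def by (simp add: inclusion_def)
  moreover have "Cmp N (\<epsilon> (OMap F Y)) (AMap F (\<eta> Y)) = Idt N (OMap F Y)"
    using adj Y by (auto simp: adjunction_def M_def)
  ultimately have "Cmp N (\<eta> Y) (\<epsilon> Y) = Idt N (OMap F Y)" by metis
  then show "Cmp M (\<eta> Y) (\<epsilon> Y) = Idt M (OMap F Y)"
    by (simp only: M_def N_def q_model_simps MdTop_sat_simps)
qed

section \<open>Loops that are nowhere constant\<close>

definition finitary_loop :: "(real \<Rightarrow> nat \<Rightarrow> real) \<Rightarrow> bool" where
  "finitary_loop \<omega> \<longleftrightarrow> (\<forall>n. continuous_on {0..1} (\<lambda>s. \<omega> s n)) \<and> (\<forall>n. \<omega> 0 n = 0 \<and> \<omega> 1 n = 0) \<and>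
     (\<exists>N. \<forall>n \<ge> N. \<forall>s \<in> {0..1}. \<omega> s n = 0)"

definition nowhere_constant :: "(real \<Rightarrow> 'a) \<Rightarrow> bool" where
  "nowhere_constant \<rho> \<longleftrightarrow> (\<forall>a \<in> {0..1}. \<forall>b \<in> {0..1}. a < b \<longrightarrow> (\<exists>s \<in> {a..b}. \<rho> s \<noteq> \<rho> a))"

text \<open>Adding a positive multiple of the shifted loop, with a nowhere constant function in the
  vacant coordinate, makes every finitary loop nowhere constant at once.\<close>

definition regularize :: "real \<Rightarrow> (real \<Rightarrow> nat \<Rightarrow> real) \<Rightarrow> real \<Rightarrow> nat \<Rightarrow> real" where
  "regularize t \<omega> s n = \<omega> s n + t * (case n of 0 \<Rightarrow> s * (1 - s) | Suc m \<Rightarrow> \<omega> s m)"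

lemma regularize_0 [simp]: "regularize 0 \<omega> = \<omega>"
  by (simp add: regularize_def fun_eq_iff)

lemma finitary_loop_regularize:
  assumes "finitary_loop \<omega>" shows "finitary_loop (regularize t \<omega>)"
  unfolding finitary_loop_def
proof (intro conjI allI)
  obtain N where N: "\<And>n s. n \<ge> N \<Longrightarrow> s \<in> {0..1} \<Longrightarrow> \<omega> s n = 0"
    using assms unfolding finitary_loop_def by blast
  have c: "continuous_on {0..1} (\<lambda>s. \<omega> s n)" for n using assms by (simp add: finitary_loop_def)
  show "continuous_on {0..1} (\<lambda>s. regularize t \<omega> s n)" for n
    unfolding regularize_def by (cases n) (auto intro!: continuous_intros c)
  show "regularize t \<omega> 0 n = 0" "regularize t \<omega> 1 n = 0" for n
    using assms by (auto simp: regularize_def finitary_loop_def split: nat.split)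
  show "\<exists>N. \<forall>n\<ge>N. \<forall>s\<in>{0..1}. regularize t \<omega> s n = 0"
    using N by (intro exI[of _ "Suc N"]) (auto simp: regularize_def split: nat.split)
qed

text \<open>If \<open>regularize t \<omega>\<close> is constant on an interval, then coordinate \<open>n\<close> of \<open>\<omega>\<close> differs there
  by a constant from a nonzero multiple of \<open>s (1 - s)\<close>, for every \<open>n\<close>. Almost all
  coordinates vanish, so \<open>s (1 - s)\<close> would be constant on that interval.\<close>

lemma nowhere_constant_regularize:
  assumes \<omega>: "finitary_loop \<omega>" and t: "t > 0"
  shows "nowhere_constant (regularize t \<omega>)"
  unfolding nowhere_constant_def
proof (intro ballI impI, rule ccontr)
  fix a b :: real assume a: "a \<in> {0..1}" and b: "b \<in> {0..1}" and "a < b"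
    and "\<not> (\<exists>s\<in>{a..b}. regularize t \<omega> s \<noteq> regularize t \<omega> a)"
  then have eq: "regularize t \<omega> s n = regularize t \<omega> a n" if "s \<in> {a..b}" for s n
    using that by metis
  obtain N where N: "\<And>n s. n \<ge> N \<Longrightarrow> s \<in> {0..1} \<Longrightarrow> \<omega> s n = 0"
    using \<omega> unfolding finitary_loop_def by blast
  have bump: "s * (1 - s) = a * (1 - a)" if s: "s \<in> {a..b}" for s
  proof -
    define D where "D n = \<omega> s n - \<omega> a n" for n
    have D0: "D 0 + t * (s * (1 - s) - a * (1 - a)) = 0"
      using eq[OF s, of 0] by (simp add: regularize_def D_def algebra_simps)
    have DS: "D (Suc m) + t * D m = 0" for m
      using eq[OF s, of "Suc m"] by (simp add: regularize_def D_def algebra_simps)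
    have "s \<in> {0..1}" using s a b by auto
    then have "D N = 0" using N[of N s] N[of N a] a by (simp add: D_def)
    moreover have "D m = 0 \<Longrightarrow> D 0 = 0" for m
    proof (induction m)
      case (Suc m)
      then show ?case using DS[of m] t by simp
    qed
    ultimately have "D 0 = 0" by blast
    then show ?thesis using D0 t by simp
  qed
  have "(b - a) * (1 - a - b) = 0"
    using bump[of b] \<open>a < b\<close> by (simp add: algebra_simps)
  then have ab: "b = 1 - a" using \<open>a < b\<close> by simp
  have "(1/2) * (1 - 1/2) = a * (1 - a)" using \<open>a < b\<close> ab by (intro bump) auto
  then have "(a - 1/2) * (a - 1/2) = 0" by (simp add: algebra_simps)
  then show False using ab \<open>a < b\<close> by simp
qed

text \<open>These pairs will be the execution paths of the thickening of \<open>X\<close>. The reparametrization \<open>\<psi>\<close> makes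
  them stable under \<open>M11\<close>; that \<open>\<rho>\<close> is nowhere constant means that \<open>\<omega>\<close> stops only where \<open>\<psi>\<close> does.\<close>

definition regular_pair :: "'u mdspace \<Rightarrow> (real \<Rightarrow> 'u) \<Rightarrow> (real \<Rightarrow> nat \<Rightarrow> real) \<Rightarrow> bool" where
  "regular_pair X \<gamma> \<omega> \<longleftrightarrow> (\<exists>\<delta> \<in> expaths X. \<exists>\<rho>. \<exists>\<psi> \<in> M11. finitary_loop \<rho> \<and> nowhere_constant \<rho> \<and>
     \<gamma> = compose {0..1} \<delta> \<psi> \<and> (\<forall>s \<in> {0..1}. \<omega> s = \<rho> (\<psi> s)))"

lemma M11_id: "(\<lambda>s. s) \<in> M11"
  by (auto simp: M11_def mono_on_def)

lemma M11_mono: "\<phi> \<in> M11 \<Longrightarrow> s \<in> {0..1} \<Longrightarrow> t \<in> {0..1} \<Longrightarrow> s \<le> t \<Longrightarrow> \<phi> s \<le> \<phi> t"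
  by (auto simp: M11_def mono_on_def)

lemma M11_compose:
  assumes "\<psi> \<in> M11" "\<phi> \<in> M11" shows "(\<lambda>s. \<psi> (\<phi> s)) \<in> M11"
proof -
  have "(\<lambda>s. \<psi> (\<phi> s)) ` {0..1} = \<psi> ` (\<phi> ` {0..1})" by (simp add: image_image)
  also have "\<dots> = {0..1}" using assms by (simp add: M11_def)
  finally have "(\<lambda>s. \<psi> (\<phi> s)) ` {0..1} = {0..1}" .
  moreover have "mono_on {0..1} (\<lambda>s. \<psi> (\<phi> s))"
    by (rule mono_onI) (simp add: M11_mono[OF assms(1)] M11_mono[OF assms(2)] M11_app[OF assms(2), simplified])
  ultimately show ?thesis by (simp add: M11_def)
qed

lemma regular_pairI:
  assumes X: "path_data X" and "\<gamma> \<in> expaths X" "finitary_loop \<omega>" "nowhere_constant \<omega>"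
  shows "regular_pair X \<gamma> \<omega>"
proof -
  have "\<gamma> \<in> extensional {0..1}" using assms by (auto simp: path_data_def cmaps_def)
  then have "\<gamma> = compose {0..1} \<gamma> (\<lambda>s. s)" by (auto simp: compose_def fun_eq_iff extensional_def)
  then show ?thesis unfolding regular_pair_def using assms M11_id by blast
qed

lemma regular_pair_expath:
  assumes "is_mdspace Top X" "regular_pair X \<gamma> \<omega>" shows "\<gamma> \<in> expaths X"
  using assms by (auto simp: regular_pair_def is_mdspace_def)

lemma finitary_loop_reparam:
  assumes \<rho>: "finitary_loop \<rho>" and \<psi>: "\<psi> \<in> M11" and eq: "\<And>s. s \<in> {0..1} \<Longrightarrow> \<omega> s = \<rho> (\<psi> s)"
  shows "finitary_loop \<omega>"
  unfolding finitary_loop_def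
proof (intro conjI allI)
  fix n
  have "continuous_on {0..1} (\<lambda>s. \<rho> (\<psi> s) n)"
  proof (rule continuous_on_compose2[of "{0..1}" "\<lambda>s. \<rho> s n"])
    show "continuous_on {0..1} (\<lambda>s. \<rho> s n)" using \<rho> by (simp add: finitary_loop_def)
  qed (use M11_continuous[OF \<psi>] M11_app[OF \<psi>] in auto)
  then show "continuous_on {0..1} (\<lambda>s. \<omega> s n)" by (rule continuous_on_eq) (simp add: eq)
  show "\<omega> 0 n = 0" "\<omega> 1 n = 0" using \<rho> eq[of 0] eq[of 1] M11_ends[OF \<psi>] by (auto simp: finitary_loop_def)
next
  obtain N where "\<And>n s. n \<ge> N \<Longrightarrow> s \<in> {0..1} \<Longrightarrow> \<rho> s n = 0" using \<rho> unfolding finitary_loop_def by blast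
  then show "\<exists>N. \<forall>n\<ge>N. \<forall>s\<in>{0..1}. \<omega> s n = 0" using eq M11_app[OF \<psi>] by (intro exI[of _ N]) simp
qed

lemma regular_pair_loop: "regular_pair X \<gamma> \<omega> \<Longrightarrow> finitary_loop \<omega>"
  unfolding regular_pair_def using finitary_loop_reparam by blast

lemma regular_pair_cong:
  assumes "regular_pair X \<gamma> \<omega>" "\<And>s. s \<in> {0..1} \<Longrightarrow> \<omega>' s = \<omega> s" shows "regular_pair X \<gamma> \<omega>'"
  using assms unfolding regular_pair_def by (metis (no_types, lifting))

lemma regular_pair_reparam:
  assumes "regular_pair X \<gamma> \<omega>" and \<phi>: "\<phi> \<in> M11"
  shows "regular_pair X (compose {0..1} \<gamma> \<phi>) (\<lambda>s. \<omega> (\<phi> s))"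
proof -
  obtain \<delta> \<rho> \<psi> where *: "\<delta> \<in> expaths X" "\<psi> \<in> M11" "finitary_loop \<rho>" "nowhere_constant \<rho>"
    "\<gamma> = compose {0..1} \<delta> \<psi>" "\<forall>s \<in> {0..1}. \<omega> s = \<rho> (\<psi> s)"
    using assms(1) unfolding regular_pair_def by blast
  have "compose {0..1} \<gamma> \<phi> = compose {0..1} \<delta> (\<lambda>s. \<psi> (\<phi> s))"
    unfolding *(5) using M11_app[OF \<phi>] by (auto simp: compose_def fun_eq_iff)
  moreover have "\<forall>s \<in> {0..1}. \<omega> (\<phi> s) = \<rho> (\<psi> (\<phi> s))" using *(6) M11_app[OF \<phi>] by blast
  ultimately show ?thesis
    unfolding regular_pair_def using * M11_compose[OF *(2) \<phi>] by blast
qed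

lemma M11_concat:
  assumes 1: "\<psi>1 \<in> M11" and 2: "\<psi>2 \<in> M11"
  shows "(\<lambda>t. if t \<le> 1/2 then \<psi>1 (2 * t) / 2 else (1 + \<psi>2 (2 * t - 1)) / 2) \<in> M11" (is "?\<psi> \<in> M11")
proof -
  have r1: "0 \<le> \<psi>1 s" "\<psi>1 s \<le> 1" if "0 \<le> s" "s \<le> 1" for s using M11_app[OF 1, of s] that by auto
  have r2: "0 \<le> \<psi>2 s" "\<psi>2 s \<le> 1" if "0 \<le> s" "s \<le> 1" for s using M11_app[OF 2, of s] that by auto
  have "mono_on {0..1} ?\<psi>"
  proof (rule mono_onI)
    fix s t :: real assume st: "s \<in> {0..1}" "t \<in> {0..1}" "s \<le> t"
    consider "t \<le> 1/2" | "s \<le> 1/2" "t > 1/2" | "s > 1/2" by linarith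
    then show "?\<psi> s \<le> ?\<psi> t"
    proof cases
      case 1 then show ?thesis using st M11_mono[OF \<open>\<psi>1 \<in> M11\<close>, of "2 * s" "2 * t"] by auto
    next
      case 2 then show ?thesis using st r1(2)[of "2 * s"] r2(1)[of "2 * t-1"] by auto
    next
      case 3 then show ?thesis using st M11_mono[OF \<open>\<psi>2 \<in> M11\<close>, of "2 * s-1" "2 * t-1"] by auto
    qed
  qed
  moreover have "?\<psi> ` {0..1} = {0..1}"
  proof
    show "?\<psi> ` {0..1} \<subseteq> {0..1}"
    proof
      fix y assume "y \<in> ?\<psi> ` {0..1}"
      then obtain t where "t \<in> {0..1}" "y = ?\<psi> t" by (rule imageE)
      then have t: "0 \<le> t" "t \<le> 1" "y = ?\<psi> t" by auto
      show "y \<in> {0..1}"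
        using t r1[of "2 * t"] r2[of "2 * t-1"] by (auto split: if_splits)
    qed
    show "{0..1} \<subseteq> ?\<psi> ` {0..1}"
    proof
      fix u :: real assume u: "u \<in> {0..1}"
      show "u \<in> ?\<psi> ` {0..1}"
      proof (cases "u \<le> 1/2")
        case True
        then have "2 * u \<in> \<psi>1 ` {0..1}" using 1 u by (simp add: M11_def)
        then obtain s where "s \<in> {0..1}" "\<psi>1 s = 2 * u" by auto
        then show ?thesis by (intro image_eqI[of _ _ "s/2"]) auto
      next
        case False
        then have "2 * u - 1 \<in> \<psi>2 ` {0..1}" using 2 u by (simp add: M11_def)
        then obtain s where s: "s \<in> {0..1}" "\<psi>2 s = 2 * u - 1" by auto
        have "s \<noteq> 0" using s M11_ends[OF 2] False by auto
        moreover have "2 * ((s + 1) / 2) - 1 = s" by (simp add: field_simps)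
        ultimately have "u = ?\<psi> ((s + 1) / 2)" using s by simp
        then show ?thesis using s(1) by (intro image_eqI[of _ _ "(s + 1) / 2"]) auto
      qed
    qed
  qed
  ultimately show ?thesis by (simp add: M11_def)
qed

lemma finitary_loop_concat:
  assumes 1: "finitary_loop \<rho>1" and 2: "finitary_loop \<rho>2"
  shows "finitary_loop (\<lambda>s. if s \<le> 1/2 then \<rho>1 (2 * s) else \<rho>2 (2 * s - 1))" (is "finitary_loop ?\<rho>")
  unfolding finitary_loop_def
proof (intro conjI allI)
  fix n
  have "continuous_map unit_interval euclideanreal (\<lambda>s. if s \<le> 1/2 then \<rho>1 (2 * s) n else \<rho>2 (2 * s - 1) n)"
    using continuous_map_halves[of euclideanreal "\<lambda>s. \<rho>1 s n" "\<lambda>s. \<rho>2 s n"] assms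
    by (simp add: finitary_loop_def)
  then show "continuous_on {0..1} (\<lambda>s. ?\<rho> s n)" by (simp add: if_distrib[of "\<lambda>f. f n"])
  show "?\<rho> 0 n = 0" "?\<rho> 1 n = 0" using assms by (auto simp: finitary_loop_def)
next
  obtain N1 N2 where "\<And>n s. n \<ge> N1 \<Longrightarrow> s \<in> {0..1} \<Longrightarrow> \<rho>1 s n = 0" "\<And>n s. n \<ge> N2 \<Longrightarrow> s \<in> {0..1} \<Longrightarrow> \<rho>2 s n = 0"
    using assms unfolding finitary_loop_def by blast
  then show "\<exists>N. \<forall>n\<ge>N. \<forall>s\<in>{0..1}. ?\<rho> s n = 0" by (intro exI[of _ "max N1 N2"]) simp
qed

lemma nowhere_constant_concat:
  assumes 1: "nowhere_constant \<rho>1" and 2: "nowhere_constant \<rho>2" and eq: "\<rho>1 1 = \<rho>2 0"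
  shows "nowhere_constant (\<lambda>s. if s \<le> 1/2 then \<rho>1 (2 * s) else \<rho>2 (2 * s - 1))" (is "nowhere_constant ?\<rho>")
  unfolding nowhere_constant_def
proof (intro ballI impI)
  fix a b :: real assume ab: "a \<in> {0..1}" "b \<in> {0..1}" "a < b"
  show "\<exists>s\<in>{a..b}. ?\<rho> s \<noteq> ?\<rho> a"
  proof (cases "a < 1/2")
    case True
    have "2 * a \<in> {0..1}" "min (2 * b) 1 \<in> {0..1}" "2 * a < min (2 * b) 1" using ab True by auto
    then obtain s where s: "s \<in> {2 * a..min (2 * b) 1}" "\<rho>1 s \<noteq> \<rho>1 (2 * a)"
      using 1 unfolding nowhere_constant_def by blast
    then show ?thesis using True by (intro bexI[of _ "s / 2"]) auto
  next
    case False
    have "2 * a - 1 \<in> {0..1}" "2 * b - 1 \<in> {0..1}" "2 * a - 1 < 2 * b - 1" using ab False by auto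
    then obtain s where s: "s \<in> {2 * a - 1..2 * b - 1}" "\<rho>2 s \<noteq> \<rho>2 (2 * a - 1)"
      using 2 unfolding nowhere_constant_def by blast
    have r: "?\<rho> ((u + 1) / 2) = \<rho>2 u" if "u \<ge> 0" for u
    proof (cases "u = 0")
      case True then show ?thesis using eq by simp
    next
      case False
      then have "\<not> (u + 1) / 2 \<le> 1 / 2" using that by simp
      moreover have "2 * ((u + 1) / 2) - 1 = u" by (simp add: field_simps)
      ultimately show ?thesis by simp
    qed
    have "?\<rho> ((s + 1) / 2) = \<rho>2 s" by (rule r) (use s(1) False in auto)
    moreover have "?\<rho> a = \<rho>2 (2 * a - 1)"
    proof -
      have "a = (2 * a - 1 + 1) / 2" by simp
      also have "?\<rho> \<dots> = \<rho>2 (2 * a - 1)" by (rule r) (use False in auto)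
      finally show ?thesis .
    qed
    ultimately have "?\<rho> ((s + 1) / 2) \<noteq> ?\<rho> a" using s(2) by simp
    moreover have "(s + 1) / 2 \<in> {a..b}" using s(1) by (simp add: field_simps)
    ultimately show ?thesis by blast
  qed
qed

text \<open>All loops are based at \<open>0\<close>, so the accompanying loops can be concatenated whenever the
  execution paths can.\<close>

lemma regular_pair_concat:
  assumes X: "is_mdspace Top X" and 1: "regular_pair X \<gamma>1 \<omega>1" and 2: "regular_pair X \<gamma>2 \<omega>2"
    and eq: "\<gamma>1 1 = \<gamma>2 0"
  shows "regular_pair X (ncomp \<gamma>1 \<gamma>2) (\<lambda>s. if s \<le> 1/2 then \<omega>1 (2 * s) else \<omega>2 (2 * s - 1))"
proof -
  obtain \<delta>1 \<rho>1 \<psi>1 where f1: "\<delta>1 \<in> expaths X" "\<psi>1 \<in> M11" "finitary_loop \<rho>1" "nowhere_constant \<rho>1"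
    "\<gamma>1 = compose {0..1} \<delta>1 \<psi>1" "\<And>s. s \<in> {0..1} \<Longrightarrow> \<omega>1 s = \<rho>1 (\<psi>1 s)"
    using 1 unfolding regular_pair_def by blast
  obtain \<delta>2 \<rho>2 \<psi>2 where f2: "\<delta>2 \<in> expaths X" "\<psi>2 \<in> M11" "finitary_loop \<rho>2" "nowhere_constant \<rho>2"
    "\<gamma>2 = compose {0..1} \<delta>2 \<psi>2" "\<And>s. s \<in> {0..1} \<Longrightarrow> \<omega>2 s = \<rho>2 (\<psi>2 s)"
    using 2 unfolding regular_pair_def by blast
  define \<psi> where "\<psi> = (\<lambda>t. if t \<le> 1/2 then \<psi>1 (2 * t) / 2 else (1 + \<psi>2 (2 * t - 1)) / 2)"
  define \<rho> where "\<rho> = (\<lambda>s. if s \<le> 1/2 then \<rho>1 (2 * s) else \<rho>2 (2 * s - 1))"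
  have \<delta>12: "\<delta>1 1 = \<delta>2 0"
    using eq M11_ends[OF f1(2)] M11_ends[OF f2(2)] by (simp add: f1(5) f2(5) compose_def)
  have \<rho>12: "\<rho>1 1 = \<rho>2 0" using f1(3) f2(3) by (simp add: finitary_loop_def fun_eq_iff)
  have "ncomp \<delta>1 \<delta>2 \<in> expaths X" using X f1(1) f2(1) \<delta>12 by (simp add: is_mdspace_def)
  moreover have "\<psi> \<in> M11" unfolding \<psi>_def by (rule M11_concat[OF f1(2) f2(2)])
  moreover have "finitary_loop \<rho>" unfolding \<rho>_def by (rule finitary_loop_concat[OF f1(3) f2(3)])
  moreover have "nowhere_constant \<rho>" unfolding \<rho>_def by (rule nowhere_constant_concat[OF f1(4) f2(4) \<rho>12])
  moreover have at: "(ncomp \<gamma>1 \<gamma>2) t = ncomp \<delta>1 \<delta>2 (\<psi> t) \<and>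
      (if t \<le> 1/2 then \<omega>1 (2 * t) else \<omega>2 (2 * t - 1)) = \<rho> (\<psi> t)" if t: "t \<in> {0..1}" for t
  proof (cases "t \<le> 1/2")
    case True
    then have "2 * t \<in> {0..1}" using t by auto
    then have "\<psi>1 (2 * t) \<in> {0..1}" by (rule M11_app[OF f1(2)])
    then show ?thesis
      using True t f1(5) f1(6)[of "2 * t"] by (simp add: ncomp_def compose_def \<psi>_def \<rho>_def)
  next
    case False
    then have t2: "2 * t - 1 \<in> {0..1}" using t by auto
    then have r: "\<psi>2 (2 * t - 1) \<in> {0..1}" by (rule M11_app[OF f2(2)])
    show ?thesis
    proof (cases "\<psi>2 (2 * t - 1) = 0")
      case True
      \<comment> \<open>Both halves meet at time 1/2, which \<open>ncomp\<close> assigns to the first half.\<close>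
      then have "\<psi> t \<le> 1/2" "2 * \<psi> t = 1" "\<psi> t \<in> {0..1}" using False by (simp_all add: \<psi>_def)
      then show ?thesis
        using False t t2 True \<delta>12 \<rho>12 f2(5) f2(6)[OF t2] by (simp add: ncomp_def compose_def \<rho>_def)
    next
      case nz: False
      have "\<psi> t = (1 + \<psi>2 (2 * t - 1)) / 2" using False by (simp add: \<psi>_def)
      then have "2 * \<psi> t = 1 + \<psi>2 (2 * t - 1)" by simp
      then have "\<psi> t > 1/2" "2 * \<psi> t - 1 = \<psi>2 (2 * t - 1)" "\<psi> t \<le> 1" using nz r by auto
      then show ?thesis
        using False t t2 f2(5) f2(6)[OF t2] by (simp add: ncomp_def compose_def \<rho>_def)
    qed
  qed
  moreover have "ncomp \<gamma>1 \<gamma>2 = compose {0..1} (ncomp \<delta>1 \<delta>2) \<psi>"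
  proof
    fix t show "ncomp \<gamma>1 \<gamma>2 t = compose {0..1} (ncomp \<delta>1 \<delta>2) \<psi> t"
    proof (cases "t \<in> {0..1}")
      case True then show ?thesis using at by (simp add: compose_def)
    next
      case False then show ?thesis by (auto simp: compose_def ncomp_def)
    qed
  qed
  ultimately show ?thesis unfolding regular_pair_def by blast
qed

text \<open>The reason for nowhere constant loops. If \<open>\<gamma>\<phi> = \<delta>\<psi>\<close> and \<open>\<omega>\<phi> = \<rho>\<psi>\<close>, then \<open>\<psi>\<close> is constant
  wherever \<open>\<phi>\<close> is, because \<open>\<rho>\<close> is constant on no interval. So \<open>\<psi>\<close> factors through \<open>\<phi>\<close>, and the
  other factor exhibits \<open>\<gamma>\<close> and \<open>\<omega>\<close> themselves as reparametrizations of \<open>\<delta>\<close> and \<open>\<rho>\<close>.\<close>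

lemma regular_pair_desat:
  assumes \<gamma>: "\<gamma> \<in> extensional {0..1}" and \<phi>: "\<phi> \<in> M11"
    and r: "regular_pair X (compose {0..1} \<gamma> \<phi>) (\<lambda>s. \<omega> (\<phi> s))"
  shows "regular_pair X \<gamma> \<omega>"
proof -
  obtain \<delta> \<rho> \<psi> where *: "\<delta> \<in> expaths X" "\<psi> \<in> M11" "finitary_loop \<rho>" "nowhere_constant \<rho>"
    "compose {0..1} \<gamma> \<phi> = compose {0..1} \<delta> \<psi>" "\<And>s. s \<in> {0..1} \<Longrightarrow> \<omega> (\<phi> s) = \<rho> (\<psi> s)"
    using r unfolding regular_pair_def by blast
  have le: "\<psi> t \<le> \<psi> s" if st: "s \<in> {0..1}" "t \<in> {0..1}" "\<phi> s = \<phi> t" for s t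
  proof (rule ccontr)
    assume "\<not> \<psi> t \<le> \<psi> s"
    then have lt: "\<psi> s < \<psi> t" by simp
    then have "s < t" using M11_mono[OF *(2) st(2) st(1)] by linarith
    obtain u where u: "u \<in> {\<psi> s..\<psi> t}" "\<rho> u \<noteq> \<rho> (\<psi> s)"
      using *(4) lt M11_app[OF *(2) st(1)] M11_app[OF *(2) st(2)] unfolding nowhere_constant_def by blast
    have "u \<in> \<psi> ` {0..1}"
      using u(1) M11_app[OF *(2) st(1)] M11_app[OF *(2) st(2)] *(2) by (simp add: M11_def)
    then obtain r where r: "r \<in> {0..1}" "u = \<psi> r" by auto
    have "s \<le> r"
    proof (rule ccontr)
      assume "\<not> s \<le> r"
      then have "u = \<psi> s" using M11_mono[OF *(2) r(1) st(1)] u(1) r(2) by simp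
      then show False using u(2) by simp
    qed
    have "\<rho> (\<psi> t) = \<rho> (\<psi> s)" using *(6) st by metis
    have "r \<le> t"
    proof (rule ccontr)
      assume "\<not> r \<le> t"
      then have "u = \<psi> t" using M11_mono[OF *(2) st(2) r(1)] u(1) r(2) by simp
      then show False using u(2) \<open>\<rho> (\<psi> t) = \<rho> (\<psi> s)\<close> by simp
    qed
    have "\<phi> r = \<phi> s"
      using M11_mono[OF \<phi> st(1) r(1) \<open>s \<le> r\<close>] M11_mono[OF \<phi> r(1) st(2) \<open>r \<le> t\<close>] st(3) by simp
    then show False using u(2) r *(6)[of r] *(6)[of s] st(1) by simp
  qed
  \<comment> \<open>By \<open>le\<close>, applied both ways, the choice of a preimage under \<open>\<phi>\<close> does not matter.\<close>
  define \<theta> where "\<theta> u = \<psi> (SOME s. s \<in> {0..1} \<and> \<phi> s = u)" for u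
  have \<theta>: "\<theta> (\<phi> s) = \<psi> s" if "s \<in> {0..1}" for s
  proof -
    have "(SOME s'. s' \<in> {0..1} \<and> \<phi> s' = \<phi> s) \<in> {0..1} \<and> \<phi> (SOME s'. s' \<in> {0..1} \<and> \<phi> s' = \<phi> s) = \<phi> s"
      using that by (metis (mono_tags, lifting) someI)
    then show ?thesis unfolding \<theta>_def using le that by (metis order_antisym)
  qed
  have surj: "\<exists>s \<in> {0..1}. u = \<phi> s" if "u \<in> {0..1}" for u
    using that \<phi> by (auto simp: M11_def)
  have "mono_on {0..1} \<theta>"
  proof (rule mono_onI)
    fix u v :: real assume uv: "u \<in> {0..1}" "v \<in> {0..1}" "u \<le> v"
    then obtain s t where st: "s \<in> {0..1}" "u = \<phi> s" "t \<in> {0..1}" "v = \<phi> t" using surj by metis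
    show "\<theta> u \<le> \<theta> v"
    proof (cases "s \<le> t")
      case True then show ?thesis using st \<theta> M11_mono[OF *(2)] by simp
    next
      case False
      then have "u = v" using M11_mono[OF \<phi> st(3) st(1)] st uv(3) by simp
      then show ?thesis by simp
    qed
  qed
  moreover have "\<theta> ` {0..1} = {0..1}"
  proof -
    have "\<theta> ` {0..1} = \<theta> ` (\<phi> ` {0..1})" using \<phi> by (simp add: M11_def)
    also have "\<dots> = \<psi> ` {0..1}" unfolding image_image using \<theta> by (rule image_cong[OF refl])
    also have "\<dots> = {0..1}" using *(2) by (simp add: M11_def)
    finally show ?thesis .
  qed
  ultimately have "\<theta> \<in> M11" by (simp add: M11_def)
  moreover have "\<omega> u = \<rho> (\<theta> u)" if "u \<in> {0..1}" for u
    using surj[OF that] *(6) \<theta> by metis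
  moreover have "\<gamma> = compose {0..1} \<delta> \<theta>"
  proof
    fix u show "\<gamma> u = compose {0..1} \<delta> \<theta> u"
    proof (cases "u \<in> {0..1}")
      case True
      then obtain s where s: "s \<in> {0..1}" "u = \<phi> s" using surj by blast
      have "\<gamma> (\<phi> s) = \<delta> (\<psi> s)" using fun_cong[OF *(5), of s] s(1) by (simp add: compose_def)
      then show ?thesis using s True \<theta>[OF s(1)] by (simp add: compose_def)
    next
      case False then show ?thesis using \<gamma> by (auto simp: compose_def extensional_def)
    qed
  qed
  ultimately show ?thesis unfolding regular_pair_def using * by blast
qed

section \<open>The thickening\<close>

text \<open>\<open>\<Delta>\<close>-Hausdorff spaces have closed coincidence sets of paths, as Hausdorff spaces do. Unlike
  the definition, this passes to products at once.\<close>

lemma Delta_Hausdorff_coincidence_closed: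
  assumes T: "T \<in> Delta_Hausdorff_spaces" and p: "pathin T p" and q: "pathin T q"
  shows "closedin (prod_topology unit_interval unit_interval)
           {z \<in> topspace (prod_topology unit_interval unit_interval). p (fst z) = q (snd z)}"
    (is "closedin ?I2 ?E")
proof -
  have image_closed: "closedin T (r ` {0..1})" if "pathin T r" for r
    using T that by (simp add: Delta_Hausdorff_spaces_def)
  have top: "p s \<in> topspace T" "q s \<in> topspace T" if "s \<in> {0..1}" for s
    using p q that by (auto simp: pathin_def dest: continuous_map_app)
  have "openin ?I2 (topspace ?I2 - ?E)"
  proof (subst openin_subopen, intro ballI)
    fix z assume z: "z \<in> topspace ?I2 - ?E"
    obtain s0 t0 where st: "z = (s0, t0)" by fastforce
    have s0: "s0 \<in> {0..1}" and t0: "t0 \<in> {0..1}" and ne: "p s0 \<noteq> q t0" using z st by auto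
    have "pathin T (\<lambda>_. q t0)" using top t0 by simp
    then have "closedin T {q t0}" using image_closed[of "\<lambda>_. q t0"] by (simp add: image_constant_conv)
    then have "openin unit_interval {s \<in> topspace unit_interval. p s \<in> topspace T - {q t0}}"
      using p unfolding pathin_def by (intro openin_continuous_map_preimage) auto
    moreover have "s0 \<in> {s \<in> topspace unit_interval. p s \<in> topspace T - {q t0}}" using s0 top ne by auto
    ultimately obtain e where "e > 0"
      and e: "\<And>s. s \<in> {0..1} \<Longrightarrow> dist s s0 < e \<Longrightarrow> s \<in> {s \<in> topspace unit_interval. p s \<in> topspace T - {q t0}}"
      unfolding openin_euclidean_subtopology_iff by (meson)
    \<comment> \<open>A neighbourhood \<open>{a..b}\<close> of \<open>s0\<close> whose image under \<open>p\<close> avoids \<open>q t0\<close>. The image is the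
      image of a path, hence closed, so \<open>q\<close> stays out of it near \<open>t0\<close>.\<close>
    define a where "a = max 0 (s0 - e / 2)"
    define b where "b = min 1 (s0 + e / 2)"
    have ab: "0 \<le> a" "a \<le> s0" "s0 \<le> b" "b \<le> 1" using s0 \<open>e > 0\<close> by (auto simp: a_def b_def)
    have near: "p s \<noteq> q t0" if "s \<in> {a..b}" for s
    proof -
      have "s \<in> {0..1}" "dist s s0 < e"
        using that ab \<open>e > 0\<close> by (auto simp: a_def b_def dist_real_def)
      then show ?thesis using e by blast
    qed
    have "(\<lambda>u. a + u * (b - a)) ` {0..1} = {a..b}"
    proof (cases "a = b")
      case True then show ?thesis by (simp add: image_constant_conv)
    next
      case False
      then show ?thesis
        using ab image_affinity_atLeastAtMost[of "b - a" a 0 1] by (simp add: mult.commute add.commute)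
    qed
    then have im: "(\<lambda>u. p (a + u * (b - a))) ` {0..1} = p ` {a..b}"
      by (metis image_image)
    have "continuous_map unit_interval unit_interval (\<lambda>u. a + u * (b - a))"
    proof -
      have "(\<lambda>u. a + u * (b - a)) ` {0..1} \<subseteq> {0..1}"
        using \<open>(\<lambda>u. a + u * (b - a)) ` {0..1} = {a..b}\<close> ab by auto
      then show ?thesis
        by (auto simp: continuous_map_in_subtopology intro!: continuous_intros)
    qed
    then have "pathin T (p \<circ> (\<lambda>u. a + u * (b - a)))"
      using p unfolding pathin_def by (rule continuous_map_compose)
    then have "closedin T (p ` {a..b})" using image_closed im by (simp add: o_def) metis
    then have "openin unit_interval {t \<in> topspace unit_interval. q t \<in> topspace T - p ` {a..b}}" (is "openin _ ?V")
      using q unfolding pathin_def by (intro openin_continuous_map_preimage) auto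
    moreover have "openin unit_interval ({0..1} \<inter> ball s0 (e / 2))" by auto
    ultimately have "openin ?I2 (({0..1} \<inter> ball s0 (e / 2)) \<times> ?V)"
      by (simp only: openin_prod_Times_iff simp_thms)
    moreover have "z \<in> ({0..1} \<inter> ball s0 (e / 2)) \<times> ?V"
    proof -
      have "q t0 \<notin> p ` {a..b}" using near by (metis imageE)
      then show ?thesis using st s0 t0 \<open>e > 0\<close> top by auto
    qed
    moreover have "({0..1} \<inter> ball s0 (e / 2)) \<times> ?V \<subseteq> topspace ?I2 - ?E"
    proof
      fix y assume y: "y \<in> ({0..1} \<inter> ball s0 (e / 2)) \<times> ?V"
      then have "\<bar>s0 - fst y\<bar> < e / 2" "0 \<le> fst y" "fst y \<le> 1" by (auto simp: dist_real_def)
      then have "s0 - e / 2 \<le> fst y" "fst y \<le> s0 + e / 2" "0 \<le> fst y" "fst y \<le> 1" by linarith+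
      then have "fst y \<in> {a..b}" by (simp add: a_def b_def)
      moreover have "q (snd y) \<notin> p ` {a..b}" using y by auto
      ultimately have "p (fst y) \<noteq> q (snd y)" by (metis image_eqI)
      then show "y \<in> topspace ?I2 - ?E" using y by auto
    qed
    ultimately show "\<exists>N. openin ?I2 N \<and> z \<in> N \<and> N \<subseteq> topspace ?I2 - ?E" by blast
  qed
  then show ?thesis by (auto simp: closedin_def)
qed

lemma Delta_HausdorffI:
  assumes T: "T \<in> Delta_generated_spaces"
    and closed: "\<And>p q. pathin T p \<Longrightarrow> pathin T q \<Longrightarrow> closedin (prod_topology unit_interval unit_interval)
           {z \<in> topspace (prod_topology unit_interval unit_interval). p (fst z) = q (snd z)}"
  shows "T \<in> Delta_Hausdorff_spaces"
proof -
  have "closedin T (p ` {0..1})" if p: "pathin T p" for p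
  proof -
    have "openin T (topspace T - p ` {0..1})"
    proof (rule Delta_generated_openI[OF T])
      fix q assume q: "pathin T q"
      let ?E = "{z \<in> topspace (prod_topology unit_interval unit_interval). p (fst z) = q (snd z)}"
      have "closed_map (prod_topology unit_interval unit_interval) unit_interval snd"
        by (rule closed_map_snd) (simp add: compact_space_subtopology)
      then have "closedin unit_interval (snd ` ?E)" using closed[OF p q] by (simp only: closed_map_def)
      moreover have im: "snd ` ?E = {t \<in> {0..1}. q t \<in> p ` {0..1}}"
      proof
        show "snd ` ?E \<subseteq> {t \<in> {0..1}. q t \<in> p ` {0..1}}"
        proof
          fix t assume "t \<in> snd ` ?E"
          then obtain s where st: "s \<in> {0..1}" "t \<in> {0..1}" "p s = q t" by auto
          then have "q t \<in> p ` {0..1}" by (metis image_eqI)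
          then show "t \<in> {t \<in> {0..1}. q t \<in> p ` {0..1}}" using st by simp
        qed
        show "{t \<in> {0..1}. q t \<in> p ` {0..1}} \<subseteq> snd ` ?E"
        proof
          fix t assume "t \<in> {t \<in> {0..1}. q t \<in> p ` {0..1}}"
          then obtain s where "s \<in> {0..1}" "t \<in> {0..1}" "q t = p s" by auto
          then show "t \<in> snd ` ?E" by (intro image_eqI[of _ _ "(s, t)"]) auto
        qed
      qed
      ultimately have c: "closedin unit_interval {t \<in> {0..1}. q t \<in> p ` {0..1}}" by (simp only: im)
      have eq: "{t \<in> {0..1}. q t \<in> topspace T - p ` {0..1}} = {0..1} - {t \<in> {0..1}. q t \<in> p ` {0..1}}"
        using q by (auto simp: pathin_def dest: continuous_map_app)
      show "openin unit_interval {t \<in> {0..1}. q t \<in> topspace T - p ` {0..1}}"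
        unfolding eq using openin_diff[OF openin_topspace c] by (simp only: topspace_euclidean_subtopology)
    qed auto
    moreover have "p ` {0..1} \<subseteq> topspace T" using p by (auto simp: pathin_def dest: continuous_map_app)
    ultimately show ?thesis by (simp add: closedin_def)
  qed
  then show ?thesis using T by (simp add: Delta_Hausdorff_spaces_def)
qed

lemma continuous_map_pullback_iff:
  "continuous_map C (pullback_topology A f T) g \<longleftrightarrow>
     (\<forall>c \<in> topspace C. g c \<in> A) \<and> continuous_map C T (f \<circ> g)"
proof
  assume g: "continuous_map C (pullback_topology A f T) g"
  have "continuous_map (pullback_topology A f T) T (id \<circ> f)" by (rule continuous_map_pullback) simp
  then have "continuous_map C T (f \<circ> g)" using continuous_map_compose[OF g] by (metis id_comp)
  moreover have "\<forall>c \<in> topspace C. g c \<in> A"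
    using continuous_map_app[OF g] by (auto simp: topspace_pullback_topology)
  ultimately show "(\<forall>c \<in> topspace C. g c \<in> A) \<and> continuous_map C T (f \<circ> g)" by blast
next
  assume "(\<forall>c \<in> topspace C. g c \<in> A) \<and> continuous_map C T (f \<circ> g)"
  then show "continuous_map C (pullback_topology A f T) g"
    by (intro continuous_map_pullback') auto
qed

text \<open>Products with \<open>\<real>\<^sup>\<nat>\<close> are formed inside the given universe by means of an injective
  coding of pairs.\<close>

locale point_coding =
  fixes code :: "'u \<times> (nat \<Rightarrow> real) \<Rightarrow> 'u"
  assumes inj_code: "inj code"
begin

definition base :: "'u \<Rightarrow> 'u" where "base x = fst (inv code x)"

definition height :: "'u \<Rightarrow> nat \<Rightarrow> real" where "height x = snd (inv code x)"

lemma base_code [simp]: "base (code (x, w)) = x" and height_code [simp]: "height (code (x, w)) = w"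
  by (simp_all add: base_def height_def inj_code)

text \<open>The product in the category of \<open>\<Delta>\<close>-generated spaces, transported to codes.\<close>

definition thick_space :: "'u topology \<Rightarrow> 'u topology" where
  "thick_space T = delta_kelley (pullback_topology (code ` (topspace T \<times> UNIV)) (inv code)
     (prod_topology T (product_topology (\<lambda>_. euclideanreal) UNIV)))"

lemma topspace_thick_space: "topspace (thick_space T) = code ` (topspace T \<times> UNIV)"
  by (auto simp: thick_space_def topspace_pullback_topology inj_code)

lemma continuous_map_thick_space:
  assumes "C \<in> Delta_generated_spaces"
  shows "continuous_map C (thick_space T) q \<longleftrightarrow>
     (\<forall>c \<in> topspace C. q c \<in> code ` (topspace T \<times> UNIV)) \<and>
     continuous_map C T (\<lambda>c. base (q c)) \<and> (\<forall>n. continuous_map C euclideanreal (\<lambda>c. height (q c) n))"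
  unfolding thick_space_def continuous_map_into_delta_kelley[OF assms] continuous_map_pullback_iff
    continuous_map_pairwise
  by (simp add: o_def base_def[symmetric] height_def[symmetric] continuous_map_componentwise_UNIV)

lemma thick_space_in_Top:
  assumes "Top = Delta_generated_spaces \<or> Top = Delta_Hausdorff_spaces" and T: "T \<in> Top"
  shows "thick_space T \<in> Top"
proof -
  have dg: "thick_space T \<in> Delta_generated_spaces"
    unfolding thick_space_def by (rule delta_kelley_in_Delta_generated)
  have "thick_space T \<in> Delta_Hausdorff_spaces" if T: "T \<in> Delta_Hausdorff_spaces"
  proof (rule Delta_HausdorffI[OF dg])
    fix p q assume p: "pathin (thick_space T) p" and q: "pathin (thick_space T) q"
    let ?I2 = "prod_topology unit_interval unit_interval"
    have pq: "pathin T (\<lambda>s. base (p s))" "pathin T (\<lambda>s. base (q s))"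
      "continuous_map unit_interval euclideanreal (\<lambda>s. height (p s) n)"
      "continuous_map unit_interval euclideanreal (\<lambda>s. height (q s) n)"
      "s \<in> {0..1} \<Longrightarrow> p s \<in> code ` (topspace T \<times> UNIV)"
      "s \<in> {0..1} \<Longrightarrow> q s \<in> code ` (topspace T \<times> UNIV)" for s n
      using p q unfolding pathin_def continuous_map_thick_space[OF unit_interval_Delta_generated] by auto
    have "closedin ?I2 {z \<in> topspace ?I2. height (p (fst z)) n = height (q (snd z)) n}" for n
    proof -
      have c1: "continuous_map ?I2 euclideanreal (\<lambda>z. height (p (fst z)) n)"
        using continuous_map_compose[OF continuous_map_fst pq(3)[of n]] by (simp only: o_def)
      have c2: "continuous_map ?I2 euclideanreal (\<lambda>z. height (q (snd z)) n)"
        using continuous_map_compose[OF continuous_map_snd pq(4)[of n]] by (simp only: o_def)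
      have "closedin ?I2 {z \<in> topspace ?I2. height (p (fst z)) n - height (q (snd z)) n \<in> {0}}"
        by (rule closedin_continuous_map_preimage[OF continuous_map_diff[OF c1 c2]]) simp
      then show ?thesis by simp
    qed
    then have "closedin ?I2 (\<Inter>n. {z \<in> topspace ?I2. height (p (fst z)) n = height (q (snd z)) n})"
      by (intro closedin_INT) auto
    then have "closedin ?I2 ({z \<in> topspace ?I2. base (p (fst z)) = base (q (snd z))} \<inter>
        (\<Inter>n. {z \<in> topspace ?I2. height (p (fst z)) n = height (q (snd z)) n}))"
      using Delta_Hausdorff_coincidence_closed[OF T pq(1,2)] by (intro closedin_Int)
    moreover have "({z \<in> topspace ?I2. base (p (fst z)) = base (q (snd z))} \<inter>
        (\<Inter>n. {z \<in> topspace ?I2. height (p (fst z)) n = height (q (snd z)) n}))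
        = {z \<in> topspace ?I2. p (fst z) = q (snd z)}"
    proof -
      have "p s = q t \<longleftrightarrow> base (p s) = base (q t) \<and> (\<forall>n. height (p s) n = height (q t) n)"
        if "s \<in> {0..1}" "t \<in> {0..1}" for s t
      proof -
        have "(\<forall>n. height (p s) n = height (q t) n) \<longleftrightarrow> height (p s) = height (q t)" by (simp add: fun_eq_iff)
        then show ?thesis using pq(5)[OF that(1)] pq(6)[OF that(2)] by auto
      qed
      then show ?thesis by auto
    qed
    ultimately show "closedin ?I2 {z \<in> topspace ?I2. p (fst z) = q (snd z)}" by simp
  qed
  then show ?thesis using assms dg by auto
qed

definition lift :: "(real \<Rightarrow> 'u) \<Rightarrow> (real \<Rightarrow> nat \<Rightarrow> real) \<Rightarrow> real \<Rightarrow> 'u" where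
  "lift \<gamma> \<omega> = (\<lambda>s \<in> {0..1}. code (\<gamma> s, \<omega> s))"

definition thicken :: "'u mdspace \<Rightarrow> 'u mdspace" where
  "thicken X = \<lparr>und = thick_space (und X), states = (\<lambda>\<alpha>. code (\<alpha>, \<lambda>_. 0)) ` states X,
     expaths = {lift \<gamma> \<omega> |\<gamma> \<omega>. regular_pair X \<gamma> \<omega>}\<rparr>"

lemma lift_cmaps:
  assumes "\<gamma> \<in> cmaps unit_interval T" "finitary_loop \<omega>"
  shows "lift \<gamma> \<omega> \<in> cmaps unit_interval (thick_space T)"
proof -
  have top: "\<gamma> s \<in> topspace T" if "s \<in> {0..1}" for s
    using assms(1) that continuous_map_app[of unit_interval T \<gamma> s] by (simp add: cmaps_def)
  have "continuous_map unit_interval T (\<lambda>s. base (lift \<gamma> \<omega> s))"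
    by (rule continuous_map_eq[of _ _ \<gamma>]) (use assms(1) in \<open>auto simp: cmaps_def lift_def\<close>)
  moreover have "continuous_map unit_interval euclideanreal (\<lambda>s. height (lift \<gamma> \<omega> s) n)" for n
    by (rule continuous_map_eq[of _ _ "\<lambda>s. \<omega> s n"]) (use assms(2) in \<open>auto simp: finitary_loop_def lift_def\<close>)
  ultimately have "continuous_map unit_interval (thick_space T) (lift \<gamma> \<omega>)"
    unfolding continuous_map_thick_space[OF unit_interval_Delta_generated] using top by (auto simp: lift_def)
  then show ?thesis by (simp add: cmaps_def lift_def)
qed

lemma is_mdspace_thicken:
  assumes Top: "Top = Delta_generated_spaces \<or> Top = Delta_Hausdorff_spaces" and X: "is_mdspace Top X"
  shows "is_mdspace Top (thicken X)"
proof -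
  have g: "\<gamma> \<in> cmaps unit_interval (und X)" "\<gamma> 0 \<in> states X" "\<gamma> 1 \<in> states X" "finitary_loop \<omega>"
    if "regular_pair X \<gamma> \<omega>" for \<gamma> \<omega>
    using regular_pair_expath[OF X that] X regular_pair_loop[OF that] by (auto simp: is_mdspace_def)
  show ?thesis
    unfolding is_mdspace_def
  proof (intro conjI ballI impI)
    show "und (thicken X) \<in> Top"
      using X thick_space_in_Top[OF Top] by (simp add: thicken_def is_mdspace_def)
    show "states (thicken X) \<subseteq> topspace (und (thicken X))"
      using X by (auto simp: thicken_def topspace_thick_space is_mdspace_def)
    show "expaths (thicken X) \<subseteq> cmaps unit_interval (und (thicken X))"
      using lift_cmaps g by (auto simp: thicken_def)
  next
    fix \<gamma>' assume "\<gamma>' \<in> expaths (thicken X)"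
    then obtain \<gamma> \<omega> where r: "regular_pair X \<gamma> \<omega>" "\<gamma>' = lift \<gamma> \<omega>" by (auto simp: thicken_def)
    have "\<omega> 0 = (\<lambda>_. 0)" "\<omega> 1 = (\<lambda>_. 0)" using g(4)[OF r(1)] by (auto simp: finitary_loop_def)
    then show "\<gamma>' 0 \<in> states (thicken X)" "\<gamma>' 1 \<in> states (thicken X)"
      using g(2,3)[OF r(1)] r(2) by (auto simp: lift_def thicken_def)
    fix \<phi> assume \<phi>: "\<phi> \<in> M11"
    have "compose {0..1} \<gamma>' \<phi> = lift (compose {0..1} \<gamma> \<phi>) (\<lambda>s. \<omega> (\<phi> s))"
      unfolding r(2) lift_def using M11_app[OF \<phi>] by (auto simp: compose_def fun_eq_iff)
    then show "compose {0..1} \<gamma>' \<phi> \<in> expaths (thicken X)"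
      using regular_pair_reparam[OF r(1) \<phi>] by (auto simp: thicken_def)
  next
    fix \<gamma>1' \<gamma>2' assume "\<gamma>1' \<in> expaths (thicken X)" "\<gamma>2' \<in> expaths (thicken X)" and eq: "\<gamma>1' 1 = \<gamma>2' 0"
    then obtain \<gamma>1 \<omega>1 \<gamma>2 \<omega>2 where r1: "regular_pair X \<gamma>1 \<omega>1" "\<gamma>1' = lift \<gamma>1 \<omega>1"
      and r2: "regular_pair X \<gamma>2 \<omega>2" "\<gamma>2' = lift \<gamma>2 \<omega>2" by (auto simp: thicken_def)
    have "\<gamma>1 1 = \<gamma>2 0" using eq r1 r2 inj_code by (simp add: lift_def inj_eq)
    then have "regular_pair X (ncomp \<gamma>1 \<gamma>2) (\<lambda>s. if s \<le> 1/2 then \<omega>1 (2 * s) else \<omega>2 (2 * s - 1))"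
      by (rule regular_pair_concat[OF X r1(1) r2(1)])
    moreover have "ncomp \<gamma>1' \<gamma>2' = lift (ncomp \<gamma>1 \<gamma>2) (\<lambda>s. if s \<le> 1/2 then \<omega>1 (2 * s) else \<omega>2 (2 * s - 1))"
      unfolding r1 r2 lift_def ncomp_def by (auto simp: fun_eq_iff)
    ultimately show "ncomp \<gamma>1' \<gamma>2' \<in> expaths (thicken X)" unfolding thicken_def by auto
  qed
qed

lemma saturated_thicken: "saturated (thicken X)"
  unfolding saturated_def
proof (intro ballI impI)
  fix \<gamma> assume \<gamma>: "\<gamma> \<in> cmaps unit_interval (und (thicken X))"
    and "\<exists>\<phi>\<in>M11. compose {0..1} \<gamma> \<phi> \<in> expaths (thicken X)"
  then obtain \<phi> \<gamma>' \<omega>' where \<phi>: "\<phi> \<in> M11" and r: "regular_pair X \<gamma>' \<omega>'"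
    and eq: "compose {0..1} \<gamma> \<phi> = lift \<gamma>' \<omega>'" by (auto simp: thicken_def)
  define \<beta> where "\<beta> = (\<lambda>s \<in> {0..1}. base (\<gamma> s))"
  have "\<gamma>' \<in> extensional {0..1}"
    using r by (auto simp: regular_pair_def)
  have v: "\<gamma> (\<phi> s) = code (\<gamma>' s, \<omega>' s)" if "s \<in> {0..1}" for s
    using fun_cong[OF eq, of s] that by (simp add: compose_def lift_def)
  have "compose {0..1} \<beta> \<phi> = \<gamma>'"
    using v M11_app[OF \<phi>] \<open>\<gamma>' \<in> extensional {0..1}\<close> by (auto simp: compose_def \<beta>_def fun_eq_iff extensional_def)
  moreover have "regular_pair X \<gamma>' (\<lambda>s. height (\<gamma> (\<phi> s)))"
    by (rule regular_pair_cong[OF r]) (simp add: v)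
  ultimately have "regular_pair X (compose {0..1} \<beta> \<phi>) (\<lambda>s. height (\<gamma> (\<phi> s)))" by simp
  then have "regular_pair X \<beta> (\<lambda>s. height (\<gamma> s))"
    unfolding \<beta>_def by (rule regular_pair_desat[OF restrict_extensional \<phi>])
  moreover have "\<gamma> = lift \<beta> (\<lambda>s. height (\<gamma> s))"
  proof
    fix s show "\<gamma> s = lift \<beta> (\<lambda>s. height (\<gamma> s)) s"
    proof (cases "s \<in> {0..1}")
      case True
      then have "\<gamma> s \<in> topspace (thick_space (und X))"
        using \<gamma> continuous_map_app[of unit_interval _ \<gamma> s] by (simp add: cmaps_def thicken_def)
      then show ?thesis using True by (auto simp: lift_def \<beta>_def topspace_thick_space)
    next
      case False then show ?thesis using \<gamma> by (auto simp: lift_def cmaps_def extensional_def)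
    qed
  qed
  ultimately show "\<gamma> \<in> expaths (thicken X)" unfolding thicken_def by auto
qed

end

section \<open>The thickening as a trivial fibration\<close>

text \<open>A family of execution paths that is continuous in the topology of \<open>Ptop\<close> is jointly
  continuous. The parameter space has to be such that its cylinder is \<open>\<Delta>\<close>-generated, since \<open>Ptop\<close>
  only controls paths of parameters.\<close>

lemma continuous_map_Ptop_evaluation:
  assumes X: "path_data X" and A: "prod_topology A unit_interval \<in> Delta_generated_spaces"
    and g: "continuous_map A (Ptop X) g"
  shows "continuous_map (prod_topology A unit_interval) (und X) (\<lambda>z. snd (g (fst z)) (snd z))"
  unfolding continuous_map_Delta_generated_iff[OF A]
proof (intro allI impI)
  fix r assume r: "pathin (prod_topology A unit_interval) r"
  then have r1: "pathin A (fst \<circ> r)" and r2: "continuous_map unit_interval unit_interval (\<lambda>t. snd (r t))"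
    by (simp_all only: pathin_def continuous_map_pairwise o_def)
  have "pathin (Ptop X) (g \<circ> (fst \<circ> r))" by (rule pathin_compose[OF r1 g])
  then have j: "continuous_map (prod_topology unit_interval unit_interval) (und X)
      (\<lambda>(t, s). snd ((g \<circ> (fst \<circ> r)) t) s)"
    unfolding pathin_Ptop[OF X] by blast
  have "continuous_map unit_interval (prod_topology unit_interval unit_interval) (\<lambda>t. (t, snd (r t)))"
    unfolding continuous_map_paired using r2 by (simp add: continuous_map_id[unfolded id_def])
  from continuous_map_compose[OF this j]
  show "pathin (und X) ((\<lambda>z. snd (g (fst z)) (snd z)) \<circ> r)"
    by (simp add: pathin_def o_def)
qed

lemma continuous_map_regularize:
  assumes e: "continuous_map A euclideanreal e"
    and \<Omega>: "\<And>n. continuous_map (prod_topology A unit_interval) euclideanreal (\<lambda>z. \<Omega> (fst z) (snd z) n)"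
  shows "continuous_map (prod_topology A unit_interval) euclideanreal
     (\<lambda>z. regularize (e (fst z)) (\<Omega> (fst z)) (snd z) n)"
proof -
  have e': "continuous_map (prod_topology A unit_interval) euclideanreal (\<lambda>z. e (fst z))"
    using continuous_map_compose[OF continuous_map_fst e] by (simp only: o_def)
  have s: "continuous_map (prod_topology A unit_interval) euclideanreal (\<lambda>z. snd z)"
    using continuous_map_into_fulltopology[OF continuous_map_snd] .
  have c: "continuous_map (prod_topology A unit_interval) euclideanreal
      (\<lambda>z. case n of 0 \<Rightarrow> snd z * (1 - snd z) | Suc m \<Rightarrow> \<Omega> (fst z) (snd z) m)"
  proof (cases n)
    case 0
    have "continuous_map (prod_topology A unit_interval) euclideanreal (\<lambda>z. snd z * (1 - snd z))"
      by (intro continuous_map_real_mult continuous_map_diff s) simp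
    then show ?thesis using 0 by simp
  qed (use \<Omega> in simp)
  show ?thesis
    unfolding regularize_def by (intro continuous_map_add continuous_map_real_mult \<Omega> e' c)
qed

locale thickening = point_coding code for code :: "'u \<times> (nat \<Rightarrow> real) \<Rightarrow> 'u" +
  fixes Top :: "'u topology set" and X :: "'u mdspace"
  assumes Top: "Top = Delta_generated_spaces \<or> Top = Delta_Hausdorff_spaces"
    and X: "is_mdspace Top X"
begin

lemma path_data_X: "path_data X"
  by (rule is_mdspace_path_data[OF X])

lemma path_data_thicken: "path_data (thicken X)"
  by (rule is_mdspace_path_data[OF is_mdspace_thicken[OF Top X]])

definition projection :: "'u \<Rightarrow> 'u" where
  "projection = (\<lambda>x \<in> topspace (und (thicken X)). base x)"

definition over :: "('u \<times> 'u) \<times> (real \<Rightarrow> 'u) \<Rightarrow> (real \<Rightarrow> nat \<Rightarrow> real) \<Rightarrow> ('u \<times> 'u) \<times> (real \<Rightarrow> 'u)" where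
  "over p \<omega> = with_ends (lift (snd p) \<omega>)"

definition heights :: "('u \<times> 'u) \<times> (real \<Rightarrow> 'u) \<Rightarrow> real \<Rightarrow> nat \<Rightarrow> real" where
  "heights p = (\<lambda>s. height (snd p s))"

abbreviation shadow :: "('u \<times> 'u) \<times> (real \<Rightarrow> 'u) \<Rightarrow> ('u \<times> 'u) \<times> (real \<Rightarrow> 'u)" where
  "shadow \<equiv> Ptop_map projection"

lemma projection_lift:
  assumes "\<gamma> \<in> expaths X" shows "compose {0..1} projection (lift \<gamma> \<omega>) = \<gamma>"
proof
  fix s show "compose {0..1} projection (lift \<gamma> \<omega>) s = \<gamma> s"
  proof (cases "s \<in> {0..1}")
    case True
    then show ?thesis
      using expaths_app[OF path_data_X assms True]
      by (simp add: compose_def projection_def lift_def thicken_def topspace_thick_space)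
  next
    case False
    then show ?thesis using assms path_data_X by (auto simp: compose_def path_data_def cmaps_def extensional_def)
  qed
qed

lemma is_mdmap_projection: "is_mdmap (thicken X) X projection"
proof -
  have "und (thicken X) \<in> Delta_generated_spaces"
    by (simp add: thicken_def thick_space_def delta_kelley_in_Delta_generated)
  then have "continuous_map (und (thicken X)) (und X) (\<lambda>x. base x)"
    using continuous_map_thick_space[of "und (thicken X)" "und X" "\<lambda>x. x"]
    by (simp add: thicken_def continuous_map_id[unfolded id_def])
  then have "continuous_map (und (thicken X)) (und X) projection"
    by (rule continuous_map_eq) (simp add: projection_def)
  moreover have "projection ` states (thicken X) \<subseteq> states X"
    using X by (auto simp: projection_def thicken_def topspace_thick_space is_mdspace_def inj_eq[OF inj_code])
  moreover have "compose {0..1} projection \<gamma> \<in> expaths X" if "\<gamma> \<in> expaths (thicken X)" for \<gamma>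
    using that projection_lift regular_pair_expath[OF X] by (auto simp: thicken_def)
  ultimately show ?thesis by (simp add: is_mdmap_def cmaps_def projection_def)
qed

lemma shadow_over:
  assumes "p \<in> topspace (Ptop X)" shows "shadow (over p \<omega>) = p"
proof -
  obtain \<gamma> where \<gamma>: "\<gamma> \<in> expaths X" "p = with_ends \<gamma>" using assms by (auto simp: topspace_Ptop[OF path_data_X])
  have "shadow (over p \<omega>) = with_ends (compose {0..1} projection (lift \<gamma> \<omega>))"
    unfolding over_def Ptop_map_with_ends using \<gamma>(2) by simp
  then show ?thesis using projection_lift[OF \<gamma>(1)] \<gamma>(2) by simp
qed

lemma over_in_Ptop_thicken:
  assumes "regular_pair X (snd p) \<omega>" shows "over p \<omega> \<in> topspace (Ptop (thicken X))"
  unfolding over_def topspace_Ptop[OF path_data_thicken]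
  using assms by (intro imageI) (auto simp: thicken_def)

lemma over_cong:
  assumes "\<And>s. s \<in> {0..1} \<Longrightarrow> \<omega> s = \<omega>' s" shows "over p \<omega> = over p \<omega>'"
proof -
  have "lift (snd p) \<omega> = lift (snd p) \<omega>'" unfolding lift_def using assms by (intro restrict_ext) simp
  then show ?thesis by (simp add: over_def)
qed

lemma Ptop_thicken_cases:
  assumes "q \<in> topspace (Ptop (thicken X))"
  shows "shadow q \<in> topspace (Ptop X)" "regular_pair X (snd (shadow q)) (heights q)"
    "over (shadow q) (heights q) = q" "finitary_loop (heights q)"
proof -
  obtain \<gamma> \<omega> where r: "regular_pair X \<gamma> \<omega>" and q: "q = with_ends (lift \<gamma> \<omega>)"
    using assms unfolding topspace_Ptop[OF path_data_thicken] by (auto simp: thicken_def)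
  have \<gamma>: "\<gamma> \<in> expaths X" by (rule regular_pair_expath[OF X r])
  have s: "shadow q = with_ends \<gamma>"
    unfolding q Ptop_map_with_ends by (simp only: projection_lift[OF \<gamma>])
  then show "shadow q \<in> topspace (Ptop X)" using \<gamma> by (simp add: topspace_Ptop[OF path_data_X])
  have h: "heights q s = \<omega> s" if "s \<in> {0..1}" for s using that by (simp add: heights_def q lift_def)
  show "regular_pair X (snd (shadow q)) (heights q)"
    unfolding s snd_conv by (rule regular_pair_cong[OF r h])
  then show "finitary_loop (heights q)" by (rule regular_pair_loop)
  have "over (shadow q) (heights q) = over (shadow q) \<omega>" by (rule over_cong[OF h])
  also have "\<dots> = q" unfolding over_def s snd_conv by (rule q[symmetric])
  finally show "over (shadow q) (heights q) = q" .
qed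

lemma continuous_map_heights:
  assumes A: "prod_topology A unit_interval \<in> Delta_generated_spaces"
    and g: "continuous_map A (Ptop (thicken X)) g"
  shows "continuous_map (prod_topology A unit_interval) euclideanreal (\<lambda>z. heights (g (fst z)) (snd z) n)"
  using continuous_map_Ptop_evaluation[OF path_data_thicken A g]
  unfolding heights_def thicken_def mdspace.select_convs continuous_map_thick_space[OF A] by blast

lemma continuous_map_over:
  assumes A: "A \<in> Delta_generated_spaces" and h: "continuous_map A (Ptop X) h"
    and \<Omega>: "\<And>n. continuous_map (prod_topology A unit_interval) euclideanreal (\<lambda>z. \<Omega> (fst z) (snd z) n)"
    and r: "\<And>a. a \<in> topspace A \<Longrightarrow> regular_pair X (snd (h a)) (\<Omega> a)"
  shows "continuous_map A (Ptop (thicken X)) (\<lambda>a. over (h a) (\<Omega> a))"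
  unfolding continuous_map_Delta_generated_iff[OF A]
proof (intro allI impI)
  fix c assume c: "pathin A c"
  let ?I2 = "prod_topology unit_interval unit_interval"
  have I2: "?I2 \<in> Delta_generated_spaces"
    by (intro path_sequential_imp_Delta_generated path_sequential_prod_topology path_sequential_unit_interval)
  have hc: "pathin (Ptop X) (h \<circ> c)" by (rule pathin_compose[OF c h])
  have ct: "c t \<in> topspace A" if "t \<in> {0..1}" for t
    using c that by (auto simp: pathin_def dest: continuous_map_app)
  have rc: "regular_pair X (snd (h (c t))) (\<Omega> (c t))" if "t \<in> {0..1}" for t using r ct that by blast
  have cc: "continuous_map ?I2 (prod_topology A unit_interval) (\<lambda>z. (c (fst z), snd z))"
  proof -
    have "continuous_map ?I2 A (\<lambda>z. c (fst z))"
      using continuous_map_compose[OF continuous_map_fst c[unfolded pathin_def]] by (simp only: o_def)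
    then show ?thesis unfolding continuous_map_paired by (rule conjI[OF _ continuous_map_snd])
  qed
  have hpt: "h (c t) = with_ends (snd (h (c t)))" if "t \<in> {0..1}" for t
  proof -
    have "h (c t) \<in> topspace (Ptop X)" using h ct[OF that] by (rule continuous_map_app)
    then show ?thesis by (auto simp: topspace_Ptop[OF path_data_X])
  qed
  have ends: "fst (over (h (c t)) (\<Omega> (c t))) = (code (fst (fst (h (c t))), \<lambda>_. 0), code (snd (fst (h (c t))), \<lambda>_. 0))"
    if t: "t \<in> {0..1}" for t
  proof -
    have "\<Omega> (c t) 0 = (\<lambda>_. 0)" "\<Omega> (c t) 1 = (\<lambda>_. 0)"
      using regular_pair_loop[OF rc[OF t]] by (auto simp: finitary_loop_def)
    moreover have "fst (fst (h (c t))) = snd (h (c t)) 0" "snd (fst (h (c t))) = snd (h (c t)) 1"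
      using hpt[OF t] by (metis fst_conv snd_conv)+
    ultimately show ?thesis by (simp add: over_def lift_def)
  qed
  show "pathin (Ptop (thicken X)) ((\<lambda>a. over (h a) (\<Omega> a)) \<circ> c)"
    unfolding pathin_Ptop[OF path_data_thicken]
  proof (intro conjI ballI)
    fix t :: real assume t: "t \<in> {0..1}"
    show "((\<lambda>a. over (h a) (\<Omega> a)) \<circ> c) t \<in> with_ends ` expaths (thicken X)"
      using over_in_Ptop_thicken[OF rc[OF t]] by (simp add: topspace_Ptop[OF path_data_thicken])
    have "fst (h (c t)) = fst (h (c 0))"
      using hc t unfolding pathin_Ptop[OF path_data_X] o_def by blast
    then show "fst (((\<lambda>a. over (h a) (\<Omega> a)) \<circ> c) t) = fst (((\<lambda>a. over (h a) (\<Omega> a)) \<circ> c) 0)"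
      unfolding o_def using ends[OF t] ends[of 0] by simp
  next
    have hj: "continuous_map ?I2 (und X) (\<lambda>z. snd (h (c (fst z))) (snd z))"
      using hc unfolding pathin_Ptop[OF path_data_X] by (simp only: o_def case_prod_unfold)
    have \<Omega>j: "continuous_map ?I2 euclideanreal (\<lambda>z. \<Omega> (c (fst z)) (snd z) n)" for n
      using continuous_map_compose[OF cc \<Omega>[of n]] by (simp only: o_def fst_conv snd_conv)
    have "continuous_map ?I2 (thick_space (und X))
        (\<lambda>z. code (snd (h (c (fst z))) (snd z), \<Omega> (c (fst z)) (snd z)))"
      unfolding continuous_map_thick_space[OF I2] base_code height_code
      using hj \<Omega>j continuous_map_app[OF hj] by blast
    then have "continuous_map ?I2 (thick_space (und X)) (\<lambda>z. snd (over (h (c (fst z))) (\<Omega> (c (fst z)))) (snd z))"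
      by (rule continuous_map_eq) (auto simp: over_def lift_def)
    then show "continuous_map ?I2 (und (thicken X)) (\<lambda>(t, s). snd (((\<lambda>a. over (h a) (\<Omega> a)) \<circ> c) t) s)"
      by (simp only: thicken_def mdspace.select_convs o_def case_prod_unfold)
  qed
qed

text \<open>The lifting principle behind everything below: over a family \<open>h\<close> of execution paths of
  \<open>X\<close>, any family of finitary loops may be used, once it is regularized with a speed \<open>e\<close> that
  vanishes only where nothing needs to be changed.\<close>

lemma regularized_lift:
  assumes A: "A \<in> Delta_generated_spaces"
    and h: "continuous_map A (Ptop X) h" and e: "continuous_map A euclideanreal e"
    and \<Omega>: "\<And>n. continuous_map (prod_topology A unit_interval) euclideanreal (\<lambda>z. \<Omega> (fst z) (snd z) n)"
    and e0: "\<And>a. a \<in> topspace A \<Longrightarrow> e a \<ge> 0"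
    and loop: "\<And>a. a \<in> topspace A \<Longrightarrow> finitary_loop (\<Omega> a)"
    and r: "\<And>a. a \<in> topspace A \<Longrightarrow> e a = 0 \<Longrightarrow> regular_pair X (snd (h a)) (\<Omega> a)"
  shows "continuous_map A (Ptop (thicken X)) (\<lambda>a. over (h a) (regularize (e a) (\<Omega> a)))"
proof -
  have "regular_pair X (snd (h a)) (regularize (e a) (\<Omega> a))" if a: "a \<in> topspace A" for a
  proof (cases "e a = 0")
    case True then show ?thesis using r[OF a] by simp
  next
    case False
    then have "e a > 0" using e0[OF a] by simp
    moreover have "snd (h a) \<in> expaths X"
      using continuous_map_app[OF h a] by (auto simp: topspace_Ptop[OF path_data_X])
    ultimately show ?thesis
      using path_data_X loop[OF a]
      by (intro regular_pairI finitary_loop_regularize nowhere_constant_regularize)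
  qed
  then show ?thesis
    by (intro continuous_map_over[OF A h] continuous_map_regularize[OF e \<Omega>])
qed

lemma continuous_map_shadow: "continuous_map (Ptop (thicken X)) (Ptop X) shadow"
  by (rule continuous_map_Ptop_map[OF path_data_thicken path_data_X is_mdmap_projection])

text \<open>A homotopy is lifted by regularizing the loops at time \<open>0\<close> with speed equal to the time.\<close>

lemma serre_fibration_shadow: "serre_fibration (Ptop (thicken X)) (Ptop X) shadow"
  unfolding serre_fibration_def
proof (intro conjI allI impI, rule continuous_map_shadow, elim conjE)
  fix n g h
  let ?A = "prod_topology (cube n) unit_interval"
  assume g: "continuous_map (cube n) (Ptop (thicken X)) g" and h: "continuous_map ?A (Ptop X) h"
    and h0: "\<forall>z\<in>topspace (cube n). h (z, 0) = shadow (g z)"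
  have ps: "path_sequential ?A" by (intro path_sequential_prod_topology path_sequential_cube path_sequential_unit_interval)
  have A: "?A \<in> Delta_generated_spaces" by (rule path_sequential_imp_Delta_generated[OF ps])
  have AI: "prod_topology ?A unit_interval \<in> Delta_generated_spaces"
    by (intro path_sequential_imp_Delta_generated path_sequential_prod_topology[OF ps] path_sequential_unit_interval)
  have gf: "continuous_map ?A (Ptop (thicken X)) (\<lambda>a. g (fst a))"
    using continuous_map_compose[OF continuous_map_fst g] by (simp only: o_def)
  have gt: "g z \<in> topspace (Ptop (thicken X))" if "z \<in> topspace (cube n)" for z
    using g that by (rule continuous_map_app)
  let ?k = "\<lambda>a. over (h a) (regularize (snd a) (heights (g (fst a))))"
  have k: "continuous_map ?A (Ptop (thicken X)) ?k"
  proof (rule regularized_lift[OF A h])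
    show "continuous_map ?A euclideanreal snd"
      by (rule continuous_map_into_fulltopology[OF continuous_map_snd])
  next
    fix a assume a: "a \<in> topspace ?A" and "snd a = 0"
    then have "fst a \<in> topspace (cube n)" "a = (fst a, 0)" by (auto simp: prod_eq_iff)
    then have "h a = shadow (g (fst a))" using h0 by metis
    then show "regular_pair X (snd (h a)) (heights (g (fst a)))"
      using Ptop_thicken_cases(2)[OF gt[OF \<open>fst a \<in> topspace (cube n)\<close>]] by simp
  next
    fix a assume "a \<in> topspace ?A"
    then have "fst a \<in> topspace (cube n)" and "snd a \<in> {0..1}" by auto
    then show "finitary_loop (heights (g (fst a)))" and "0 \<le> snd a"
      using Ptop_thicken_cases(4)[OF gt] by simp_all
  qed (rule continuous_map_heights[OF AI gf])
  show "\<exists>k. continuous_map ?A (Ptop (thicken X)) k \<and> (\<forall>z\<in>topspace (cube n). k (z, 0) = g z) \<and>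
      (\<forall>z\<in>topspace (cube n). \<forall>t\<in>{0..1}. shadow (k (z, t)) = h (z, t))"
  proof (intro exI conjI ballI)
    show "continuous_map ?A (Ptop (thicken X)) ?k" by (rule k)
  next
    fix z assume z: "z \<in> topspace (cube n)"
    then show "?k (z, 0) = g z" using h0 Ptop_thicken_cases(3)[OF gt[OF z]] by simp
    fix t :: real assume "t \<in> {0..1}"
    then have "(z, t) \<in> topspace ?A" using z by simp
    then show "shadow (?k (z, t)) = h (z, t)" by (rule shadow_over[OF continuous_map_app[OF h]])
  qed
qed

text \<open>A function on the cube that vanishes exactly on the boundary.\<close>

definition wall :: "nat \<Rightarrow> (nat \<Rightarrow> real) \<Rightarrow> real" where
  "wall n z = (\<Prod>i<n. z i * (1 - z i))"

lemma continuous_map_wall: "continuous_map (cube n) euclideanreal (wall n)"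
proof -
  have "continuous_map (cube n) euclideanreal (\<lambda>z. z i)" if "i < n" for i
  proof -
    have "continuous_map (cube n) unit_interval (\<lambda>z. z i)"
      unfolding cube_def using continuous_map_product_projection[of i "{..<n}" "\<lambda>_. unit_interval"] that
      by simp
    then show ?thesis by (rule continuous_map_into_fulltopology)
  qed
  then show ?thesis
    unfolding wall_def
    by (intro continuous_map_prod continuous_map_real_mult continuous_map_diff) simp_all
qed

lemma cube_coordinate: "z \<in> topspace (cube n) \<Longrightarrow> i < n \<Longrightarrow> z i \<in> {0..1}"
  unfolding cube_def topspace_product_topology by (drule PiE_mem[of _ _ _ i]) simp_all

lemma wall_nonneg:
  assumes z: "z \<in> topspace (cube n)" shows "wall n z \<ge> 0"
  unfolding wall_def
proof (intro prod_nonneg ballI)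
  fix i assume "i \<in> {..<n}"
  then have "z i \<in> {0..1}" using cube_coordinate[OF z] by blast
  then show "0 \<le> z i * (1 - z i)" by simp
qed

lemma wall_eq_0_iff:
  assumes "z \<in> topspace (cube n)" shows "wall n z = 0 \<longleftrightarrow> z \<in> cube_boundary n"
proof -
  have "wall n z = 0 \<longleftrightarrow> (\<exists>i \<in> {..<n}. z i * (1 - z i) = 0)"
    unfolding wall_def by (rule prod_zero_iff) simp
  moreover have "x * (1 - x) = 0 \<longleftrightarrow> x = 0 \<or> x = 1" for x :: real by simp
  ultimately have "wall n z = 0 \<longleftrightarrow> (\<exists>i<n. z i = 0 \<or> z i = 1)" by (simp only: Bex_def lessThan_iff)
  then show ?thesis using assms unfolding cube_boundary_def by blast
qed

text \<open>Two execution paths of the thickening, or families of such, whose shadows are joined by a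
  homotopy \<open>K\<close>, are joined by the straight line between their loops, regularized over \<open>K\<close> with a
  speed that vanishes at both ends (and wherever \<open>e\<close> does).\<close>

lemma shadow_homotopy_lift:
  assumes B: "path_sequential B"
    and g: "continuous_map B (Ptop (thicken X)) g" and g': "continuous_map B (Ptop (thicken X)) g'"
    and K: "continuous_map (prod_topology unit_interval B) (Ptop X) K"
    and K0: "\<And>b. b \<in> topspace B \<Longrightarrow> K (0, b) = shadow (g b)"
    and K1: "\<And>b. b \<in> topspace B \<Longrightarrow> K (1, b) = shadow (g' b)"
    and e: "continuous_map B euclideanreal e" and e0: "\<And>b. b \<in> topspace B \<Longrightarrow> e b \<ge> 0"
    and stat: "\<And>b t. b \<in> topspace B \<Longrightarrow> e b = 0 \<Longrightarrow> t \<in> {0..1} \<Longrightarrow> g b = g' b \<and> K (t, b) = shadow (g b)"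
  shows "\<exists>L. continuous_map (prod_topology unit_interval B) (Ptop (thicken X)) L \<and>
    (\<forall>b \<in> topspace B. L (0, b) = g b \<and> L (1, b) = g' b \<and> (e b = 0 \<longrightarrow> (\<forall>t \<in> {0..1}. L (t, b) = g b)))"
proof -
  let ?A = "prod_topology unit_interval B"
  have ps: "path_sequential ?A" by (intro path_sequential_prod_topology B path_sequential_unit_interval)
  have A: "?A \<in> Delta_generated_spaces" by (rule path_sequential_imp_Delta_generated[OF ps])
  have AI: "prod_topology ?A unit_interval \<in> Delta_generated_spaces"
    by (intro path_sequential_imp_Delta_generated path_sequential_prod_topology[OF ps] path_sequential_unit_interval)
  have gs: "continuous_map ?A (Ptop (thicken X)) (\<lambda>a. g (snd a))" "continuous_map ?A (Ptop (thicken X)) (\<lambda>a. g' (snd a))"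
    using continuous_map_compose[OF continuous_map_snd g] continuous_map_compose[OF continuous_map_snd g']
    by (simp_all only: o_def)
  have gt: "g b \<in> topspace (Ptop (thicken X))" "g' b \<in> topspace (Ptop (thicken X))" if "b \<in> topspace B" for b
    using g g' that by (auto intro: continuous_map_app)
  \<comment> \<open>Only finitary loops are needed here, so convex combinations are harmless.\<close>
  define \<Omega> where "\<Omega> a s m = (1 - fst a) * heights (g (snd a)) s m + fst a * heights (g' (snd a)) s m" for a s m
  define v where "v a = fst a * (1 - fst a) * e (snd a)" for a :: "real \<times> _"
  define L where "L a = over (K a) (regularize (v a) (\<Omega> a))" for a
  have f: "continuous_map ?A euclideanreal fst"
    by (rule continuous_map_into_fulltopology[OF continuous_map_fst])
  have es: "continuous_map ?A euclideanreal (\<lambda>a. e (snd a))"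
    using continuous_map_compose[OF continuous_map_snd e] by (simp only: o_def)
  have \<Omega>0: "\<Omega> (0, b) = heights (g b)" and \<Omega>1: "\<Omega> (1, b) = heights (g' b)" for b
    by (simp_all add: \<Omega>_def fun_eq_iff)
  have \<Omega>e: "\<Omega> (t, b) = heights (g b)" if "g b = g' b" for t b
    using that by (simp add: \<Omega>_def fun_eq_iff algebra_simps)
  have zero: "K (t, b) = shadow (g b) \<and> \<Omega> (t, b) = heights (g b) \<or> K (t, b) = shadow (g' b) \<and> \<Omega> (t, b) = heights (g' b)"
    if "b \<in> topspace B" "t \<in> {0..1}" "v (t, b) = 0" for t b
  proof -
    have "t = 0 \<or> t = 1 \<or> e b = 0" using that(3) by (simp add: v_def)
    then show ?thesis using K0 K1 \<Omega>0 \<Omega>1 \<Omega>e stat that by metis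
  qed
  have contL: "continuous_map ?A (Ptop (thicken X)) L"
    unfolding L_def
  proof (rule regularized_lift[OF A K])
    show "continuous_map ?A euclideanreal v"
      unfolding v_def by (intro continuous_map_real_mult continuous_map_diff f es) simp
    have ff: "continuous_map (prod_topology ?A unit_interval) euclideanreal (\<lambda>z. fst (fst z))"
      using continuous_map_compose[OF continuous_map_fst f] by (simp only: o_def)
    show "continuous_map (prod_topology ?A unit_interval) euclideanreal (\<lambda>z. \<Omega> (fst z) (snd z) n)" for n
      unfolding \<Omega>_def
      by (intro continuous_map_add continuous_map_real_mult continuous_map_diff ff
          continuous_map_heights[OF AI gs(1)] continuous_map_heights[OF AI gs(2)]) simp
  next
    fix a assume "a \<in> topspace ?A"
    then obtain t b where a: "a = (t, b)" "t \<in> {0..1}" "b \<in> topspace B" by auto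
    show "v a \<ge> 0" using a e0 by (simp add: v_def)
    have l: "finitary_loop (heights (g b))" "finitary_loop (heights (g' b))"
      using Ptop_thicken_cases(4) gt[OF a(3)] by auto
    show "finitary_loop (\<Omega> a)"
      unfolding finitary_loop_def
    proof (intro conjI allI)
      show "continuous_on {0..1} (\<lambda>s. \<Omega> a s n)" for n
        unfolding \<Omega>_def a fst_conv snd_conv using l by (auto simp: finitary_loop_def intro!: continuous_intros)
      show "\<Omega> a 0 n = 0" "\<Omega> a 1 n = 0" for n using l by (simp_all add: finitary_loop_def \<Omega>_def a)
      obtain N1 N2 where "\<And>n s. n \<ge> N1 \<Longrightarrow> s \<in> {0..1} \<Longrightarrow> heights (g b) s n = 0"
        "\<And>n s. n \<ge> N2 \<Longrightarrow> s \<in> {0..1} \<Longrightarrow> heights (g' b) s n = 0"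
        using l unfolding finitary_loop_def by blast
      then show "\<exists>N. \<forall>n\<ge>N. \<forall>s\<in>{0..1}. \<Omega> a s n = 0"
        by (intro exI[of _ "max N1 N2"]) (simp add: \<Omega>_def a)
    qed
    assume "v a = 0"
    then show "regular_pair X (snd (K a)) (\<Omega> a)"
      using zero[OF a(3,2)] Ptop_thicken_cases(2) gt[OF a(3)] unfolding a(1) by metis
  qed
  have v0: "v (0, b) = 0" "v (1, b) = 0" for b by (simp_all add: v_def)
  show ?thesis
  proof (intro exI conjI ballI impI, rule contL)
    fix b assume b: "b \<in> topspace B"
    show "L (0, b) = g b" "L (1, b) = g' b"
      using K0[OF b] K1[OF b] Ptop_thicken_cases(3) gt[OF b] by (simp_all add: L_def v0 \<Omega>0 \<Omega>1)
    fix t :: real assume t: "e b = 0" "t \<in> {0..1}"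
    have "v (t, b) = 0" using t(1) by (simp add: v_def)
    moreover have "g b = g' b" "K (t, b) = shadow (g b)" using stat[OF b t] by auto
    ultimately show "L (t, b) = g b"
      using Ptop_thicken_cases(3)[OF gt(1)[OF b]] by (simp only: L_def \<Omega>e regularize_0)
  qed
qed

text \<open>For surjectivity on homotopy groups, a loop of execution paths of \<open>X\<close> at the shadow of \<open>x\<close> is
  accompanied by the height of \<open>x\<close>, regularized off the boundary of the cube so that the lift
  is based at \<open>x\<close> itself. Injectivity is the lifting of homotopies.\<close>

lemma weak_homotopy_equivalence_shadow:
  "weak_homotopy_equivalence (Ptop (thicken X)) (Ptop X) shadow"
  unfolding weak_homotopy_equivalence_iff
proof (intro conjI allI impI ballI)
  show "continuous_map (Ptop (thicken X)) (Ptop X) shadow" by (rule continuous_map_shadow)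
next
  fix p assume p: "p \<in> topspace (Ptop X)"
  have z: "finitary_loop (\<lambda>_ _. 0)" by (simp add: finitary_loop_def)
  have "snd p \<in> expaths X" using p by (auto simp: topspace_Ptop[OF path_data_X])
  then have "regular_pair X (snd p) (regularize 1 (\<lambda>_ _. 0))"
    using path_data_X z by (intro regular_pairI finitary_loop_regularize nowhere_constant_regularize) simp_all
  then show "\<exists>q \<in> topspace (Ptop (thicken X)). path_component_of (Ptop X) (shadow q) p"
    using over_in_Ptop_thicken shadow_over[OF p] p path_component_of_refl by metis
next
  fix q q' assume q: "q \<in> topspace (Ptop (thicken X))" "q' \<in> topspace (Ptop (thicken X))"
    and "path_component_of (Ptop X) (shadow q) (shadow q')"
  then obtain c where c: "pathin (Ptop X) c" "c 0 = shadow q" "c 1 = shadow q'"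
    by (auto simp: path_component_of_def)
  \<comment> \<open>The one-point space \<open>cube 0\<close> serves as parameter space.\<close>
  have "continuous_map (prod_topology unit_interval (cube 0)) (Ptop X) (\<lambda>a. c (fst a))"
    using continuous_map_compose[OF continuous_map_fst c(1)[unfolded pathin_def]] by (simp only: o_def)
  then have "\<exists>L. continuous_map (prod_topology unit_interval (cube 0)) (Ptop (thicken X)) L \<and>
    (\<forall>b \<in> topspace (cube 0). L (0, b) = q \<and> L (1, b) = q' \<and> ((1::real) = 0 \<longrightarrow> (\<forall>t \<in> {0..1}. L (t, b) = q)))"
    by (rule shadow_homotopy_lift[OF path_sequential_cube, rotated 2]) (simp_all add: q c)
  then obtain L where L: "continuous_map (prod_topology unit_interval (cube 0)) (Ptop (thicken X)) L"
    "\<And>b. b \<in> topspace (cube 0) \<Longrightarrow> L (0, b) = q" "\<And>b. b \<in> topspace (cube 0) \<Longrightarrow> L (1, b) = q'"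
    by blast
  obtain b where b: "b \<in> topspace (cube 0)" by (auto simp: cube_def)
  have "continuous_map unit_interval (prod_topology unit_interval (cube 0)) (\<lambda>t. (t, b))"
    unfolding continuous_map_paired using b by (simp add: continuous_map_id[unfolded id_def])
  from continuous_map_compose[OF this L(1)]
  have "pathin (Ptop (thicken X)) (\<lambda>t. L (t, b))" by (simp add: pathin_def o_def)
  then show "path_component_of (Ptop (thicken X)) q q'"
    unfolding path_component_of_def using L(2,3)[OF b] by blast
next
  fix n x g assume x: "x \<in> topspace (Ptop (thicken X))" and g: "g \<in> loop_maps n (Ptop X) (shadow x)"
  have gc: "continuous_map (cube n) (Ptop X) g" using g by (simp add: loop_maps_def)
  have A: "cube n \<in> Delta_generated_spaces"
    by (rule path_sequential_imp_Delta_generated[OF path_sequential_cube])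
  have AI: "prod_topology (cube n) unit_interval \<in> Delta_generated_spaces"
    by (intro path_sequential_imp_Delta_generated path_sequential_prod_topology path_sequential_cube path_sequential_unit_interval)
  have cx: "continuous_map (cube n) (Ptop (thicken X)) (\<lambda>_. x)" using x by simp
  have gb: "g z = shadow x" if "z \<in> topspace (cube n)" "wall n z = 0" for z
    using g that wall_eq_0_iff[OF that(1)] by (auto simp: loop_maps_def)
  let ?k = "\<lambda>z. over (g z) (regularize (wall n z) (heights x))"
  have k: "continuous_map (cube n) (Ptop (thicken X)) ?k"
    by (rule regularized_lift[OF A gc continuous_map_wall])
       (use continuous_map_heights[OF AI cx] wall_nonneg Ptop_thicken_cases(2,4)[OF x] gb in auto)
  have "?k z = x" if "z \<in> cube_boundary n" for z
  proof -
    have z: "z \<in> topspace (cube n)" using that cube_boundary_subset by blast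
    then have "wall n z = 0" using that wall_eq_0_iff by blast
    then show ?thesis using gb[OF z] Ptop_thicken_cases(3)[OF x] by simp
  qed
  then have kl: "?k \<in> loop_maps n (Ptop (thicken X)) x" using k by (auto simp: loop_maps_def)
  have "g z = (shadow \<circ> ?k) z" if "z \<in> topspace (cube n)" for z
    using shadow_over[OF continuous_map_app[OF gc that]] by simp
  then have "(g, shadow \<circ> ?k) \<in> loop_homotopy n (Ptop X) (shadow x)"
    by (rule loop_homotopy_cong(2)[OF g])
  then have "(shadow \<circ> ?k, g) \<in> loop_homotopy n (Ptop X) (shadow x)"
    using equiv_loop_homotopy by (meson equivE symD)
  then show "\<exists>k \<in> loop_maps n (Ptop (thicken X)) x. (shadow \<circ> k, g) \<in> loop_homotopy n (Ptop X) (shadow x)"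
    using kl by blast
next
  fix n x g g' assume x: "x \<in> topspace (Ptop (thicken X))"
    and g: "g \<in> loop_maps n (Ptop (thicken X)) x" and g': "g' \<in> loop_maps n (Ptop (thicken X)) x"
    and hom: "(shadow \<circ> g, shadow \<circ> g') \<in> loop_homotopy n (Ptop X) (shadow x)"
  have gc: "continuous_map (cube n) (Ptop (thicken X)) g" "continuous_map (cube n) (Ptop (thicken X)) g'"
    using g g' by (simp_all add: loop_maps_def)
  obtain K where K: "continuous_map (prod_topology unit_interval (cube n)) (Ptop X) K"
    and K0: "\<And>z. K (0, z) = shadow (g z)" and K1: "\<And>z. K (1, z) = shadow (g' z)"
    and Kb: "\<And>t z. t \<in> {0..1} \<Longrightarrow> z \<in> cube_boundary n \<Longrightarrow> K (t, z) = shadow x"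
    using hom unfolding loop_homotopy_def homotopic_with_def by (auto simp: image_subset_iff)
  have gb: "g z = x \<and> g' z = x" if "z \<in> cube_boundary n" for z
    using g g' that by (auto simp: loop_maps_def)
  have stat: "g z = g' z \<and> K (t, z) = shadow (g z)"
    if "z \<in> topspace (cube n)" "wall n z = 0" "t \<in> {0..1}" for z t
  proof -
    have "z \<in> cube_boundary n" using that wall_eq_0_iff by blast
    then show ?thesis using gb Kb[OF that(3)] by simp
  qed
  have "\<exists>L. continuous_map (prod_topology unit_interval (cube n)) (Ptop (thicken X)) L \<and>
    (\<forall>z \<in> topspace (cube n). L (0, z) = g z \<and> L (1, z) = g' z \<and> (wall n z = 0 \<longrightarrow> (\<forall>t \<in> {0..1}. L (t, z) = g z)))"
    by (rule shadow_homotopy_lift[OF path_sequential_cube gc K K0 K1 continuous_map_wall])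
       (fact wall_nonneg stat)+
  then obtain L where L: "continuous_map (prod_topology unit_interval (cube n)) (Ptop (thicken X)) L"
    "\<And>z. z \<in> topspace (cube n) \<Longrightarrow> L (0, z) = g z" "\<And>z. z \<in> topspace (cube n) \<Longrightarrow> L (1, z) = g' z"
    "\<And>z t. z \<in> topspace (cube n) \<Longrightarrow> wall n z = 0 \<Longrightarrow> t \<in> {0..1} \<Longrightarrow> L (t, z) = g z"
    by blast
  have Lb: "L (t, z) = x" if "t \<in> {0..1}" "z \<in> cube_boundary n" for t z
  proof -
    have z: "z \<in> topspace (cube n)" using that cube_boundary_subset by blast
    then show ?thesis using L(4)[OF z _ that(1)] wall_eq_0_iff[OF z] gb that(2) by simp
  qed
  have "homotopic_with (\<lambda>k. k ` cube_boundary n \<subseteq> {x}) (cube n) (Ptop (thicken X)) g g'"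
  proof (subst homotopic_with)
    fix h k :: "(nat \<Rightarrow> real) \<Rightarrow> ('u \<times> 'u) \<times> (real \<Rightarrow> 'u)"
    assume "\<And>z. z \<in> topspace (cube n) \<Longrightarrow> h z = k z"
    then have "h ` cube_boundary n = k ` cube_boundary n"
      using cube_boundary_subset by (intro image_cong) auto
    then show "(h ` cube_boundary n \<subseteq> {x}) = (k ` cube_boundary n \<subseteq> {x})" by simp
  next
    show "\<exists>h. continuous_map (prod_topology unit_interval (cube n)) (Ptop (thicken X)) h \<and>
        (\<forall>z\<in>topspace (cube n). h (0, z) = g z) \<and> (\<forall>z\<in>topspace (cube n). h (1, z) = g' z) \<and>
        (\<forall>t\<in>{0..1}. (\<lambda>z. h (t, z)) ` cube_boundary n \<subseteq> {x})"
      using L(1-3) Lb by (intro exI[of _ L]) (simp add: image_subset_iff)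
  qed
  then show "(g, g') \<in> loop_homotopy n (Ptop (thicken X)) x"
    using g g' by (simp add: loop_homotopy_def)
qed

lemma bij_betw_projection_states: "bij_betw projection (states (thicken X)) (states X)"
proof (rule bij_betw_byWitness[where f' = "\<lambda>\<alpha>. code (\<alpha>, \<lambda>_. 0)"])
  have "\<alpha> \<in> topspace (und X)" if "\<alpha> \<in> states X" for \<alpha> using X that by (auto simp: is_mdspace_def)
  then show "\<forall>a\<in>states (thicken X). code (projection a, \<lambda>_. 0) = a"
    "\<forall>\<alpha>\<in>states X. projection (code (\<alpha>, \<lambda>_. 0)) = \<alpha>"
    by (auto simp: projection_def thicken_def topspace_thick_space)
  show "projection ` states (thicken X) \<subseteq> states X"
    using is_mdmap_projection by (simp add: is_mdmap_def)
qed (auto simp: thicken_def)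

end

section \<open>Cofibrant objects\<close>

text \<open>A sequence of reals, seen as a sequence of sets of naturals, is a set of pairs of naturals.\<close>

lemma sequences_lepoll_reals: "(UNIV :: (nat \<Rightarrow> real) set) \<lesssim> (UNIV :: real set)"
proof -
  obtain a :: "real \<Rightarrow> nat set" where a: "inj a"
    using nat_sets_eqpoll_reals eqpoll_sym eqpoll_imp_lepoll unfolding lepoll_def by blast
  have "(UNIV :: (nat \<Rightarrow> real) set) \<lesssim> (UNIV :: nat set set)"
    unfolding lepoll_def
  proof (intro exI[of _ "\<lambda>w. prod_encode ` (SIGMA n:UNIV. a (w n))"] conjI injI)
    fix w w' :: "nat \<Rightarrow> real"
    assume "prod_encode ` (SIGMA n:UNIV. a (w n)) = prod_encode ` (SIGMA n:UNIV. a (w' n))"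
    then have "(SIGMA n:UNIV. a (w n)) = (SIGMA n:UNIV. a (w' n))"
      using inj_prod_encode by (metis inj_image_eq_iff)
    then have "a (w n) = a (w' n)" for n by (auto simp: set_eq_iff)
    then show "w = w'" using a by (auto simp: inj_def fun_eq_iff)
  qed auto
  then show ?thesis using nat_sets_eqpoll_reals lepoll_trans2 by blast
qed

lemma point_coding_exists:
  assumes "(UNIV :: real set) \<lesssim> (UNIV :: 'u set)"
  obtains code :: "'u \<times> (nat \<Rightarrow> real) \<Rightarrow> 'u" where "inj code"
proof -
  obtain b :: "(nat \<Rightarrow> real) \<Rightarrow> 'u" where b: "inj b"
    using lepoll_trans[OF sequences_lepoll_reals assms] unfolding lepoll_def by blast
  have "infinite (UNIV :: 'u set)"
    using assms infinite_UNIV_char_0[where 'a = real] infinite_le_lepoll lepoll_trans by metis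
  then have "(UNIV :: 'u set) \<times> (UNIV :: 'u set) \<approx> (UNIV :: 'u set)"
    unfolding eqpoll_iff_card_of_ordIso by (rule card_of_Times_same_infinite)
  then obtain d :: "'u \<times> 'u \<Rightarrow> 'u" where d: "inj d"
    unfolding eqpoll_def bij_betw_def UNIV_Times_UNIV by blast
  have "inj (\<lambda>z. d (fst z, b (snd z)))"
  proof (rule injI)
    fix z z' assume "d (fst z, b (snd z)) = d (fst z', b (snd z'))"
    then have "(fst z, b (snd z)) = (fst z', b (snd z'))" by (rule injD[OF d])
    then show "z = z'" using injD[OF b] by (simp add: prod_eq_iff)
  qed
  then show ?thesis by (rule that)
qed

lemma saturated_retract:
  assumes X: "is_mdspace Top X" and s: "is_mdmap X Z s" and r: "is_mdmap Z X r" and Z: "saturated Z"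
    and rs: "\<And>x. x \<in> topspace (und X) \<Longrightarrow> r (s x) = x"
  shows "saturated X"
  unfolding saturated_def
proof (intro ballI impI)
  fix \<gamma> assume \<gamma>: "\<gamma> \<in> cmaps unit_interval (und X)" and "\<exists>\<phi>\<in>M11. compose {0..1} \<gamma> \<phi> \<in> expaths X"
  then obtain \<phi> where \<phi>: "\<phi> \<in> M11" "compose {0..1} \<gamma> \<phi> \<in> expaths X" by blast
  have \<gamma>t: "\<gamma> t \<in> topspace (und X)" if "t \<in> {0..1}" for t
    using \<gamma> that continuous_map_app[of unit_interval _ \<gamma> t] by (simp add: cmaps_def)
  have "continuous_map unit_interval (und Z) (s \<circ> \<gamma>)"
    using \<gamma> is_mdmapD(1)[OF s] by (auto simp: cmaps_def intro: continuous_map_compose)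
  then have "continuous_map unit_interval (und Z) (compose {0..1} s \<gamma>)"
    by (rule continuous_map_eq) (simp add: compose_def)
  then have "compose {0..1} s \<gamma> \<in> cmaps unit_interval (und Z)" by (simp add: cmaps_def)
  moreover have "compose {0..1} (compose {0..1} s \<gamma>) \<phi> \<in> expaths Z"
    using is_mdmapD(4)[OF s \<phi>(2)] by (simp add: compose_assoc_paths[OF \<phi>(1)])
  ultimately have "compose {0..1} s \<gamma> \<in> expaths Z" using Z \<phi>(1) unfolding saturated_def by blast
  then have "compose {0..1} r (compose {0..1} s \<gamma>) \<in> expaths X" by (rule is_mdmapD(4)[OF r])
  moreover have "compose {0..1} r (compose {0..1} s \<gamma>) = \<gamma>"
    using \<gamma> \<gamma>t rs by (auto simp: compose_def fun_eq_iff cmaps_def extensional_def)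
  ultimately show "\<gamma> \<in> expaths X" by simp
qed

text \<open>A cofibrant object lifts against its thickening, hence is a retract of it.\<close>

lemma cofibrant_imp_saturated:
  fixes Top :: "'u topology set"
  assumes universe: "(UNIV :: real set) \<lesssim> (UNIV :: 'u set)"
    and Top: "Top = Delta_generated_spaces \<or> Top = Delta_Hausdorff_spaces"
    and cof: "cofibrant (q_model (MdTop Top)) X"
  shows "is_mdspace Top X" "saturated X"
proof -
  let ?C = "MdTop Top"
  have HomC: "Hom (q_model ?C) = Hom ?C" by (simp add: Hom_def fun_eq_iff)
  obtain i f where i: "initial_obj (q_model ?C) i" and f: "f \<in> Hom (q_model ?C) i X" and fc: "f \<in> Cof (q_model ?C)"
    using cof unfolding cofibrant_def by blast
  show X: "is_mdspace Top X" using f by (simp add: Hom_MdTop)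
  obtain code :: "'u \<times> (nat \<Rightarrow> real) \<Rightarrow> 'u" where "inj code" using point_coding_exists[OF universe] .
  then interpret thickening code Top X
    by unfold_locales (use Top X in auto)
  let ?Z = "thicken X"
  have Z: "is_mdspace Top ?Z" by (rule is_mdspace_thicken[OF Top X])
  define p where "p = \<lparr>mdom = ?Z, mcod = X, mfun = projection\<rparr>"
  have p: "p \<in> Hom (q_model ?C) ?Z X" using X Z is_mdmap_projection by (simp add: Hom_MdTop p_def)
  then have "p \<in> {a \<in> Arr ?C. q_weq a} \<inter> {a \<in> Arr ?C. q_fib a}"
    using bij_betw_projection_states weak_homotopy_equivalence_shadow serre_fibration_shadow
    by (simp add: Hom_MdTop q_weq_def q_fib_def) (simp add: p_def)
  then have llp: "has_llp ?C f p"
    using fc by (simp add: q_model_def model_cat_of_def)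
  obtain u where u: "u \<in> Hom (q_model ?C) i ?Z"
    using i Z by (auto simp: initial_obj_def)
  have id: "Idt ?C X \<in> Hom (q_model ?C) X X" using X is_mdmap_id[OF X] by (simp add: Hom_MdTop)
  have "Cmp ?C p u \<in> Hom (q_model ?C) i X" "Cmp ?C (Idt ?C X) f \<in> Hom (q_model ?C) i X"
    using category_MdTop[of Top] u p f id unfolding category_def q_model_simps by blast+
  then have "Cmp ?C p u = Cmp ?C (Idt ?C X) f"
    using i X unfolding initial_obj_def q_model_simps MdTop_simps(1) by blast
  moreover have "Src ?C f = i" "Tgt ?C f = X" "Src ?C p = ?Z" "Tgt ?C p = X"
    using f p by (simp_all add: Hom_MdTop)
  ultimately obtain h where h: "h \<in> Hom ?C X ?Z" "Cmp ?C p h = Idt ?C X"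
    using llp u id unfolding has_llp_def HomC by metis
  have hm: "is_mdmap X ?Z (mfun h)" "mdom h = X" using h(1) by (auto simp flip: HomC simp: Hom_MdTop)
  show "saturated X"
  proof (rule saturated_retract[OF X hm(1) is_mdmap_projection saturated_thicken])
    fix x assume x: "x \<in> topspace (und X)"
    have "compose (topspace (und X)) projection (mfun h) = (\<lambda>x \<in> topspace (und X). x)"
      using h(2) hm(2) by (simp add: p_def)
    from fun_cong[OF this, of x] show "projection (mfun h x) = x" using x by (simp add: compose_def)
  qed
qed

lemma homeomorphic_maps_Ptop_map:
  assumes X: "is_mdspace Top X" and Z: "is_mdspace Top Z" and a: "is_mdmap X Z a" and b: "is_mdmap Z X b"
    and ba: "compose (topspace (und X)) b a = (\<lambda>x \<in> topspace (und X). x)"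
    and ab: "compose (topspace (und Z)) a b = (\<lambda>x \<in> topspace (und Z). x)"
  shows "homeomorphic_maps (Ptop X) (Ptop Z) (Ptop_map a) (Ptop_map b)"
proof -
  have inv: "Ptop_map g (Ptop_map f p) = p"
    if W: "path_data W" and p: "p \<in> topspace (Ptop W)"
      and fg: "compose (topspace (und W)) g f = (\<lambda>x \<in> topspace (und W). x)" for W :: "'a mdspace" and f g p
  proof -
    obtain \<gamma> where \<gamma>: "\<gamma> \<in> expaths W" "p = with_ends \<gamma>" using p by (auto simp: topspace_Ptop[OF W])
    have "compose {0..1} g (compose {0..1} f \<gamma>) = \<gamma>"
      using compose_compose_path[OF W \<gamma>(1), of g f] compose_id_path[OF W \<gamma>(1)] fg by simp
    then show ?thesis unfolding \<gamma>(2) Ptop_map_with_ends by simp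
  qed
  have X': "path_data X" and Z': "path_data Z" using X Z by (auto intro: is_mdspace_path_data)
  show ?thesis
    unfolding homeomorphic_maps_def
    using continuous_map_Ptop_map[OF X' Z' a] continuous_map_Ptop_map[OF Z' X' b] inv[OF X' _ ba] inv[OF Z' _ ab]
    by blast
qed

text \<open>Adjuncts of arrows out of a cofibrant object are obtained by composing with the unit, an
  isomorphism; this is how weak equivalences are compared with their adjuncts.\<close>

lemma q_weq_precompose_iso:
  assumes a: "a \<in> Hom (q_model (MdTop Top)) X Z" and b: "b \<in> Hom (q_model (MdTop Top)) Z X"
    and ba: "Cmp (MdTop Top) b a = Idt (MdTop Top) X" and ab: "Cmp (MdTop Top) a b = Idt (MdTop Top) Z"
    and f: "f \<in> Hom (q_model (MdTop Top)) Z Y" and w: "q_weq f"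
  shows "q_weq (Cmp (MdTop Top) f a)"
proof -
  have m: "is_mdspace Top X" "is_mdspace Top Z" "is_mdmap X Z (mfun a)" "is_mdmap Z X (mfun b)"
    "mdom a = X" "mdom b = Z" "mdom f = Z" "mcod f = Y"
    using a b f by (auto simp: Hom_MdTop)
  have ba': "compose (topspace (und X)) (mfun b) (mfun a) = (\<lambda>x \<in> topspace (und X). x)"
    and ab': "compose (topspace (und Z)) (mfun a) (mfun b) = (\<lambda>x \<in> topspace (und Z). x)"
    using ba ab m by simp_all
  have sX: "states X \<subseteq> topspace (und X)" and sZ: "states Z \<subseteq> topspace (und Z)" using m by (auto simp: is_mdspace_def)
  have inv: "mfun b (mfun a x) = x" if "x \<in> topspace (und X)" for x
    using fun_cong[OF ba', of x] that by (simp add: compose_def)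
  have inv': "mfun a (mfun b x) = x" if "x \<in> topspace (und Z)" for x
    using fun_cong[OF ab', of x] that by (simp add: compose_def)
  have "bij_betw (mfun a) (states X) (states Z)"
    by (rule bij_betw_byWitness[where f' = "mfun b"])
       (use inv inv' sX sZ is_mdmapD(3)[OF m(3)] is_mdmapD(3)[OF m(4)] in auto)
  then have "bij_betw (mfun f \<circ> mfun a) (states X) (states Y)"
    using w m by (auto simp: q_weq_def intro: bij_betw_trans)
  then have "bij_betw (compose (topspace (und X)) (mfun f) (mfun a)) (states X) (states Y)"
    by (rule bij_betw_cong[THEN iffD1, rotated]) (use sX in \<open>auto simp: compose_def\<close>)
  moreover have "weak_homotopy_equivalence (Ptop X) (Ptop Y) (Ptop_map (compose (topspace (und X)) (mfun f) (mfun a)))"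
  proof (rule weak_homotopy_equivalence_cong)
    show "weak_homotopy_equivalence (Ptop X) (Ptop Y) (Ptop_map (mfun f) \<circ> Ptop_map (mfun a))"
      by (rule weak_homotopy_equivalence_compose_homeomorphism[OF homeomorphic_maps_Ptop_map[OF m(1-4) ba' ab']])
         (use w m in \<open>simp add: q_weq_def\<close>)
    have X': "path_data X" using m by (auto intro: is_mdspace_path_data)
    fix p assume "p \<in> topspace (Ptop X)"
    then obtain \<gamma> where \<gamma>: "\<gamma> \<in> expaths X" "p = with_ends \<gamma>" by (auto simp: topspace_Ptop[OF X'])
    show "(Ptop_map (mfun f) \<circ> Ptop_map (mfun a)) p = Ptop_map (compose (topspace (und X)) (mfun f) (mfun a)) p"
      unfolding comp_apply \<gamma>(2) Ptop_map_with_ends compose_compose_path[OF X' \<gamma>(1)] by (rule refl)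
  qed
  ultimately show ?thesis using m by (simp add: q_weq_def)
qed

theorem theorem19:
  fixes Top :: "'u topology set"
    and M N :: "('u mdspace, 'u mdarr) model_cat"
  assumes universe: "(UNIV :: real set) \<lesssim> (UNIV :: 'u set)"
    and Top: "Top = Delta_generated_spaces \<or> Top = Delta_Hausdorff_spaces"
  defines "M \<equiv> q_model (MdTop Top)"
    and "N \<equiv> q_model (MdTop_sat Top)"
  shows "right_quillen_equivalence N M inclusion \<and>
    (\<forall>F \<eta> \<epsilon>. adjunction M N F inclusion \<eta> \<epsilon> \<longrightarrow>
       (\<forall>X. cofibrant M X \<longrightarrow> iso_arr M (\<eta> X)) \<and>
       (\<forall>Y. cofibrant N Y \<longrightarrow> iso_arr N (\<epsilon> Y)))"
proof (intro conjI allI impI)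
  \<comment> \<open>Fibrations and weak equivalences are the same in both categories.\<close>
  have "AMap inclusion ` Fib N \<subseteq> Fib M" "AMap inclusion ` (Fib N \<inter> Weq N) \<subseteq> Fib M \<inter> Weq M"
    by (auto simp: inclusion_def M_def N_def)
  then have rq: "right_quillen_functor N M inclusion"
    unfolding right_quillen_functor_def using saturation_adjunction[of Top] unfolding M_def N_def by blast
  show "right_quillen_equivalence N M inclusion"
    unfolding right_quillen_equivalence_def
  proof (intro conjI allI impI, rule rq, elim conjE)
    fix F \<eta> \<epsilon> X Y f
    assume adj: "adjunction M N F inclusion \<eta> \<epsilon>" and "cofibrant M X" and f: "f \<in> Hom N (OMap F X) Y"
    then have X: "is_mdspace Top X" "saturated X"
      using cofibrant_imp_saturated[OF universe Top] by (auto simp: M_def)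
    note inv = unit_counit_inverse[OF adj[unfolded M_def N_def] X]
    have \<eta>: "\<eta> X \<in> Hom (q_model (MdTop Top)) X (OMap F X)" and \<epsilon>: "\<epsilon> X \<in> Hom (q_model (MdTop Top)) (OMap F X) X"
      and fM: "f \<in> Hom (q_model (MdTop Top)) (OMap F X) Y"
      using inv(1,2) f by (auto simp: Hom_MdTop_sat N_def)
    define g where "g = Cmp (MdTop Top) f (\<eta> X)"
    have cat: "category (q_model (MdTop Top))" by (rule category_MdTop)
    have gM: "g \<in> Hom (q_model (MdTop Top)) X Y"
      using cat \<eta> fM unfolding category_def g_def q_model_simps by blast
    have "Cmp (MdTop Top) g (\<epsilon> X) = Cmp (MdTop Top) f (Cmp (MdTop Top) (\<eta> X) (\<epsilon> X))"
      using category_comp_assoc[OF cat \<epsilon> \<eta> fM] unfolding g_def q_model_simps by (rule sym)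
    also have "\<dots> = Cmp (MdTop Top) f (Idt (MdTop Top) (OMap F X))" using inv(4) by (simp only: q_model_simps)
    also have "\<dots> = f" using cat fM unfolding category_def q_model_simps by blast
    finally have "q_weq g \<Longrightarrow> q_weq f"
      using q_weq_precompose_iso[OF \<epsilon> \<eta> _ _ gM] inv(3,4) unfolding q_model_simps by metis
    moreover have "q_weq f \<Longrightarrow> q_weq g"
      using q_weq_precompose_iso[OF \<eta> \<epsilon> _ _ fM] inv(3,4) unfolding g_def q_model_simps by metis
    moreover have "f \<in> Arr N" "g \<in> Arr M"
      using f gM by (auto simp: Hom_def M_def N_def)
    moreover have "Cmp M (AMap inclusion f) (\<eta> X) = g"
      by (simp only: inclusion_def fnctr.select_convs id_apply g_def M_def q_model_simps)
    ultimately show "f \<in> Weq N \<longleftrightarrow> Cmp M (AMap inclusion f) (\<eta> X) \<in> Weq M"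
      unfolding M_def N_def by auto
  qed
next
  fix F \<eta> \<epsilon> X assume adj: "adjunction M N F inclusion \<eta> \<epsilon>" and "cofibrant M X"
  then have X: "is_mdspace Top X" "saturated X"
    using cofibrant_imp_saturated[OF universe Top] by (auto simp: M_def)
  note inv = unit_counit_inverse[OF adj[unfolded M_def N_def] X]
  have "\<eta> X \<in> Hom M X (OMap F X)" "\<epsilon> X \<in> Hom M (OMap F X) X"
    using inv(1,2) by (simp_all only: Hom_MdTop_sat M_def)
  then show "iso_arr M (\<eta> X)"
    using inv(3,4) unfolding iso_arr_def M_def[symmetric] Hom_def by auto
next
  fix F \<eta> \<epsilon> Y assume adj: "adjunction M N F inclusion \<eta> \<epsilon>" and "cofibrant N Y"
  then have Y: "is_mdspace Top Y" "saturated Y"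
    by (auto simp: cofibrant_def N_def Hom_MdTop_sat Hom_MdTop)
  note inv = unit_counit_inverse[OF adj[unfolded M_def N_def] Y, folded N_def]
  have "Cmp N (\<epsilon> Y) (\<eta> Y) = Idt N Y" "Cmp N (\<eta> Y) (\<epsilon> Y) = Idt N (OMap F Y)"
    using inv(3,4) by (simp_all only: N_def q_model_simps MdTop_sat_simps)
  then show "iso_arr N (\<epsilon> Y)"
    using inv(1,2) unfolding iso_arr_def Hom_def by auto
qed

end
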